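(* Let $f$ be a holomorphic cusp form of integer weight $k \geq 2$ on $\mathrm{SL}_2(\mathbb{Z})$ with Fourier expansion $f(z) = \sum_{n \geq 1} a(n) e^{2\pi i n z}$, and for $n\ge 1$ let $S_f(n) = \sum_{1\le m \leq n} a(m)$. Fix $\delta > \tfrac{1}{2}$. Then for $X$ sufficiently large and $y \geq 2$ with $y \ll X^{1-\delta}$, \[ \sum_{\lvert n - X \rvert < X/y} \frac{\lvert S_f(n) \rvert^2}{n^{k-1}} \ll_{\delta} \frac{X^{\frac{3}{2}}}{y} + X^{\frac{1}{2}} y^{2} (\log y)^{\frac{1}{2}}, \] where the implied constant depends on $f$ and $\delta$. In particular, taking $y = X^{\frac{1}{3}} (\log X)^{-\frac{1}{6}}$, \[ \frac{1}{X^{\frac{2}{3}} (\log X)^{\frac{1}{6}}} \sum_{\lvert n - X \rvert < X^{\frac{2}{3}}(\log X)^{\frac{1}{6}}} \frac{\lvert S_f(n) \rvert^2}{n^{k-1}} \ll X^{\frac{1}{2}}. \]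
   Context: Sums are over positive integers $n$. *)

theory Defs
  imports "HOL-Complex_Analysis.Complex_Analysis" "HOL-Library.Landau_Symbols"
begin

definition upper_half_plane :: "complex set" where
  "upper_half_plane = {z. Im z > 0}"

text \<open>The last conjunct says that \<open>f z\<close> tends to \<open>0\<close> as \<open>Im z\<close> tends to infinity, uniformly in
  \<open>Re z\<close>, i.e. that \<open>f\<close> vanishes at the only cusp. The values of \<open>f\<close> outside the upper
  half plane are irrelevant.\<close>

definition cusp_form_SL2Z :: "nat \<Rightarrow> (complex \<Rightarrow> complex) \<Rightarrow> bool" where
  "cusp_form_SL2Z k f \<longleftrightarrow>
     f holomorphic_on upper_half_plane \<and>
     (\<forall>a b c d :: int. a * d - b * c = 1 \<longrightarrow>
        (\<forall>z\<in>upper_half_plane.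
           f ((of_int a * z + of_int b) / (of_int c * z + of_int d)) =
             (of_int c * z + of_int d) ^ k * f z)) \<and>
     (f \<longlongrightarrow> 0) (filtercomap Im at_top)"

text \<open>The series starts at \<open>n = 1\<close>; the value \<open>a 0\<close> is irrelevant.\<close>

definition cusp_fourier_expansion :: "(complex \<Rightarrow> complex) \<Rightarrow> (nat \<Rightarrow> complex) \<Rightarrow> bool" where
  "cusp_fourier_expansion f a \<longleftrightarrow>
     (\<forall>z\<in>upper_half_plane.
        (\<lambda>n. a (Suc n) * exp (2 * of_real pi * \<i> * of_nat (Suc n) * z)) sums f z)"

definition coeff_sum :: "(nat \<Rightarrow> complex) \<Rightarrow> nat \<Rightarrow> complex" where
  "coeff_sum a n = (\<Sum>m=1..n. a m)"

definition short_sum :: "nat \<Rightarrow> (nat \<Rightarrow> complex) \<Rightarrow> real \<Rightarrow> real \<Rightarrow> real" where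
  "short_sum k a X H =
     (\<Sum>n | 1 \<le> n \<and> \<bar>real n - X\<bar> < H. (cmod (coeff_sum a n))\<^sup>2 / real n ^ (k - 1))"

end

theory Submission
  imports Defs "HOL-Probability.Distributions" "HOL-Real_Asymp.Real_Asymp"
begin

text \<open>In the range \<open>X powr (2/3) \<le> H \<le> X / 2\<close> one has the stronger bound \<open>O (H * X powr (1/2))\<close> for the sum over
  \<open>\<bar>n - X\<bar> < H\<close>, and smaller \<open>H\<close> are covered by monotonicity, since then the term \<open>X powr (1/2) * y\<^sup>2\<close> dominates.

  The modular relation for \<open>z\<close> and \<open>- 1 / z\<close> on the imaginary axis says that the Riesz mean
  \<open>\<Sum>m. a m * max 0 (x - m)\<close> and the Bessel series \<open>\<Sum>m. a m * (x / b\<^sub>m) powr ((k+1)/2) * J\<^sub>k\<^sub>+\<^sub>1 (2 * sqrt (b\<^sub>m * x))\<close>,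
  \<open>b\<^sub>m = 4 * pi\<^sup>2 * m\<close>, have proportional Laplace transforms, hence are proportional. As \<open>S\<^sub>f n\<close> is the increment of the
  Riesz mean over \<open>[n, n + 1]\<close>, it is the integral over this interval of the corresponding series of order
  \<open>k\<close>, truncated at \<open>m \<le> X ^ 4\<close> with an admissible error. The sum over \<open>n\<close> becomes a mean square over
  \<open>[X - H, X + H + 1]\<close> of \<open>x powr (k/2 - 1/4) * (\<Sum>m. a m * m powr (- k/2 - 1/4) * cos (4 * pi * sqrt (m * x) + \<phi>))\<close>, where the diagonal
  gives \<open>H * X powr (k - 1/2)\<close> and the off-diagonal terms \<open>X ^ k * (ln X)\<^sup>2\<close>. Only the mean bound
  \<open>\<Sum>m\<le>M. \<bar>a m\<bar>\<^sup>2 = O (M ^ k)\<close> on the coefficients is needed; it follows from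
  \<open>\<bar>f z\<bar>\<^sup>2 = O (Im z powr - k)\<close> and Bessel's inequality.\<close>

section \<open>Bessel functions of integer order\<close>

text \<open>Convergence dictates the detour. By the mean bound, \<open>a m\<close> has typical size
  m^((k-1)/2), so a Bessel series of order k for the coefficient sums themselves has terms of size
  m^(-3/4); it is not absolutely convergent and cannot be transformed termwise. One more integration
  gives m^(-5/4). Hence the identity is proved for the Riesz mean, and order k returns only after
  truncation, by averaging over [n, n + 1]. The averaging is harmless: the square of a mean is at
  most the mean of the squares, and that is what the sum over n asks for.

  The exponent 2/3 is where the two terms of the final bound meet: with H = X / y, the quantities H
  X^(1/2) and X^(1/2) y^2 agree at y = X^(1/3). The off-diagonal terms are already harmless once H
  exceeds X^(1/2) (ln X)^2. The room between X^(1/2) and X^(2/3) absorbs all logarithms, so an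
  elementary estimate of the off-diagonal sum is enough.

  Of the Bessel functions only the size and the leading oscillation matter; both come from the
  differential equation.\<close>

text \<open>A solution of \<open>v'' = (q / t\<^sup>2 - 1) v\<close> is a perturbed harmonic oscillator: the energy \<open>v\<^sup>2 + v'\<^sup>2\<close> stays
  bounded because \<open>1 / t\<^sup>2\<close> is integrable at infinity, and in the rotating frame \<open>(v, v')\<close> converges at rate \<open>1 / t\<close>.\<close>

lemma oscillating_ode_energy_bound:
  fixes v v' :: "real \<Rightarrow> real" and q t :: real
  assumes v: "\<And>t. t > 0 \<Longrightarrow> (v has_real_derivative v' t) (at t)"
    and v': "\<And>t. t > 0 \<Longrightarrow> (v' has_real_derivative (q / t\<^sup>2 - 1) * v t) (at t)"
    and t: "t \<ge> 1"
  shows "(v t)\<^sup>2 + (v' t)\<^sup>2 \<le> ((v 1)\<^sup>2 + (v' 1)\<^sup>2) * exp \<bar>q\<bar>"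
proof -
  \<comment> \<open>The energy has derivative 2 q v v' / t^2, at most \<bar>q\<bar> / t^2 times the
    energy. The factor \<open>exp (\<bar>q\<bar> / t)\<close> has logarithmic derivative -
    \<bar>q\<bar> / t^2 and so compensates the growth.\<close>
  define F where "F = (\<lambda>t. ((v t)\<^sup>2 + (v' t)\<^sup>2) * exp (\<bar>q\<bar> / t))"
  have "F t \<le> F 1"
  proof (rule DERIV_nonpos_imp_nonincreasing[OF t])
    fix x :: real assume x: "1 \<le> x" "x \<le> t"
    have "(F has_real_derivative
       (2 * q / x\<^sup>2 * (v x * v' x) - \<bar>q\<bar> / x\<^sup>2 * ((v x)\<^sup>2 + (v' x)\<^sup>2)) * exp (\<bar>q\<bar> / x)) (at x)"
      unfolding F_def using x
      by (auto intro!: derivative_eq_intros v v' simp: field_simps power2_eq_square)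
    moreover have "2 * q * (v x * v' x) \<le> \<bar>q\<bar> * ((v x)\<^sup>2 + (v' x)\<^sup>2)"
    proof -
      have "2 * \<bar>v x * v' x\<bar> \<le> (v x)\<^sup>2 + (v' x)\<^sup>2"
        using sum_squares_bound[of "\<bar>v x\<bar>" "\<bar>v' x\<bar>"] by (simp add: abs_mult)
      then have "\<bar>q\<bar> * (2 * \<bar>v x * v' x\<bar>) \<le> \<bar>q\<bar> * ((v x)\<^sup>2 + (v' x)\<^sup>2)"
        by (intro mult_left_mono) auto
      moreover have "q * (v x * v' x) \<le> \<bar>q\<bar> * \<bar>v x * v' x\<bar>"
        by (metis abs_ge_self abs_mult)
      ultimately show ?thesis by linarith
    qed
    then have "2 * q / x\<^sup>2 * (v x * v' x) - \<bar>q\<bar> / x\<^sup>2 * ((v x)\<^sup>2 + (v' x)\<^sup>2) \<le> 0"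
      using x by (simp add: divide_simps)
    then have "(2 * q / x\<^sup>2 * (v x * v' x) - \<bar>q\<bar> / x\<^sup>2 * ((v x)\<^sup>2 + (v' x)\<^sup>2)) * exp (\<bar>q\<bar> / x) \<le> 0"
      by (simp add: mult_le_0_iff)
    ultimately show "\<exists>y. (F has_real_derivative y) (at x) \<and> y \<le> 0" by blast
  qed
  moreover have "(v t)\<^sup>2 + (v' t)\<^sup>2 \<le> F t"
    unfolding F_def using t mult_left_mono[of 1 "exp (\<bar>q\<bar> / t)" "(v t)\<^sup>2 + (v' t)\<^sup>2"] by simp
  ultimately show ?thesis by (simp add: F_def)
qed

text \<open>\<open>A t + K / t\<close> decreases and \<open>A t - K / t\<close> increases, so the
  intervals they bound are nested; the supremum of the left ends lies in all of them. This yields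
  limit and rate at once, without integrating \<open>A'\<close>.\<close>

lemma derivative_inverse_square_bound_imp_limit:
  fixes A A' :: "real \<Rightarrow> real"
  assumes A: "\<And>t. t \<ge> 1 \<Longrightarrow> (A has_real_derivative A' t) (at t)"
    and A': "\<And>t. t \<ge> 1 \<Longrightarrow> \<bar>A' t\<bar> \<le> K / t\<^sup>2"
  shows "\<exists>\<alpha>. \<forall>t\<ge>1. \<bar>A t - \<alpha>\<bar> \<le> K / t"
proof -
  have dec: "A t + K / t \<le> A s + K / s" if "1 \<le> s" "s \<le> t" for s t
  proof (rule DERIV_nonpos_imp_nonincreasing[OF that(2)])
    fix x assume "s \<le> x" "x \<le> t"
    then have x: "x \<ge> 1" using that by simp
    have "((\<lambda>t. A t + K / t) has_real_derivative (A' x - K / x\<^sup>2)) (at x)"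
      using x by (auto intro!: derivative_eq_intros A simp: power2_eq_square)
    then show "\<exists>y. ((\<lambda>t. A t + K / t) has_real_derivative y) (at x) \<and> y \<le> 0"
      using A'[OF x] by (intro exI[of _ "A' x - K / x\<^sup>2"]) auto
  qed
  have inc: "A s - K / s \<le> A t - K / t" if "1 \<le> s" "s \<le> t" for s t
  proof (rule DERIV_nonneg_imp_nondecreasing[OF that(2)])
    fix x assume "s \<le> x" "x \<le> t"
    then have x: "x \<ge> 1" using that by simp
    have "((\<lambda>t. A t - K / t) has_real_derivative (A' x + K / x\<^sup>2)) (at x)"
      using x by (auto intro!: derivative_eq_intros A simp: power2_eq_square)
    then show "\<exists>y. ((\<lambda>t. A t - K / t) has_real_derivative y) (at x) \<and> y \<ge> 0"
      using A'[OF x] by (intro exI[of _ "A' x + K / x\<^sup>2"]) auto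
  qed
  have K: "K \<ge> 0" using A'[of 1] by simp
  have cross: "A s - K / s \<le> A t + K / t" if "1 \<le> s" "1 \<le> t" for s t
  proof -
    have "K / max s t \<ge> 0" using K that by simp
    then show ?thesis
      using inc[OF that(1), of "max s t"] dec[OF that(2), of "max s t"] by linarith
  qed
  define \<alpha> where "\<alpha> = (SUP s\<in>{1..}. A s - K / s)"
  have "bdd_above ((\<lambda>s. A s - K / s) ` {1..})"
    using cross[of _ 1] by (intro bdd_aboveI[of _ "A 1 + K / 1"]) auto
  then have "A t - K / t \<le> \<alpha>" if "t \<ge> 1" for t
    unfolding \<alpha>_def using that by (intro cSUP_upper) auto
  moreover have "\<alpha> \<le> A t + K / t" if "t \<ge> 1" for t
    unfolding \<alpha>_def using that cross by (intro cSUP_least) auto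
  ultimately show ?thesis
    by (intro exI[of _ \<alpha>]) (fastforce simp: abs_le_iff)
qed

lemma oscillating_ode_asymptotics:
  fixes v v' :: "real \<Rightarrow> real" and q :: real
  assumes v: "\<And>t. t > 0 \<Longrightarrow> (v has_real_derivative v' t) (at t)"
    and v': "\<And>t. t > 0 \<Longrightarrow> (v' has_real_derivative (q / t\<^sup>2 - 1) * v t) (at t)"
  shows "\<exists>\<alpha> \<beta> C. \<forall>t\<ge>1. \<bar>v t - (\<alpha> * cos t + \<beta> * sin t)\<bar> \<le> C / t"
proof -
  define B where "B = sqrt (((v 1)\<^sup>2 + (v' 1)\<^sup>2) * exp \<bar>q\<bar>)"
  have B: "\<bar>v t\<bar> \<le> B" if "t \<ge> 1" for t
  proof -
    have "(v t)\<^sup>2 \<le> ((v 1)\<^sup>2 + (v' 1)\<^sup>2) * exp \<bar>q\<bar>"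
      using oscillating_ode_energy_bound[OF v v' that] zero_le_power2[of "v' t"] by linarith
    then show ?thesis unfolding B_def using real_le_rsqrt[of "\<bar>v t\<bar>"] by simp
  qed
  have small: "\<bar>q / t\<^sup>2 * v t * w\<bar> \<le> \<bar>q\<bar> * B / t\<^sup>2" if "t \<ge> 1" "\<bar>w\<bar> \<le> 1" for t w
  proof -
    have "\<bar>v t\<bar> * \<bar>w\<bar> \<le> B * 1"
      using B[OF that(1)] that by (intro mult_mono) auto
    then have "\<bar>q\<bar> / t\<^sup>2 * (\<bar>v t\<bar> * \<bar>w\<bar>) \<le> \<bar>q\<bar> / t\<^sup>2 * B"
      by (intro mult_left_mono) auto
    then show ?thesis by (simp add: abs_mult mult_ac)
  qed
  \<comment> \<open>For v'' = - v this combination and its companion below, with sin t and cos t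
    exchanged, are constant. For the perturbed equation only the term with q / t^2 survives in their
    derivatives.\<close>
  have "\<exists>\<alpha>. \<forall>t\<ge>1. \<bar>(v t * cos t - v' t * sin t) - \<alpha>\<bar> \<le> \<bar>q\<bar> * B / t"
  proof (rule derivative_inverse_square_bound_imp_limit)
    fix t :: real assume t: "t \<ge> 1"
    show "((\<lambda>t. v t * cos t - v' t * sin t) has_real_derivative q / t\<^sup>2 * v t * (- sin t)) (at t)"
      using t by (auto intro!: derivative_eq_intros v v' simp: field_simps)
    show "\<bar>q / t\<^sup>2 * v t * (- sin t)\<bar> \<le> \<bar>q\<bar> * B / t\<^sup>2" by (rule small[OF t]) simp
  qed
  then obtain \<alpha> where \<alpha>: "\<And>t. t \<ge> 1 \<Longrightarrow> \<bar>(v t * cos t - v' t * sin t) - \<alpha>\<bar> \<le> \<bar>q\<bar> * B / t" by blast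
  have "\<exists>\<alpha>. \<forall>t\<ge>1. \<bar>(v t * sin t + v' t * cos t) - \<alpha>\<bar> \<le> \<bar>q\<bar> * B / t"
  proof (rule derivative_inverse_square_bound_imp_limit)
    fix t :: real assume t: "t \<ge> 1"
    show "((\<lambda>t. v t * sin t + v' t * cos t) has_real_derivative q / t\<^sup>2 * v t * cos t) (at t)"
      using t by (auto intro!: derivative_eq_intros v v' simp: field_simps)
    show "\<bar>q / t\<^sup>2 * v t * cos t\<bar> \<le> \<bar>q\<bar> * B / t\<^sup>2" by (rule small[OF t]) simp
  qed
  then obtain \<beta> where \<beta>: "\<And>t. t \<ge> 1 \<Longrightarrow> \<bar>(v t * sin t + v' t * cos t) - \<beta>\<bar> \<le> \<bar>q\<bar> * B / t" by blast
  have "\<bar>v t - (\<alpha> * cos t + \<beta> * sin t)\<bar> \<le> (2 * \<bar>q\<bar> * B) / t" if t: "t \<ge> 1" for t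
  proof -
    define a where "a = (v t * cos t - v' t * sin t) - \<alpha>"
    define b where "b = (v t * sin t + v' t * cos t) - \<beta>"
    have "a * cos t + b * sin t = v t * ((sin t)\<^sup>2 + (cos t)\<^sup>2) - (\<alpha> * cos t + \<beta> * sin t)"
      unfolding a_def b_def by (simp only: algebra_simps power2_eq_square)
    then have "v t - (\<alpha> * cos t + \<beta> * sin t) = a * cos t + b * sin t" by simp
    also have "\<bar>\<dots>\<bar> \<le> \<bar>a\<bar> * \<bar>cos t\<bar> + \<bar>b\<bar> * \<bar>sin t\<bar>"
      by (metis abs_mult abs_triangle_ineq)
    also have "\<dots> \<le> \<bar>a\<bar> * 1 + \<bar>b\<bar> * 1"
      by (intro add_mono mult_left_mono) auto
    also have "\<dots> \<le> \<bar>q\<bar> * B / t + \<bar>q\<bar> * B / t"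
      using add_mono[OF \<alpha>[OF t] \<beta>[OF t]] by (simp only: mult_1_right a_def b_def)
    finally show ?thesis by (simp add: mult_ac)
  qed
  then show ?thesis by blast
qed

text \<open>The Bessel function is J_n t = (t / 2)^n *
  \<open>bessel_clifford n (- (t\<^sup>2 / 4))\<close>. In this entire form differentiation merely
  raises the index.\<close>

definition bessel_clifford :: "nat \<Rightarrow> real \<Rightarrow> real" where
  "bessel_clifford n x = (\<Sum>j. x ^ j / (fact j * fact (n + j)))"

lemma summable_bessel_clifford: "summable (\<lambda>j. x ^ j / (fact j * fact (n + j)) :: real)"
proof (rule summable_comparison_test')
  show "summable (\<lambda>j. inverse (fact j) * \<bar>x\<bar> ^ j)" by (rule summable_exp)
  fix j :: nat
  have "(1::real) \<le> fact (n + j)" by (simp add: fact_ge_1)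
  then have "\<bar>x\<bar> ^ j / (fact j * fact (n + j)) \<le> \<bar>x\<bar> ^ j / (fact j * 1)"
    by (intro divide_left_mono mult_left_mono) auto
  then show "norm (x ^ j / (fact j * fact (n + j))) \<le> inverse (fact j) * \<bar>x\<bar> ^ j"
    by (simp add: abs_mult power_abs field_simps)
qed

lemma abs_bessel_clifford_le: "\<bar>bessel_clifford n x\<bar> \<le> exp \<bar>x\<bar>"
proof -
  have le: "\<bar>x ^ j / (fact j * fact (n + j))\<bar> \<le> \<bar>x\<bar> ^ j / fact j" for j
  proof -
    have "(1::real) \<le> fact (n + j)" by (simp add: fact_ge_1)
    then have "\<bar>x\<bar> ^ j / (fact j * fact (n + j)) \<le> \<bar>x\<bar> ^ j / (fact j * 1)"
      by (intro divide_left_mono mult_left_mono) auto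
    then show ?thesis by (simp add: abs_mult power_abs)
  qed
  have e: "(\<lambda>j. \<bar>x\<bar> ^ j / fact j) sums exp \<bar>x\<bar>"
    using exp_converges[of "\<bar>x\<bar>"] by (simp add: field_simps)
  have s: "summable (\<lambda>j. \<bar>x ^ j / (fact j * fact (n + j))\<bar>)"
    by (rule summable_comparison_test'[OF sums_summable[OF e], of 0]) (use le in simp)
  have "\<bar>bessel_clifford n x\<bar> \<le> (\<Sum>j. \<bar>x ^ j / (fact j * fact (n + j))\<bar>)"
    unfolding bessel_clifford_def by (rule summable_rabs[OF s])
  also have "\<dots> \<le> exp \<bar>x\<bar>"
    using suminf_le[OF le s sums_summable[OF e]] sums_unique[OF e] by simp
  finally show ?thesis .
qed

lemma has_real_derivative_bessel_clifford:
  "(bessel_clifford n has_real_derivative bessel_clifford (Suc n) x) (at x)"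
proof -
  define c :: "nat \<Rightarrow> real" where "c = (\<lambda>j. inverse (fact j * fact (n + j)))"
  have "((\<lambda>x. \<Sum>j. c j * x ^ j) has_real_derivative (\<Sum>j. diffs c j * x ^ j)) (at x)"
    by (rule termdiffs_strong_converges_everywhere)
       (use summable_bessel_clifford[of _ n] in \<open>simp add: c_def field_simps\<close>)
  moreover have "diffs c = (\<lambda>j. inverse (fact j * fact (Suc n + j)))"
    by (auto simp: diffs_def c_def fun_eq_iff divide_simps)
  ultimately show ?thesis
    by (simp add: c_def bessel_clifford_def[abs_def] field_simps)
qed

text \<open>As each derivative raises the index by one, this is the differential equation x y'' + (n
  + 1) y' = y for y = \<open>bessel_clifford n\<close>. It follows by comparing coefficients of
  x^(j+1), the constant terms being compared separately.\<close>

lemma bessel_clifford_recurrence: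
  "x * bessel_clifford (Suc (Suc n)) x + real (Suc n) * bessel_clifford (Suc n) x = bessel_clifford n x"
proof -
  let ?t = "\<lambda>n j. x ^ j / (fact j * fact (n + j))"
  have s: "?t n sums bessel_clifford n x" for n
    unfolding bessel_clifford_def using summable_bessel_clifford by (rule summable_sums)
  have eq: "x * ?t (Suc (Suc n)) j + real (Suc n) * ?t (Suc n) (Suc j) = ?t n (Suc j)" for j
  proof -
    define A :: real where "A = fact (n + Suc j)"
    define B :: real where "B = fact j"
    have "A > 0" "B > 0" by (simp_all add: A_def B_def)
    have f: "fact (Suc (Suc n) + j) = (real n + real j + 2) * A"
       "fact (Suc n + Suc j) = (real n + real j + 2) * A" "fact (Suc j) = (real j + 1) * B"
      by (simp_all add: A_def B_def algebra_simps)
    have "x * (x ^ j / (B * ((real n + real j + 2) * A))) + real (Suc n) *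
       (x ^ Suc j / ((real j + 1) * B * ((real n + real j + 2) * A))) =
       x ^ Suc j / ((real j + 1) * B * A) * ((real j + 1) + real (Suc n)) / (real n + real j + 2)"
      using \<open>A > 0\<close> \<open>B > 0\<close> by (simp add: divide_simps add_pos_nonneg) (simp add: algebra_simps)?
    also have "\<dots> = x ^ Suc j / ((real j + 1) * B * A)" by (simp add: add_ac)
    finally show ?thesis by (simp only: f A_def[symmetric] B_def[symmetric])
  qed
  have "(\<lambda>j. x * ?t (Suc (Suc n)) j + real (Suc n) * ?t (Suc n) (Suc j)) sums
     (x * bessel_clifford (Suc (Suc n)) x + real (Suc n) * (bessel_clifford (Suc n) x - ?t (Suc n) 0))"
    by (intro sums_add sums_mult s) (use s[of "Suc n"] in \<open>subst sums_Suc_iff, simp\<close>)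
  moreover have "(\<lambda>j. ?t n (Suc j)) sums (bessel_clifford n x - ?t n 0)"
    using s[of n] by (subst sums_Suc_iff) simp
  ultimately have "x * bessel_clifford (Suc (Suc n)) x +
      real (Suc n) * (bessel_clifford (Suc n) x - ?t (Suc n) 0) = bessel_clifford n x - ?t n 0"
    unfolding eq by (rule sums_unique2)
  moreover have "real (Suc n) * ?t (Suc n) 0 = ?t n 0" by (simp del: of_nat_Suc)
  ultimately show ?thesis by (simp add: right_diff_distrib)
qed

text \<open>In terms of the Bessel function this is \<open>2 ^ n * sqrt t * J\<^sub>n t\<close>.\<close>

definition bessel_osc :: "nat \<Rightarrow> real \<Rightarrow> real" where
  "bessel_osc n t = t powr (real n + 1/2) * bessel_clifford n (- (t\<^sup>2 / 4))"

lemma bessel_osc_ode: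
  obtains v' where "\<And>t. t > 0 \<Longrightarrow> (bessel_osc n has_real_derivative v' t) (at t)"
    and "\<And>t. t > 0 \<Longrightarrow> (v' has_real_derivative ((real n ^ 2 - 1/4) / t\<^sup>2 - 1) * bessel_osc n t) (at t)"
proof -
  define p where "p = real n + 1/2"
  define c where "c = (\<lambda>j t. bessel_clifford (n + j) (- (t\<^sup>2 / 4)))"
  have c: "(c j has_real_derivative - (t / 2) * c (Suc j) t) (at t)" for j t
  proof -
    have "((\<lambda>t::real. - (t\<^sup>2 / 4)) has_real_derivative - (t / 2)) (at t)"
      by (auto intro!: derivative_eq_intros)
    from DERIV_chain2[OF has_real_derivative_bessel_clifford this]
    show ?thesis by (simp add: c_def mult_ac)
  qed
  have v: "bessel_osc n = (\<lambda>t. t powr p * c 0 t)"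
    by (simp add: fun_eq_iff bessel_osc_def p_def c_def)
  define v' where "v' = (\<lambda>t. p * t powr (p - 1) * c 0 t - t powr (p + 1) / 2 * c 1 t)"
  have P: "t powr (p + 1) = t * t powr p" "t powr (p - 1) = t powr p / t" "t powr (p - 2) = t powr p / t\<^sup>2"
     "t powr (p - 1 - 1) = t powr p / t\<^sup>2" if "t > 0" for t :: real
    using that by (simp_all add: powr_add powr_diff power2_eq_square)
  show ?thesis
  proof
    fix t :: real assume t: "t > 0"
    have d: "((\<lambda>t. t powr r) has_real_derivative r * t powr (r - 1)) (at t)" for r
      using t by (rule has_real_derivative_powr)
    show "(bessel_osc n has_real_derivative v' t) (at t)"
      unfolding v v'_def by (rule DERIV_cong[OF DERIV_mult[OF d c]]) (simp add: P[OF t])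
    \<comment> \<open>The recurrence at - t^2 / 4; the coefficient p + 1/2 is n + 1.\<close>
    have rec: "c 0 t = - (t\<^sup>2 / 4) * c 2 t + (p + 1/2) * c 1 t"
      using bessel_clifford_recurrence[of "- (t\<^sup>2 / 4)" n] by (simp add: c_def p_def numeral_2_eq_2)
    have "(v' has_real_derivative p * ((p - 1) * t powr (p - 2)) * c 0 t
        + p * t powr (p - 1) * (- (t / 2) * c 1 t)
        - ((p + 1) * t powr p / 2 * c 1 t + t powr (p + 1) / 2 * (- (t / 2) * c 2 t))) (at t)"
      unfolding v'_def
      by (rule DERIV_cong[OF DERIV_diff[OF DERIV_mult[OF DERIV_cmult[OF d] c] DERIV_mult[OF DERIV_cdivide[OF d] c]]])
         (simp add: numeral_2_eq_2 mult_ac)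
    also have "p * ((p - 1) * t powr (p - 2)) * c 0 t
        + p * t powr (p - 1) * (- (t / 2) * c 1 t)
        - ((p + 1) * t powr p / 2 * c 1 t + t powr (p + 1) / 2 * (- (t / 2) * c 2 t))
       = t powr p * (p * (p - 1) / t\<^sup>2 * c 0 t - (- (t\<^sup>2 / 4) * c 2 t + (p + 1/2) * c 1 t))"
    proof -
      have "p * ((p - 1) * (T / t\<^sup>2)) * c\<^sub>0 + p * (T / t) * (- (t / 2) * c\<^sub>1)
          - ((p + 1) * T / 2 * c\<^sub>1 + t * T / 2 * (- (t / 2) * c\<^sub>2))
        = T * (p * (p - 1) / t\<^sup>2 * c\<^sub>0 - (- (t\<^sup>2 / 4) * c\<^sub>2 + (p + 1/2) * c\<^sub>1))" for T c\<^sub>0 c\<^sub>1 c\<^sub>2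
        using t by (simp add: divide_simps power2_eq_square) (simp add: algebra_simps)
      then show ?thesis by (simp only: P[OF t])
    qed
    also have "\<dots> = (p * (p - 1) / t\<^sup>2 - 1) * bessel_osc n t"
      unfolding rec[symmetric] v by (simp add: algebra_simps)
    also have "p * (p - 1) = real n ^ 2 - 1/4"
      by (simp add: p_def algebra_simps power2_eq_square)
    finally show "(v' has_real_derivative ((real n ^ 2 - 1/4) / t\<^sup>2 - 1) * bessel_osc n t) (at t)" .
  qed
qed

lemma bessel_osc_asymptotics:
  "\<exists>\<alpha> \<beta> C. \<forall>t\<ge>1. \<bar>bessel_osc n t - (\<alpha> * cos t + \<beta> * sin t)\<bar> \<le> C / t"
  by (rule bessel_osc_ode[of n]) (rule oscillating_ode_asymptotics)

text \<open>For t at least 1 the asymptotics apply. Below 1, where D / t type errors are useless,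
  the power of t is at most 1 and the series is dominated by the exponential series.\<close>

lemma bessel_osc_bounded: "\<exists>C. \<forall>t>0. \<bar>bessel_osc n t\<bar> \<le> C"
proof -
  obtain \<alpha> \<beta> C where C: "\<And>t. t \<ge> 1 \<Longrightarrow> \<bar>bessel_osc n t - (\<alpha> * cos t + \<beta> * sin t)\<bar> \<le> C / t"
    using bessel_osc_asymptotics by blast
  have C0: "C \<ge> 0" using C[of 1] by simp
  have "\<bar>bessel_osc n t\<bar> \<le> C + \<bar>\<alpha>\<bar> + \<bar>\<beta>\<bar> + exp 1" if t: "t > 0" for t
  proof (cases "t \<ge> 1")
    case True
    have "\<bar>\<alpha> * cos t + \<beta> * sin t\<bar> \<le> \<bar>\<alpha>\<bar> * \<bar>cos t\<bar> + \<bar>\<beta>\<bar> * \<bar>sin t\<bar>"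
      by (metis abs_mult abs_triangle_ineq)
    also have "\<dots> \<le> \<bar>\<alpha>\<bar> * 1 + \<bar>\<beta>\<bar> * 1"
      by (intro add_mono mult_left_mono) auto
    finally have "\<bar>bessel_osc n t\<bar> \<le> C / t + \<bar>\<alpha>\<bar> + \<bar>\<beta>\<bar>"
      using C[OF True] by linarith
    moreover have "C / t \<le> C / 1" using True C0 by (intro divide_left_mono) auto
    ultimately show ?thesis using exp_gt_zero[of "1::real"] by linarith
  next
    case False
    have "t powr (real n + 1/2) \<le> 1" using False t by (intro powr_le1) auto
    moreover have "t\<^sup>2 \<le> 1" using False t by (simp add: power_le_one)
    then have "exp \<bar>- (t\<^sup>2 / 4)\<bar> \<le> exp 1" by simp
    then have "\<bar>bessel_clifford n (- (t\<^sup>2 / 4))\<bar> \<le> exp 1"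
      using abs_bessel_clifford_le[of n "- (t\<^sup>2 / 4)"] by linarith
    ultimately have "\<bar>bessel_osc n t\<bar> \<le> 1 * exp 1"
      unfolding bessel_osc_def abs_mult by (intro mult_mono) auto
    then show ?thesis using C0 by linarith
  qed
  then show ?thesis by blast
qed

text \<open>This is \<open>(x / b) powr (n / 2) * J\<^sub>n (2 * sqrt (b * x))\<close>; raising \<open>n\<close> by one amounts to integrating in \<open>x\<close>.\<close>

definition voronoi_kernel :: "nat \<Rightarrow> real \<Rightarrow> real \<Rightarrow> real" where
  "voronoi_kernel n b x = x ^ n * bessel_clifford n (- (b * x))"

lemma has_real_derivative_voronoi_kernel:
  "(voronoi_kernel (Suc n) b has_real_derivative voronoi_kernel n b x) (at x)"
proof -
  have "(voronoi_kernel (Suc n) b has_real_derivative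
      real (Suc n) * x ^ n * bessel_clifford (Suc n) (- (b * x)) +
      x ^ Suc n * (- b * bessel_clifford (Suc (Suc n)) (- (b * x)))) (at x)"
    unfolding voronoi_kernel_def[abs_def]
    by (rule derivative_eq_intros DERIV_chain2[OF has_real_derivative_bessel_clifford] refl | simp)+
  also have "real (Suc n) * x ^ n * bessel_clifford (Suc n) (- (b * x)) +
      x ^ Suc n * (- b * bessel_clifford (Suc (Suc n)) (- (b * x))) = voronoi_kernel n b x"
    unfolding voronoi_kernel_def bessel_clifford_recurrence[of "- (b * x)" n, symmetric]
    by (simp add: algebra_simps)
  finally show ?thesis .
qed

lemma continuous_on_voronoi_kernel: "continuous_on A (voronoi_kernel n b)"
proof -
  have "isCont (voronoi_kernel n b) x" for x
    unfolding voronoi_kernel_def[abs_def]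
    by (intro continuous_intros isCont_o2[OF _ DERIV_isCont[OF has_real_derivative_bessel_clifford]])
  then show ?thesis by (simp add: continuous_at_imp_continuous_on)
qed

lemma voronoi_kernel_eq_bessel_osc:
  assumes "b > 0" "x > 0"
  shows "voronoi_kernel n b x = 2 powr (- real n - 1/2) * x powr (real n / 2 - 1/4) *
    b powr (- real n / 2 - 1/4) * bessel_osc n (2 * sqrt (b * x))"
proof -
  define p where "p = real n + 1/2"
  have "(2 * sqrt (b * x)) powr p = 2 powr p * b powr (p / 2) * x powr (p / 2)"
    using assms by (simp add: powr_mult powr_half_sqrt[symmetric] powr_powr)
  moreover have "(2 * sqrt (b * x))\<^sup>2 / 4 = b * x" using assms by (simp add: power_mult_distrib)
  ultimately have "bessel_osc n (2 * sqrt (b * x)) = 2 powr p * b powr (p / 2) * x powr (p / 2) * bessel_clifford n (- (b * x))"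
    by (simp add: bessel_osc_def p_def)
  moreover have "- real n - 1/2 = - p" "real n / 2 - 1/4 = real n - p / 2" "- real n / 2 - 1/4 = - (p / 2)"
    by (simp_all add: p_def field_simps)
  ultimately show ?thesis
    using assms unfolding voronoi_kernel_def
    by (simp only: powr_minus powr_diff powr_realpow) (simp add: field_simps)
qed

lemma voronoi_kernel_bound:
  "\<exists>C. \<forall>b>0. \<forall>x>0. \<bar>voronoi_kernel n b x\<bar> \<le> C * x powr (real n / 2 - 1/4) * b powr (- real n / 2 - 1/4)"
proof -
  obtain C where C: "\<And>t. t > 0 \<Longrightarrow> \<bar>bessel_osc n t\<bar> \<le> C" using bessel_osc_bounded by blast
  have "\<bar>voronoi_kernel n b x\<bar> \<le> (2 powr (- real n - 1/2) * C) * x powr (real n / 2 - 1/4) * b powr (- real n / 2 - 1/4)"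
    if "b > 0" "x > 0" for b x
  proof -
    have "\<bar>voronoi_kernel n b x\<bar> = (2 powr (- real n - 1/2) * x powr (real n / 2 - 1/4) *
      b powr (- real n / 2 - 1/4)) * \<bar>bessel_osc n (2 * sqrt (b * x))\<bar>"
      using that by (simp add: voronoi_kernel_eq_bessel_osc abs_mult)
    also have "\<dots> \<le> (2 powr (- real n - 1/2) * x powr (real n / 2 - 1/4) * b powr (- real n / 2 - 1/4)) * C"
      using that by (intro mult_left_mono C) auto
    finally show ?thesis by (simp add: mult_ac)
  qed
  then show ?thesis by blast
qed

section \<open>Coefficients of cusp forms\<close>

text \<open>The weight \<open>\<phi>'\<close> is the Jacobian of the substitution u =
  \<open>\<phi> x\<close>, which makes the oscillating integral elementary; no stationary phase
  argument is required.\<close>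

lemma has_integral_cis_phase:
  fixes \<phi> \<phi>' :: "real \<Rightarrow> real" and \<mu> A B :: real
  assumes AB: "A \<le> B" and "\<mu> \<noteq> 0"
    and \<phi>: "\<And>x. x \<in> {A..B} \<Longrightarrow> (\<phi> has_real_derivative \<phi>' x) (at x within {A..B})"
  shows "((\<lambda>x. cis (\<mu> * \<phi> x) * of_real (\<phi>' x)) has_integral
           (cis (\<mu> * \<phi> B) - cis (\<mu> * \<phi> A)) / (\<i> * of_real \<mu>)) {A..B}"
proof -
  have "((\<lambda>x. cis (\<mu> * \<phi> x) * of_real (\<phi>' x)) has_integral
      (cis (\<mu> * \<phi> B) / (\<i> * of_real \<mu>) - cis (\<mu> * \<phi> A) / (\<i> * of_real \<mu>))) {A..B}"
  proof (rule fundamental_theorem_of_calculus[OF AB])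
    fix x assume x: "x \<in> {A..B}"
    have 1: "((\<lambda>x. \<i> * of_real (\<mu> * \<phi> x)) has_vector_derivative \<i> * of_real (\<mu> * \<phi>' x)) (at x within {A..B})"
      using \<phi>[OF x] by (intro has_vector_derivative_mult_right has_vector_derivative_of_real) 
        (auto intro!: derivative_eq_intros simp: has_real_derivative_iff_has_vector_derivative[symmetric])
    have 2: "((\<lambda>z. exp z / (\<i> * of_real \<mu>)) has_field_derivative exp (\<i> * of_real (\<mu> * \<phi> x)) / (\<i> * of_real \<mu>))
        (at (\<i> * of_real (\<mu> * \<phi> x)) within (\<lambda>x. \<i> * of_real (\<mu> * \<phi> x)) ` {A..B})"
      using \<open>\<mu> \<noteq> 0\<close> by (auto intro!: derivative_eq_intros)
    show "((\<lambda>x. cis (\<mu> * \<phi> x) / (\<i> * of_real \<mu>)) has_vector_derivative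
        cis (\<mu> * \<phi> x) * of_real (\<phi>' x)) (at x within {A..B})"
      using field_vector_diff_chain_within[OF 1 2] \<open>\<mu> \<noteq> 0\<close>
      by (simp add: o_def cis_conv_exp field_simps)
  qed
  then show ?thesis by (simp add: diff_divide_distrib)
qed

text \<open>Serves two purposes: the identity as phase gives Parseval on the unit interval, and the
  phase sqrt x gives the mean square of the truncated Voronoi series.\<close>

lemma has_integral_norm_exponential_sum_squared:
  fixes \<phi> \<phi>' :: "real \<Rightarrow> real" and c :: "'i \<Rightarrow> complex" and L :: "'i \<Rightarrow> real"
  assumes "finite I" "inj_on L I" "A \<le> B"
    and \<phi>: "\<And>x. x \<in> {A..B} \<Longrightarrow> (\<phi> has_real_derivative \<phi>' x) (at x within {A..B})"
  shows "((\<lambda>x. of_real ((cmod (\<Sum>m\<in>I. c m * cis (L m * \<phi> x)))\<^sup>2 * \<phi>' x)) has_integral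
     (\<Sum>m\<in>I. \<Sum>n\<in>I. c m * cnj (c n) * (if m = n then of_real (\<phi> B - \<phi> A)
        else (cis ((L m - L n) * \<phi> B) - cis ((L m - L n) * \<phi> A)) / (\<i> * of_real (L m - L n))))) {A..B}"
proof -
  have eq: "of_real ((cmod (\<Sum>m\<in>I. c m * cis (L m * \<phi> x)))\<^sup>2 * \<phi>' x) =
     (\<Sum>m\<in>I. \<Sum>n\<in>I. c m * cnj (c n) * (cis ((L m - L n) * \<phi> x) * of_real (\<phi>' x)))" for x
  proof -
    have "of_real ((cmod (\<Sum>m\<in>I. c m * cis (L m * \<phi> x)))\<^sup>2 * \<phi>' x) =
       (\<Sum>m\<in>I. c m * cis (L m * \<phi> x)) * cnj (\<Sum>m\<in>I. c m * cis (L m * \<phi> x)) * of_real (\<phi>' x)"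
      by (simp only: complex_norm_square of_real_mult)
    also have "\<dots> = (\<Sum>m\<in>I. \<Sum>n\<in>I. (c m * cis (L m * \<phi> x)) * cnj (c n * cis (L n * \<phi> x)) * of_real (\<phi>' x))"
      unfolding cnj_sum sum_product by (simp only: sum_distrib_right)
    also have "\<dots> = (\<Sum>m\<in>I. \<Sum>n\<in>I. c m * cnj (c n) * (cis ((L m - L n) * \<phi> x) * of_real (\<phi>' x)))"
    proof (intro sum.cong refl)
      fix m n
      have "cis (L m * \<phi> x) * cnj (cis (L n * \<phi> x)) = cis ((L m - L n) * \<phi> x)"
        by (simp add: cis_mult cis_cnj algebra_simps)
      then show "(c m * cis (L m * \<phi> x)) * cnj (c n * cis (L n * \<phi> x)) * of_real (\<phi>' x) =
        c m * cnj (c n) * (cis ((L m - L n) * \<phi> x) * of_real (\<phi>' x))"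
        by (simp flip: mult.assoc)
    qed
    finally show ?thesis .
  qed
  have diag: "((\<lambda>x. complex_of_real (\<phi>' x)) has_integral of_real (\<phi> B - \<phi> A)) {A..B}"
    using \<phi> \<open>A \<le> B\<close>
    by (intro has_integral_of_real fundamental_theorem_of_calculus)
       (auto simp: has_real_derivative_iff_has_vector_derivative)
  show ?thesis
    unfolding eq
  proof (intro has_integral_sum assms(1) has_integral_mult_right)
    fix m n assume mn: "m \<in> I" "n \<in> I"
    show "((\<lambda>x. cis ((L m - L n) * \<phi> x) * of_real (\<phi>' x)) has_integral
      (if m = n then of_real (\<phi> B - \<phi> A) else (cis ((L m - L n) * \<phi> B) - cis ((L m - L n) * \<phi> A)) /
          (\<i> * of_real (L m - L n)))) {A..B}"
    proof (cases "m = n")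
      case True then show ?thesis using diag by simp
    next
      case False
      then have "L m - L n \<noteq> 0" using assms(2) mn by (auto simp: inj_on_def)
      from has_integral_cis_phase[OF \<open>A \<le> B\<close> this \<phi>] False show ?thesis by simp
    qed
  qed
qed

lemma trigonometric_polynomial_parseval:
  fixes c :: "nat \<Rightarrow> complex"
  assumes "finite I"
  shows "((\<lambda>x. (cmod (\<Sum>m\<in>I. c m * cis (2 * pi * real m * x)))\<^sup>2) has_integral (\<Sum>m\<in>I. (cmod (c m))\<^sup>2)) {0..1}"
proof -
  \<comment> \<open>Integer frequencies take equal values at both endpoints 0 and 1, so all
    off-diagonal terms vanish.\<close>
  have one: "cis (2 * pi * real m - 2 * pi * real n) = 1" for m n :: nat
    using cis_multiple_2pi[of "real m - real n"] by (simp add: right_diff_distrib)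
  have "((\<lambda>x. of_real ((cmod (\<Sum>m\<in>I. c m * cis (2 * pi * real m * x)))\<^sup>2 * 1)) has_integral
     (\<Sum>m\<in>I. \<Sum>n\<in>I. c m * cnj (c n) * (if m = n then of_real (1 - 0)
        else (cis ((2 * pi * real m - 2 * pi * real n) * 1) - cis ((2 * pi * real m - 2 * pi * real n) * 0)) / (\<i> * of_real (2 * pi * real m - 2 * pi * real n))))) {0..1}"
    by (rule has_integral_norm_exponential_sum_squared[where \<phi> = "\<lambda>x. x" and \<phi>' = "\<lambda>_. 1"])
       (use assms in \<open>auto simp: inj_on_def\<close>)
  also have "(\<Sum>m\<in>I. \<Sum>n\<in>I. c m * cnj (c n) * (if m = n then of_real (1 - 0)
        else (cis ((2 * pi * real m - 2 * pi * real n) * 1) - cis ((2 * pi * real m - 2 * pi * real n) * 0)) / (\<i> * of_real (2 * pi * real m - 2 * pi * real n))))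
     = (\<Sum>m\<in>I. \<Sum>n\<in>I. if m = n then of_real ((cmod (c m))\<^sup>2) else 0)"
    by (intro sum.cong refl) (simp add: one complex_norm_square del: of_real_power)
  also have "\<dots> = complex_of_real (\<Sum>m\<in>I. (cmod (c m))\<^sup>2)"
    using assms by simp
  finally show ?thesis
    by (drule_tac has_integral_linear[OF _ bounded_linear_Re]) (simp add: o_def)
qed

text \<open>Abel summation: the partial sums \<open>E\<close> of d - b are nonnegative and w
  decreases, so the weighted sum of d - b is at least the boundary term w N * E N.\<close>

lemma weighted_sum_le_of_partial_sums_le:
  fixes b d w :: "nat \<Rightarrow> real"
  assumes "\<And>M. (\<Sum>m=1..M. b m) \<le> (\<Sum>m=1..M. d m)"
    and w: "\<And>m. m \<ge> 1 \<Longrightarrow> w (Suc m) \<le> w m" "\<And>m. m \<ge> 1 \<Longrightarrow> 0 \<le> w m"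
  shows "(\<Sum>m=1..N. b m * w m) \<le> (\<Sum>m=1..N. d m * w m)"
proof -
  define E where "E = (\<lambda>M. \<Sum>m=1..M. d m - b m)"
  have E: "E M \<ge> 0" for M using assms(1)[of M] by (simp add: E_def sum_subtractf)
  have "(\<Sum>m=1..N. (d m - b m) * w m) \<ge> (if N = 0 then 0 else w N * E N)"
  proof (induction N)
    case (Suc N)
    have "w (Suc N) * E N \<le> (if N = 0 then 0 else w N * E N)"
      using w(1)[of N] E[of N] by (auto simp: mult_right_mono E_def)
    then have "w (Suc N) * E (Suc N) \<le> (if N = 0 then 0 else w N * E N) + (d (Suc N) - b (Suc N)) * w (Suc N)"
      by (simp add: E_def algebra_simps)
    with Suc show ?case by simp
  qed simp
  moreover have "(if N = 0 then 0 else w N * E N) \<ge> 0" using E w(2)[of N] by auto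
  ultimately show ?thesis by (simp add: sum_subtractf left_diff_distrib)
qed

text \<open>The comparison sequence C (m^k - (m-1)^k) telescopes to exactly the assumed bound, and
  Bernoulli's inequality puts it below C k m^(k-1). This is the form in which the second moment of
  the coefficients is used throughout.\<close>

lemma weighted_sum_le_of_power_growth:
  fixes b w :: "nat \<Rightarrow> real"
  assumes b: "\<And>M. M \<ge> 1 \<Longrightarrow> (\<Sum>m=1..M. b m) \<le> C * real M ^ k" and "C \<ge> 0" "k \<ge> 1"
    and w: "\<And>m. m \<ge> 1 \<Longrightarrow> w (Suc m) \<le> w m" "\<And>m. m \<ge> 1 \<Longrightarrow> 0 \<le> w m"
  shows "(\<Sum>m=1..N. b m * w m) \<le> C * real k * (\<Sum>m=1..N. real m ^ (k - 1) * w m)"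
proof -
  let ?d = "\<lambda>m. C * (real m ^ k - real (m - 1) ^ k)"
  have tele: "(\<Sum>m=1..M. ?d m) = C * real M ^ k" for M
    by (induction M) (use \<open>k \<ge> 1\<close> in \<open>auto simp: algebra_simps\<close>)
  have diff: "real m ^ k - real (m - 1) ^ k \<le> real k * real m ^ (k - 1)" if "m \<ge> 1" for m
  proof -
    have "1 + real k * (- 1 / real m) \<le> (1 + (- 1 / real m)) ^ k"
      using that by (intro Bernoulli_inequality) auto
    then have "real m ^ k * (1 + real k * (- 1 / real m)) \<le> real m ^ k * (1 + (- 1 / real m)) ^ k"
      by (intro mult_left_mono) auto
    also have "\<dots> = real (m - 1) ^ k"
      using that by (simp add: power_mult_distrib[symmetric] field_simps of_nat_diff)
    also have "real m ^ k * (1 + real k * (- 1 / real m)) = real m ^ k - real k * real m ^ (k - 1)"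
      using that \<open>k \<ge> 1\<close> by (cases k) (auto simp: field_simps)
    finally show ?thesis by simp
  qed
  have "(\<Sum>m=1..N. b m * w m) \<le> (\<Sum>m=1..N. ?d m * w m)"
  proof (rule weighted_sum_le_of_partial_sums_le)
    fix M show "(\<Sum>m=1..M. b m) \<le> (\<Sum>m=1..M. ?d m)"
      unfolding tele using b[of M] \<open>C \<ge> 0\<close> by (cases "M = 0") auto
  qed (use w in auto)
  also have "\<dots> \<le> (\<Sum>m=1..N. (C * (real k * real m ^ (k - 1))) * w m)"
    using w(2) diff \<open>C \<ge> 0\<close> by (intro sum_mono mult_right_mono mult_left_mono) auto
  also have "\<dots> = C * real k * (\<Sum>m=1..N. real m ^ (k - 1) * w m)"
    by (simp add: sum_distrib_left mult_ac)
  finally show ?thesis .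
qed

section \<open>Size of the coefficients and decay of the form towards the cusp\<close>

lemma power_le_fact_exp:
  fixes x :: real
  assumes "x \<ge> 0"
  shows "x ^ n \<le> fact n * exp x"
proof -
  have "(\<lambda>n. x ^ n / fact n) sums exp x"
    using exp_converges[of x] by (simp add: field_simps)
  from sum_le_suminf[OF sums_summable[OF this], of "{n}"] sums_unique[OF this] assms
  show ?thesis by (simp add: field_simps)
qed

lemma norm_exp_fourier: "cmod (exp (2 * of_real pi * \<i> * of_nat n * z)) = exp (- (2 * pi * Im z)) ^ n"
  by (simp add: exp_of_nat_mult[symmetric] mult_ac)

text \<open>The terms of a convergent series are bounded, and at the point i v of the imaginary axis
  they have exactly this size.\<close>

lemma cusp_coeff_growth:
  assumes fa: "cusp_fourier_expansion f a" and v: "v > 0"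
  obtains M where "M > 0" "\<And>n. cmod (a (Suc n)) * exp (- (2 * pi * v)) ^ Suc n \<le> M"
proof -
  define t where "t = (\<lambda>n. a (Suc n) * exp (2 * of_real pi * \<i> * of_nat (Suc n) * (\<i> * complex_of_real v)))"
  have norm_t: "cmod (t n) = cmod (a (Suc n)) * exp (- (2 * pi * v)) ^ Suc n" for n
    unfolding t_def norm_mult norm_exp_fourier by simp
  have "\<i> * complex_of_real v \<in> upper_half_plane" using v by (simp add: upper_half_plane_def)
  then have "summable t"
    using fa unfolding cusp_fourier_expansion_def t_def by (blast intro: sums_summable)
  then have "Bseq t" by (intro convergent_imp_Bseq) (metis convergentI summable_LIMSEQ_zero)
  then show ?thesis using that norm_t unfolding Bseq_def by auto
qed

lemma summable_cusp_coeff_exp: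
  assumes fa: "cusp_fourier_expansion f a" and v: "v > 0"
  shows "summable (\<lambda>n. cmod (a (Suc n)) * exp (- (2 * pi * v)) ^ Suc n)"
proof -
  \<comment> \<open>Boundedness of the terms at height v / 2 leaves a geometric factor at height
    v.\<close>
  obtain M where M: "M > 0" "\<And>n. cmod (a (Suc n)) * exp (- (2 * pi * (v / 2))) ^ Suc n \<le> M"
    using cusp_coeff_growth[OF fa, of "v / 2"] v by auto
  define r where "r = exp (- (2 * pi * (v / 2)))"
  have r: "0 < r" "r < 1" using v by (simp_all add: r_def)
  have r2: "exp (- (2 * pi * v)) = r * r" by (simp add: r_def exp_add[symmetric])
  show ?thesis
  proof (rule summable_comparison_test')
    show "summable (\<lambda>n. M * r ^ Suc n)"
      using r by (intro summable_mult) (simp add: summable_Suc_iff)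
    show "norm (cmod (a (Suc n)) * exp (- (2 * pi * v)) ^ Suc n) \<le> M * r ^ Suc n" for n
    proof -
      have "cmod (a (Suc n)) * exp (- (2 * pi * v)) ^ Suc n = (cmod (a (Suc n)) * r ^ Suc n) * r ^ Suc n"
        unfolding r2 by (simp only: power_mult_distrib mult_ac)
      also have "\<dots> \<le> M * r ^ Suc n"
        using M(2)[of n] r unfolding r_def[symmetric] by (intro mult_right_mono) auto
      finally show ?thesis using r by simp
    qed
  qed
qed

text \<open>Dividing by the bounded terms at height \<open>v\<^sub>0 / 2\<close> leaves a geometric
  series whose ratio stays away from 1. As the expansion starts at n = 1, its sum still carries one
  full factor exp (- 2 pi Im w).\<close>

lemma cusp_expansion_decay:
  assumes fa: "cusp_fourier_expansion f a" and v0: "v\<^sub>0 > 0"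
  shows "\<exists>M. \<forall>w. Im w \<ge> v\<^sub>0 \<longrightarrow> cmod (f w) \<le> M * exp (- (2 * pi * Im w))"
proof -
  define q where "q = (\<lambda>v. exp (- (2 * pi * v)))"
  define t where "t = (\<lambda>w n. a (Suc n) * exp (2 * of_real pi * \<i> * of_nat (Suc n) * w))"
  have sums: "t w sums f w" if "Im w > 0" for w
    using fa that unfolding cusp_fourier_expansion_def upper_half_plane_def t_def by auto
  define z\<^sub>0 where "z\<^sub>0 = \<i> * complex_of_real (v\<^sub>0 / 2)"
  have norm_t: "cmod (t w n) = cmod (a (Suc n)) * q (Im w) ^ Suc n" for w n
    unfolding t_def norm_mult norm_exp_fourier q_def ..
  obtain M where M: "M > 0" "\<And>n. cmod (t z\<^sub>0 n) \<le> M"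
    using cusp_coeff_growth[OF fa, of "v\<^sub>0 / 2"] v0 unfolding norm_t by (auto simp: z\<^sub>0_def q_def)
  have q_pos: "q v > 0" for v by (simp add: q_def)
  have le: "cmod (t w n) \<le> M * q (Im w - v\<^sub>0 / 2) * q (Im w - v\<^sub>0 / 2) ^ n" for w n
  proof -
    have "q (Im w) = q (v\<^sub>0 / 2) * q (Im w - v\<^sub>0 / 2)"
      by (simp add: q_def exp_add[symmetric] field_simps)
    then have "cmod (t w n) = cmod (t z\<^sub>0 n) * q (Im w - v\<^sub>0 / 2) ^ Suc n"
      unfolding norm_t by (simp add: z\<^sub>0_def power_mult_distrib)
    also have "\<dots> \<le> M * q (Im w - v\<^sub>0 / 2) ^ Suc n"
      using M(2) q_pos by (intro mult_right_mono) (auto simp: less_imp_le)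
    finally show ?thesis by (simp add: mult_ac)
  qed
  define q\<^sub>0 where "q\<^sub>0 = q (v\<^sub>0 / 2)"
  have q0: "0 < q\<^sub>0" "q\<^sub>0 < 1" using v0 by (simp_all add: q\<^sub>0_def q_def)
  have "cmod (f w) \<le> (M / (q\<^sub>0 * (1 - q\<^sub>0))) * q (Im w)" if w: "Im w \<ge> v\<^sub>0" for w
  proof -
    define r where "r = q (Im w - v\<^sub>0 / 2)"
    have r: "0 < r" "r \<le> q\<^sub>0" using w by (simp_all add: r_def q_def q\<^sub>0_def)
    have g: "(\<lambda>n. M * r * r ^ n) sums (M * r * (1 / (1 - r)))"
      using r q0 by (intro sums_mult geometric_sums) auto
    have "cmod (suminf (t w)) \<le> suminf (\<lambda>n. M * r * r ^ n)"
      by (rule norm_suminf_le[OF le[of w, folded r_def] sums_summable[OF g]])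
    then have "cmod (f w) \<le> M * r * (1 / (1 - r))"
      using sums_unique[OF sums[of w]] sums_unique[OF g] w v0 by simp
    also have "\<dots> \<le> M * r * (1 / (1 - q\<^sub>0))"
      using r q0 M(1) by (intro mult_left_mono divide_left_mono) auto
    also have "r = q (Im w) / q\<^sub>0" by (simp add: r_def q_def q\<^sub>0_def exp_diff[symmetric] field_simps)
    finally show ?thesis by (simp add: field_simps)
  qed
  then show ?thesis unfolding q_def by blast
qed

lemma cusp_expansion_weighted_bound:
  assumes fa: "cusp_fourier_expansion f a" and v0: "v\<^sub>0 > 0"
  shows "\<exists>B. \<forall>w. Im w \<ge> v\<^sub>0 \<longrightarrow> (cmod (f w))\<^sup>2 * Im w ^ k \<le> B"
proof -
  obtain M where M: "\<And>w. Im w \<ge> v\<^sub>0 \<Longrightarrow> cmod (f w) \<le> M * exp (- (2 * pi * Im w))"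
    using cusp_expansion_decay[OF fa v0] by blast
  have "(cmod (f w))\<^sup>2 * Im w ^ k \<le> M\<^sup>2 * fact k" if w: "Im w \<ge> v\<^sub>0" for w
  proof -
    have "Im w ^ k \<le> fact k * exp (Im w)" using w v0 by (intro power_le_fact_exp) auto
    also have "\<dots> \<le> fact k * exp (4 * pi * Im w)" using w v0 pi_ge_two by simp
    finally have 1: "Im w ^ k \<le> fact k * exp (4 * pi * Im w)" .
    have "(cmod (f w))\<^sup>2 \<le> (M * exp (- (2 * pi * Im w)))\<^sup>2"
      using M[OF w] by (intro power_mono) auto
    also have "\<dots> = M\<^sup>2 * exp (- (4 * pi * Im w))"
      by (simp add: power_mult_distrib power2_eq_square exp_add[symmetric])
    finally have "(cmod (f w))\<^sup>2 * Im w ^ k \<le> (M\<^sup>2 * exp (- (4 * pi * Im w))) * (fact k * exp (4 * pi * Im w))"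
      using 1 w v0 by (intro mult_mono) auto
    then show ?thesis by (simp add: exp_minus field_simps)
  qed
  then show ?thesis by blast
qed

section \<open>Hecke's bound and the second moment of the coefficients\<close>

lemma Im_moebius:
  fixes a b c d :: int
  assumes "a * d - b * c = 1"
  shows "Im ((of_int a * z + of_int b) / (of_int c * z + of_int d)) = Im z / (cmod (of_int c * z + of_int d))\<^sup>2"
proof -
  have det: "real_of_int a * real_of_int d - real_of_int b * real_of_int c = 1"
    using assms by (metis of_int_1 of_int_diff of_int_mult)
  have "real_of_int a * Im z * (of_int c * Re z + of_int d) - (of_int a * Re z + of_int b) * (of_int c * Im z)
     = Im z * (real_of_int a * real_of_int d - real_of_int b * real_of_int c)"
    by (simp add: algebra_simps)
  then show ?thesis
    unfolding det Im_divide cmod_power2 by simp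
qed

text \<open>Dirichlet approximation of \<open>Re z\<close> by a fraction \<open>h / c\<close> with \<open>c \<le> 1 / sqrt (Im z)\<close> makes \<open>\<bar>c z - h\<bar>\<^sup>2 \<le> 5 Im z\<close>;
  this replaces the reduction to a fundamental domain.\<close>

lemma exists_large_Im_translate:
  assumes z: "0 < Im z" "Im z \<le> 1"
  obtains a b c d :: int where "a * d - b * c = 1"
    "Im ((of_int a * z + of_int b) / (of_int c * z + of_int d)) \<ge> 1 / 5" "of_int c * z + of_int d \<noteq> 0"
proof -
  define s where "s = 1 / sqrt (Im z)"
  have s: "s \<ge> 1" "s\<^sup>2 = 1 / Im z" using z by (auto simp: s_def power_divide)
  define N where "N = nat \<lfloor>s\<rfloor>"
  have N: "N \<ge> 1" "real N \<le> s" "s \<le> 2 * real N"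
  proof -
    have "real N = of_int \<lfloor>s\<rfloor>" "\<lfloor>s\<rfloor> \<ge> 1" using s by (auto simp: N_def)
    then show "N \<ge> 1" "real N \<le> s" "s \<le> 2 * real N" by linarith+
  qed
  obtain h c :: int where hc: "coprime h c" "0 < c" "c \<le> int N" "\<bar>of_int c * Re z - of_int h\<bar> < 1 / real N"
    by (rule Dirichlet_approx_coprime[of N "Re z"]) (use N in auto)
  \<comment> \<open>Bezout coefficients complete the bottom row (c, - h) to a matrix of determinant
    1 with top row (- u, - v).\<close>
  obtain u v where uv: "u * h + v * c = 1" using bezout_int[of h c] hc(1) by auto
  let ?j = "of_int c * z + of_int (- h)"
  have det: "(- u) * (- h) - (- v) * c = 1" using uv by simp
  have "(cmod ?j)\<^sup>2 = (of_int c * Re z - of_int h)\<^sup>2 + (of_int c)\<^sup>2 * (Im z)\<^sup>2"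
    by (simp add: cmod_power2 power_mult_distrib)
  also have "(of_int c * Re z - of_int h)\<^sup>2 \<le> (1 / real N)\<^sup>2"
    using hc(4) by (intro abs_le_square_iff[THEN iffD1]) auto
  also have "(1 / real N)\<^sup>2 \<le> 4 * Im z"
  proof -
    \<comment> \<open>Rounding s down to N loses at most a factor 2, which gives 4 Im z for the real
      part. The imaginary part adds one more Im z, whence the 5.\<close>
    have "1 / real N \<le> 2 / s" using N s by (simp add: field_simps)
    then have "(1 / real N)\<^sup>2 \<le> (2 / s)\<^sup>2" by (intro power_mono) auto
    then show ?thesis using s by (simp add: power_divide)
  qed
  also have "(of_int c)\<^sup>2 * (Im z)\<^sup>2 \<le> (1 / Im z) * (Im z)\<^sup>2"
  proof (rule mult_right_mono)
    have "(real_of_int c) \<le> real_of_int (int N)" using hc(3) by (subst of_int_le_iff)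
    then have "(real_of_int c)\<^sup>2 \<le> s\<^sup>2" using hc(2) N(2) by (intro power_mono) auto
    then show "(real_of_int c)\<^sup>2 \<le> 1 / Im z" using s by simp
  qed auto
  also have "(1 / Im z) * (Im z)\<^sup>2 = Im z" using z by (simp add: power2_eq_square)
  finally have le: "(cmod ?j)\<^sup>2 \<le> 5 * Im z" by simp
  have "Im ?j \<noteq> 0" using hc(2) z by simp
  then have nz: "?j \<noteq> 0" by (metis zero_complex.simps(2))
  have "1 / 5 \<le> Im z / (cmod ?j)\<^sup>2"
    using le nz z by (simp add: pos_le_divide_eq)
  then show ?thesis
    using that[of "- u" "- h" "- v" c] det nz Im_moebius[OF det, of z] by metis
qed

text \<open>The function \<bar>f z\<bar>^2 (Im z)^k is invariant under the modular group. Every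
  point of height at most 1 has an image of height at least 1/5, where the Fourier expansion bounds
  this function.\<close>

lemma cusp_form_hecke_bound:
  assumes f: "cusp_form_SL2Z k f" and fa: "cusp_fourier_expansion f a"
  shows "\<exists>B. \<forall>z. 0 < Im z \<and> Im z \<le> 1 \<longrightarrow> (cmod (f z))\<^sup>2 * Im z ^ k \<le> B"
proof -
  obtain B where B: "\<And>w. Im w \<ge> 1 / 5 \<Longrightarrow> (cmod (f w))\<^sup>2 * Im w ^ k \<le> B"
    using cusp_expansion_weighted_bound[OF fa, of "1 / 5" k] by auto
  have "(cmod (f z))\<^sup>2 * Im z ^ k \<le> B" if z: "0 < Im z" "Im z \<le> 1" for z
  proof -
    obtain a b c d :: int where det: "a * d - b * c = 1"
      and im: "Im ((of_int a * z + of_int b) / (of_int c * z + of_int d)) \<ge> 1 / 5" and nz: "of_int c * z + of_int d \<noteq> 0"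
      using exists_large_Im_translate[OF z] by metis
    define j where "j = of_int c * z + of_int d"
    have "j \<noteq> 0" using nz by (simp add: j_def)
    define w where "w = (of_int a * z + of_int b) / j"
    have "f w = j ^ k * f z"
      using f det z unfolding cusp_form_SL2Z_def upper_half_plane_def w_def j_def by blast
    moreover have "Im w = Im z / (cmod j)\<^sup>2" unfolding w_def j_def by (rule Im_moebius[OF det])
    ultimately have "(cmod (f w))\<^sup>2 * Im w ^ k = (cmod (f z))\<^sup>2 * Im z ^ k"
      using \<open>j \<noteq> 0\<close> by (simp add: norm_mult norm_power power_mult_distrib power_divide power_mult[symmetric] mult.commute)
    then show ?thesis using B[of w] im by (simp add: w_def j_def)
  qed
  then show ?thesis by blast
qed

text \<open>At height y the form is a Fourier series in x with coefficients \<open>a m\<close> exp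
  (- 2 pi m y). Parseval is applied to finite partial sums only; these are bounded by G plus the
  tail \<open>R N\<close> of the absolute series, and \<open>R N\<close> tends to 0. No limit is
  taken under an integral.\<close>

lemma cusp_coeff_bessel_inequality:
  assumes fa: "cusp_fourier_expansion f a" and y: "y > 0"
    and G: "\<And>x. cmod (f (Complex x y)) \<le> G"
  shows "(\<Sum>m=1..M. (cmod (a m) * exp (- (2 * pi * y)) ^ m)\<^sup>2) \<le> G\<^sup>2"
proof -
  define b where "b = (\<lambda>m. a m * of_real (exp (- (2 * pi * y)) ^ m))"
  have norm_b: "cmod (b m) = cmod (a m) * exp (- (2 * pi * y)) ^ m" for m
    by (simp add: b_def norm_mult norm_power)
  have sb: "summable (\<lambda>n. cmod (b (Suc n)))"
    unfolding norm_b by (rule summable_cusp_coeff_exp[OF fa y])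
  define R where "R = (\<lambda>N. \<Sum>n. cmod (b (Suc (n + N))))"
  have R0: "R \<longlonglongrightarrow> 0"
    using suminf_exist_split2[OF sb] by (simp add: R_def)
  have P: "cmod (\<Sum>m\<in>{1..N}. b m * cis (2 * pi * real m * x)) \<le> G + R N" for N x
  proof -
    define t where "t = (\<lambda>n. b (Suc n) * cis (2 * pi * real (Suc n) * x))"
    have "(\<lambda>n. a (Suc n) * exp (2 * of_real pi * \<i> * of_nat (Suc n) * Complex x y)) sums f (Complex x y)"
      using fa y unfolding cusp_fourier_expansion_def upper_half_plane_def by auto
    also have "(\<lambda>n. a (Suc n) * exp (2 * of_real pi * \<i> * of_nat (Suc n) * Complex x y)) = t"
    proof
      fix n
      have "2 * of_real pi * \<i> * of_nat (Suc n) * Complex x y =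
        of_nat (Suc n) * of_real (- (2 * pi * y)) + \<i> * of_real (2 * pi * real (Suc n) * x)"
        by (simp add: complex_eq_iff algebra_simps)
      then have "exp (2 * of_real pi * \<i> * of_nat (Suc n) * Complex x y) =
        of_real (exp (- (2 * pi * y)) ^ Suc n) * cis (2 * pi * real (Suc n) * x)"
        by (simp only: exp_add exp_of_nat_mult exp_of_real cis_conv_exp of_real_power)
      then show "a (Suc n) * exp (2 * of_real pi * \<i> * of_nat (Suc n) * Complex x y) = t n"
        by (simp only: t_def b_def mult.assoc)
    qed
    finally have t: "t sums f (Complex x y)" .
    have nt: "cmod (t n) = cmod (b (Suc n))" for n by (simp add: t_def norm_mult)
    have "f (Complex x y) = (\<Sum>n. t (n + N)) + (\<Sum>n<N. t n)"
      using suminf_split_initial_segment[OF sums_summable[OF t], of N] sums_unique[OF t] by simp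
    moreover have "cmod (\<Sum>n. t (n + N)) \<le> R N"
      using summable_norm[of "\<lambda>n. t (n + N)"] sb
      unfolding R_def nt by (simp add: summable_iff_shift[of "\<lambda>n. cmod (b (Suc n))" N])
    moreover have "(\<Sum>m\<in>{1..N}. b m * cis (2 * pi * real m * x)) = (\<Sum>n<N. t n)"
      unfolding t_def by (rule sum.reindex_bij_witness[of _ Suc "\<lambda>m. m - 1"]) auto
    ultimately have "(\<Sum>m\<in>{1..N}. b m * cis (2 * pi * real m * x)) = f (Complex x y) - (\<Sum>n. t (n + N))"
      by simp
    then have "cmod (\<Sum>m\<in>{1..N}. b m * cis (2 * pi * real m * x)) \<le> cmod (f (Complex x y)) + cmod (\<Sum>n. t (n + N))"
      by (simp add: norm_triangle_ineq4)
    then show ?thesis using G[of x] \<open>cmod (\<Sum>n. t (n + N)) \<le> R N\<close> by linarith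
  qed
  have le: "(\<Sum>m=1..N. (cmod (b m))\<^sup>2) \<le> (G + R N)\<^sup>2" for N
  proof -
    show "(\<Sum>m=1..N. (cmod (b m))\<^sup>2) \<le> (G + R N)\<^sup>2"
    proof (rule has_integral_le)
      show "((\<lambda>x. (cmod (\<Sum>m\<in>{1..N}. b m * cis (2 * pi * real m * x)))\<^sup>2) has_integral (\<Sum>m=1..N. (cmod (b m))\<^sup>2)) {0..1}"
        by (rule trigonometric_polynomial_parseval) simp
      show "((\<lambda>x. (G + R N)\<^sup>2) has_integral (G + R N)\<^sup>2) {0..1::real}"
        using has_integral_const_real[of "(G + R N)\<^sup>2" 0 1] by simp
    qed (intro power_mono P norm_ge_zero)
  qed
  have "(\<lambda>N. (G + R N)\<^sup>2) \<longlonglongrightarrow> (G + 0)\<^sup>2" by (intro tendsto_intros R0)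
  then have "(\<Sum>m=1..M. (cmod (b m))\<^sup>2) \<le> (G + 0)\<^sup>2"
  proof (rule LIMSEQ_le_const)
    show "\<exists>N. \<forall>n\<ge>N. (\<Sum>m=1..M. (cmod (b m))\<^sup>2) \<le> (G + R n)\<^sup>2"
      by (intro exI[of _ M] allI impI order_trans[OF sum_mono2 le]) auto
  qed
  then show ?thesis by (simp add: norm_b)
qed

text \<open>At height y = 1 / M the squared damping factors exp (- 4 pi m y) with m up to M are at
  least exp (- 4 pi), while Hecke's bound gives \<bar>f\<bar>^2 at most B M^k there.\<close>

lemma cusp_coeff_second_moment:
  assumes f: "cusp_form_SL2Z k f" and fa: "cusp_fourier_expansion f a"
  shows "\<exists>C\<ge>0. \<forall>M\<ge>1. (\<Sum>m=1..M. (cmod (a m))\<^sup>2) \<le> C * real M ^ k"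
proof -
  obtain B where B: "\<And>z. 0 < Im z \<Longrightarrow> Im z \<le> 1 \<Longrightarrow> (cmod (f z))\<^sup>2 * Im z ^ k \<le> B"
    using cusp_form_hecke_bound[OF f fa] by blast
  have B0: "B \<ge> 0" using B[of \<i>] by (simp add: order_trans[OF zero_le_power2])
  have "(\<Sum>m=1..M. (cmod (a m))\<^sup>2) \<le> exp (4 * pi) * B * real M ^ k" if M: "M \<ge> 1" for M :: nat
  proof -
    define y where "y = 1 / real M"
    have y: "0 < y" "y \<le> 1" using M by (auto simp: y_def)
    have "(cmod (f (Complex x y)))\<^sup>2 \<le> B * real M ^ k" for x
      using B[of "Complex x y"] y M by (simp add: y_def power_divide field_simps)
    then have "cmod (f (Complex x y)) \<le> sqrt (B * real M ^ k)" for x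
      by (intro real_le_rsqrt)
    from cusp_coeff_bessel_inequality[OF fa y(1) this, of M]
    have *: "(\<Sum>m=1..M. (cmod (a m) * exp (- (2 * pi * y)) ^ m)\<^sup>2) \<le> B * real M ^ k"
      using B0 by simp
    have "(\<Sum>m=1..M. exp (- (4 * pi)) * (cmod (a m))\<^sup>2) \<le> (\<Sum>m=1..M. (cmod (a m) * exp (- (2 * pi * y)) ^ m)\<^sup>2)"
    proof (rule sum_mono)
      fix m assume m: "m \<in> {1..M}"
      have "real m * y \<le> 1" using m by (simp add: y_def)
      then have "4 * pi * (real m * y) \<le> 4 * pi * 1" by (intro mult_left_mono) auto
      moreover have "(exp (- (2 * pi * y)) ^ m)\<^sup>2 = exp (- (4 * pi * (real m * y)))"
        by (simp add: power2_eq_square exp_of_nat_mult[symmetric] exp_add[symmetric])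
      ultimately have "exp (- (4 * pi)) \<le> (exp (- (2 * pi * y)) ^ m)\<^sup>2" by simp
      then have "(cmod (a m))\<^sup>2 * exp (- (4 * pi)) \<le> (cmod (a m))\<^sup>2 * (exp (- (2 * pi * y)) ^ m)\<^sup>2"
        by (intro mult_left_mono) auto
      then show "exp (- (4 * pi)) * (cmod (a m))\<^sup>2 \<le> (cmod (a m) * exp (- (2 * pi * y)) ^ m)\<^sup>2"
        by (simp add: power_mult_distrib mult_ac)
    qed
    with * have "exp (- (4 * pi)) * (\<Sum>m=1..M. (cmod (a m))\<^sup>2) \<le> B * real M ^ k"
      by (simp add: sum_distrib_left)
    then show ?thesis by (simp add: exp_minus field_simps)
  qed
  then show ?thesis using B0 by (intro exI[of _ "exp (4 * pi) * B"]) auto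
qed

text \<open>Partial summation against the decreasing weight reduces this to the convergence of the
  sum of m^(- 1 - \<epsilon>).\<close>

lemma summable_cusp_coeff_square_powr:
  assumes C: "\<forall>M\<ge>1. (\<Sum>m=1..M. (cmod (a m))\<^sup>2) \<le> C * real M ^ k" "C \<ge> 0" and k: "k \<ge> 1" and "\<epsilon> > 0"
  shows "summable (\<lambda>n. (cmod (a (Suc n)))\<^sup>2 * real (Suc n) powr (- real k - \<epsilon>))"
proof -
  have s: "summable (\<lambda>n. real (Suc n) powr (- 1 - \<epsilon>))"
    using \<open>\<epsilon> > 0\<close> by (subst summable_Suc_iff[of "\<lambda>n. real n powr (- 1 - \<epsilon>)"]) (simp add: summable_real_powr_iff)
  show ?thesis
  proof (rule summableI_nonneg_bounded)
    fix N
    have "(\<Sum>n<N. (cmod (a (Suc n)))\<^sup>2 * real (Suc n) powr (- real k - \<epsilon>)) =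
       (\<Sum>m=1..N. (cmod (a m))\<^sup>2 * real m powr (- real k - \<epsilon>))"
      by (rule sum.reindex_bij_witness[of _ "\<lambda>m. m - 1" Suc]) auto
    also have "\<dots> \<le> C * real k * (\<Sum>m=1..N. real m ^ (k - 1) * real m powr (- real k - \<epsilon>))"
      by (rule weighted_sum_le_of_power_growth[OF C(1)[rule_format] C(2) k]) (use \<open>\<epsilon> > 0\<close> in \<open>auto intro!: powr_mono2'\<close>)
    also have "(\<Sum>m=1..N. real m ^ (k - 1) * real m powr (- real k - \<epsilon>)) = (\<Sum>m=1..N. real m powr (- 1 - \<epsilon>))"
    proof (rule sum.cong[OF refl])
      fix m assume "m \<in> {1..N}"
      then have "real m ^ (k - 1) = real m powr (real k - 1)"
        using k by (simp add: powr_realpow[symmetric] of_nat_diff)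
      then show "real m ^ (k - 1) * real m powr (- real k - \<epsilon>) = real m powr (- 1 - \<epsilon>)"
        by (simp add: powr_add[symmetric])
    qed
    also have "\<dots> = (\<Sum>n<N. real (Suc n) powr (- 1 - \<epsilon>))"
      by (rule sum.reindex_bij_witness[of _ Suc "\<lambda>m. m - 1"]) auto
    also have "\<dots> \<le> (\<Sum>n. real (Suc n) powr (- 1 - \<epsilon>))"
      by (rule sum_le_suminf[OF s]) auto
    finally show "(\<Sum>n<N. (cmod (a (Suc n)))\<^sup>2 * real (Suc n) powr (- real k - \<epsilon>)) \<le>
       C * real k * (\<Sum>n. real (Suc n) powr (- 1 - \<epsilon>))"
      using C(2) by (simp add: mult_left_mono)
  qed auto
qed

text \<open>The inequality x y \<le> x^2 + y^2 trades the first moment for the second. The weight is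
  split so that the two squares carry m^(- k - \<epsilon>) and m^(- 1 - \<epsilon>), both
  summable.\<close>

lemma summable_cusp_coeff_powr:
  assumes C: "\<forall>M\<ge>1. (\<Sum>m=1..M. (cmod (a m))\<^sup>2) \<le> C * real M ^ k" "C \<ge> 0" and k: "k \<ge> 1" and "\<epsilon> > 0"
  shows "summable (\<lambda>n. cmod (a (Suc n)) * real (Suc n) powr (- real k / 2 - 1/2 - \<epsilon>))"
proof (rule summable_comparison_test')
  show "summable (\<lambda>n. (cmod (a (Suc n)))\<^sup>2 * real (Suc n) powr (- real k - \<epsilon>) + real (Suc n) powr (- 1 - \<epsilon>))"
  proof (rule summable_add)
    show "summable (\<lambda>n. real (Suc n) powr (- 1 - \<epsilon>))"
      using \<open>\<epsilon> > 0\<close> by (subst summable_Suc_iff[of "\<lambda>n. real n powr (- 1 - \<epsilon>)"]) (simp add: summable_real_powr_iff)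
  qed (rule summable_cusp_coeff_square_powr[OF C k \<open>\<epsilon> > 0\<close>])
  fix n
  define x where "x = cmod (a (Suc n)) * real (Suc n) powr ((- real k - \<epsilon>) / 2)"
  define y where "y = real (Suc n) powr ((- 1 - \<epsilon>) / 2)"
  have "x * y \<le> x\<^sup>2 + y\<^sup>2"
    using sum_squares_bound[of x y] zero_le_power2[of x] zero_le_power2[of y] by linarith
  moreover have "x * y = cmod (a (Suc n)) * real (Suc n) powr (- real k / 2 - 1/2 - \<epsilon>)"
  proof -
    have "(- real k - \<epsilon>) / 2 + (- 1 - \<epsilon>) / 2 = - real k / 2 - 1/2 - \<epsilon>" by (simp add: field_simps)
    then show ?thesis unfolding x_def y_def by (simp only: mult.assoc powr_add[symmetric])
  qed
  moreover have "x\<^sup>2 = (cmod (a (Suc n)))\<^sup>2 * real (Suc n) powr (- real k - \<epsilon>)"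
    unfolding x_def by (simp add: power_mult_distrib power2_eq_square powr_add[symmetric])
  moreover have "y\<^sup>2 = real (Suc n) powr (- 1 - \<epsilon>)"
    unfolding y_def by (simp add: power2_eq_square powr_add[symmetric])
  ultimately show "norm (cmod (a (Suc n)) * real (Suc n) powr (- real k / 2 - 1/2 - \<epsilon>)) \<le>
    (cmod (a (Suc n)))\<^sup>2 * real (Suc n) powr (- real k - \<epsilon>) + real (Suc n) powr (- 1 - \<epsilon>)"
    by simp
qed

section \<open>Uniqueness of the Laplace transform\<close>

text \<open>This is the normalisation of the Erlang density s^(n+1) x^n exp (- s x) / n!.\<close>

lemma has_bochner_integral_power_exp:
  fixes s :: real
  assumes "s > 0"
  shows "has_bochner_integral lborel (\<lambda>x. indicator {0..} x * (exp (- s * x) * (x ^ n / fact n))) (1 / s ^ Suc n)"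
proof -
  have "has_bochner_integral lborel (erlang_density n s) 1"
  proof (rule has_bochner_integral_nn_integral)
    show "(\<integral>\<^sup>+ x. ennreal (erlang_density n s x) \<partial>lborel) = ennreal 1"
      using nn_integral_erlang_ith_moment[OF assms, of n 0] by simp
  qed (use assms in auto)
  from has_bochner_integral_mult_right[OF this, of "1 / s ^ Suc n"]
  show ?thesis
    by (rule has_bochner_integral_cong[THEN iffD1, rotated -1])
       (use assms in \<open>auto simp: erlang_density_def split: split_indicator\<close>)
qed

text \<open>The value is 0 when the integral does not converge absolutely. Statements about general
  functions that split an integral or exchange it with a series therefore carry the growth bound and
  s \<ge> 1.\<close>

definition laplace :: "real \<Rightarrow> (real \<Rightarrow> complex) \<Rightarrow> complex" where
  "laplace s g = (LINT x|lborel. indicator {0..} x *\<^sub>R (exp (- s * x) *\<^sub>R g x))"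

text \<open>All functions below grow at most like \<open>exp (x / 4)\<close>; the rate is arbitrary, as long as it is
  less than the abscissas \<open>s \<ge> 1\<close> at which Laplace transforms are compared.\<close>

lemma integrable_exp_quarter:
  assumes "s \<ge> 1"
  shows "integrable lborel (\<lambda>x::real. indicator {0..} x * (exp (- s * x) * exp (x / 4)))"
proof -
  have "integrable lborel (\<lambda>x::real. indicator {0..} x * (exp (- (s - 1/4) * x) * (x ^ 0 / fact 0)))"
    using has_bochner_integral_power_exp[of "s - 1/4" 0] assms by (auto simp: has_bochner_integral_iff)
  then show ?thesis
    by (rule Bochner_Integration.integrable_cong[THEN iffD1, rotated -1])
       (auto simp: exp_add[symmetric] algebra_simps)
qed

lemma integrable_laplace:
  fixes g :: "real \<Rightarrow> complex"
  assumes g: "continuous_on {0..} g" "\<And>x. x \<ge> 0 \<Longrightarrow> cmod (g x) \<le> C * exp (x / 4)" and s: "s \<ge> 1"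
  shows "integrable lborel (\<lambda>x. indicator {0..} x *\<^sub>R (exp (- s * x) *\<^sub>R g x))"
proof (rule Bochner_Integration.integrable_bound)
  show "integrable lborel (\<lambda>x::real. C * (indicator {0..} x * (exp (- s * x) * exp (x / 4))))"
    using integrable_exp_quarter[OF s] by (rule integrable_mult_right)
  have "(\<lambda>x. indicator {0..} x *\<^sub>R (exp (- s * x) *\<^sub>R g x)) \<in> borel_measurable borel"
    by (rule borel_measurable_continuous_on_indicator) (auto intro!: continuous_intros g)
  then show "(\<lambda>x. indicator {0..} x *\<^sub>R (exp (- s * x) *\<^sub>R g x)) \<in> borel_measurable lborel"
    by simp
  show "AE x in lborel. norm (indicator {0..} x *\<^sub>R (exp (- s * x) *\<^sub>R g x)) \<le>
      norm (C * (indicator {0..} x * (exp (- s * x) * exp (x / 4))))"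
  proof (rule AE_I2)
    fix x :: real
    show "norm (indicator {0..} x *\<^sub>R (exp (- s * x) *\<^sub>R g x)) \<le> norm (C * (indicator {0..} x * (exp (- s * x) * exp (x / 4))))"
    proof (cases "x \<ge> 0")
      case True
      have "C * exp (x / 4) \<le> \<bar>C\<bar> * exp (x / 4)" by (intro mult_right_mono) auto
      then have "cmod (g x) \<le> \<bar>C\<bar> * exp (x / 4)" using g(2)[OF True] by linarith
      then show ?thesis using True by (simp add: abs_mult mult_ac)
    qed auto
  qed
qed

lemma laplace_diff_cmult:
  fixes g h :: "real \<Rightarrow> complex"
  assumes g: "continuous_on {0..} g" "\<And>x. x \<ge> 0 \<Longrightarrow> cmod (g x) \<le> C * exp (x / 4)"
    and h: "continuous_on {0..} h" "\<And>x. x \<ge> 0 \<Longrightarrow> cmod (h x) \<le> D * exp (x / 4)" and s: "s \<ge> 1"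
  shows "laplace s (\<lambda>x. g x - c * h x) = laplace s g - c * laplace s h"
proof -
  note ig = integrable_laplace[OF g s] and ih = integrable_laplace[OF h s]
  have "laplace s g - c * laplace s h = (LINT x|lborel. indicator {0..} x *\<^sub>R (exp (- s * x) *\<^sub>R g x)
     - c * (indicator {0..} x *\<^sub>R (exp (- s * x) *\<^sub>R h x)))"
    using Bochner_Integration.integral_diff[OF ig integrable_mult_right[OF ih, of c]]
    by (simp only: laplace_def integral_mult_right_zero)
  also have "\<dots> = laplace s (\<lambda>x. g x - c * h x)"
    unfolding laplace_def by (rule Bochner_Integration.integral_cong) (auto simp: algebra_simps)
  finally show ?thesis ..
qed

lemma series_exp_quarter_bound:
  fixes g :: "nat \<Rightarrow> real \<Rightarrow> complex"
  assumes "\<And>n x. x \<ge> 0 \<Longrightarrow> cmod (g n x) \<le> M n * exp (x / 4)" "summable M" "x \<ge> 0"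
  shows "summable (\<lambda>n. cmod (g n x))" "cmod (\<Sum>n. g n x) \<le> suminf M * exp (x / 4)"
proof -
  have s: "summable (\<lambda>n. M n * exp (x / 4))" using assms(2) by (rule summable_mult2)
  then show "summable (\<lambda>n. cmod (g n x))"
    by (rule summable_comparison_test') (use assms in simp)
  show "cmod (\<Sum>n. g n x) \<le> suminf M * exp (x / 4)"
    using norm_suminf_le[OF assms(1)[OF assms(3)] s] suminf_mult2[OF assms(2), of "exp (x / 4)"] by simp
qed

text \<open>The majorants grow with x, so the M-test gives uniform convergence only on {0..R};
  continuity is local, and R = x + 1 serves the point x.\<close>

lemma continuous_on_series_exp_quarter:
  fixes g :: "nat \<Rightarrow> real \<Rightarrow> complex"
  assumes cont: "\<And>n. continuous_on {0..} (g n)"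
    and bound: "\<And>n x. x \<ge> 0 \<Longrightarrow> cmod (g n x) \<le> M n * exp (x / 4)" and M: "summable M"
  shows "continuous_on {0..} (\<lambda>x. \<Sum>n. g n x)"
proof -
  have M0: "M n \<ge> 0" for n using bound[of 0 n] norm_ge_zero[of "g n 0"] by (simp del: norm_ge_zero)
  have *: "continuous_on {0..R} (\<lambda>x. \<Sum>n. g n x)" for R
  proof (rule uniform_limit_theorem)
    show "uniform_limit {0..R} (\<lambda>N x. \<Sum>n<N. g n x) (\<lambda>x. \<Sum>n. g n x) sequentially"
    proof (rule Weierstrass_m_test)
      show "summable (\<lambda>n. M n * exp (R / 4))" using M by (rule summable_mult2)
      fix n x assume x: "x \<in> {0..R}"
      have "M n * exp (x / 4) \<le> M n * exp (R / 4)" using x M0 by (intro mult_left_mono) auto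
      then show "cmod (g n x) \<le> M n * exp (R / 4)" using bound[of x n] x by simp
    qed
  qed (auto intro!: always_eventually continuous_intros continuous_on_subset[OF cont])
  show ?thesis
    unfolding continuous_on_eq_continuous_within
  proof
    fix x :: real assume x: "x \<in> {0..}"
    have "at x within {0..} = at x within {0..x + 1}"
      by (rule at_within_nhd[of _ "{x - 1<..<x + 1}"]) auto
    then show "continuous (at x within {0..}) (\<lambda>x. \<Sum>n. g n x)"
      using *[of "x + 1"] x by (simp add: continuous_on_eq_continuous_within)
  qed
qed

text \<open>The norm of the n-th integrand integrates to at most \<open>M n\<close> times one fixed
  integral, so the series of these integrals converges and summation may be exchanged with
  integration.\<close>

lemma laplace_series:
  fixes g :: "nat \<Rightarrow> real \<Rightarrow> complex"
  assumes cont: "\<And>n. continuous_on {0..} (g n)"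
    and bound: "\<And>n x. x \<ge> 0 \<Longrightarrow> cmod (g n x) \<le> M n * exp (x / 4)" and M: "summable M" and s: "s \<ge> 1"
  shows "(\<lambda>n. laplace s (g n)) sums laplace s (\<lambda>x. \<Sum>n. g n x)"
proof -
  let ?G = "\<lambda>n x. indicator {0..} x *\<^sub>R (exp (- s * x) *\<^sub>R g n x)"
  let ?I = "LINT x|lborel. indicator {0..} x * (exp (- s * x) * exp (x / 4))"
  have int: "integrable lborel (?G n)" for n by (rule integrable_laplace[OF cont bound s])
  have sn: "summable (\<lambda>n. norm (?G n x))" for x
    using series_exp_quarter_bound(1)[of g M x, OF bound M]
    by (cases "x \<ge> 0") (auto intro!: summable_mult)
  have "(\<lambda>n. integral\<^sup>L lborel (?G n)) sums (LINT x|lborel. (\<Sum>n. ?G n x))"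
  proof (rule sums_integral[OF int])
    show "AE x in lborel. summable (\<lambda>n. norm (?G n x))" using sn by simp
    show "summable (\<lambda>n. LINT x|lborel. norm (?G n x))"
    proof (rule summable_comparison_test')
      show "summable (\<lambda>n. M n * ?I)" using M by (rule summable_mult2)
      fix n
      have "(LINT x|lborel. norm (?G n x)) \<le> (LINT x|lborel. M n * (indicator {0..} x * (exp (- s * x) * exp (x / 4))))"
      proof (rule integral_mono)
        show "integrable lborel (\<lambda>x. norm (?G n x))" using int by (rule integrable_norm)
        show "integrable lborel (\<lambda>x. M n * (indicator {0..} x * (exp (- s * x) * exp (x / 4))))"
          using integrable_exp_quarter[OF s] by (rule integrable_mult_right)
        fix x :: real
        have "exp (- s * x) * cmod (g n x) \<le> exp (- s * x) * (M n * exp (x / 4))" if "x \<ge> 0"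
          using bound[OF that] by (intro mult_left_mono) auto
        then show "norm (?G n x) \<le> M n * (indicator {0..} x * (exp (- s * x) * exp (x / 4)))"
          by (auto simp: mult_ac split: split_indicator)
      qed
      then show "norm (LINT x|lborel. norm (?G n x)) \<le> M n * ?I"
        by (simp add: integral_nonneg_AE)
    qed
  qed
  also have "(LINT x|lborel. (\<Sum>n. ?G n x)) = laplace s (\<lambda>x. \<Sum>n. g n x)"
    unfolding laplace_def
  proof (rule Bochner_Integration.integral_cong[OF refl])
    fix x :: real
    have "(\<Sum>n. ?G n x) = (\<Sum>n. (indicator {0..} x * exp (- s * x)) *\<^sub>R g n x)" by simp
    also have "\<dots> = (indicator {0..} x * exp (- s * x)) *\<^sub>R (\<Sum>n. g n x)"
    proof (cases "x \<ge> 0")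
      case True
      then show ?thesis
        using series_exp_quarter_bound(1)[of g M x, OF bound M True]
        by (intro suminf_scaleR_right[symmetric]) (rule summable_norm_cancel)
    qed simp
    finally show "(\<Sum>n. ?G n x) = indicator {0..} x *\<^sub>R (exp (- s * x) *\<^sub>R (\<Sum>n. g n x))" by simp
  qed
  finally show ?thesis by (simp add: laplace_def)
qed

text \<open>Lerch's argument: all moments of \<open>D\<close> against polynomials in \<open>exp (- x)\<close> vanish, and by Weierstrass
  such polynomials approximate \<open>exp (- x) * D x\<close> uniformly, so \<open>D\<^sup>2\<close> integrates to zero.\<close>

lemma laplace_unique_real:
  fixes D :: "real \<Rightarrow> real"
  assumes cont: "continuous_on {0..} D"
    and bound: "\<And>x. x \<ge> 0 \<Longrightarrow> \<bar>D x\<bar> \<le> C * exp (x / 4)"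
    and zero: "\<And>s. s \<ge> 1 \<Longrightarrow> (LINT x|lborel. indicator {0..} x * (exp (- s * x) * D x)) = 0"
    and int: "\<And>s. s \<ge> 1 \<Longrightarrow> integrable lborel (\<lambda>x. indicator {0..} x * (exp (- s * x) * D x))"
    and x: "x > 0"
  shows "D x = 0"
proof -
  \<comment> \<open>In the variable u = exp (- x) this is exp (- x) * D x. Growth of D at most exp
    (x / 4) means at most u^(- 1/4), so the factor u more than compensates and makes
    \<open>\<phi>\<close> continuous at 0.\<close>
  define \<phi> where "\<phi> = (\<lambda>u. u * D (- ln u))"
  have C0: "C \<ge> 0" using bound[of 0] by simp
  have \<phi>_bound: "\<bar>\<phi> u\<bar> \<le> C * sqrt u" if "0 \<le> u" "u \<le> 1" for u
  proof (cases "u = 0")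
    case False
    then have u: "0 < u" using that by simp
    have "\<bar>D (- ln u)\<bar> \<le> C * exp (- ln u / 4)" using u that by (intro bound) (simp add: ln_le_zero_iff)
    also have "exp (- ln u / 4) \<le> exp (- ln u / 2)" using u that by (simp add: ln_le_zero_iff)
    also have "exp (- ln u / 2) = 1 / sqrt u"
    proof -
      have "sqrt u = exp (ln u / 2)" using u by (simp add: powr_half_sqrt[symmetric] powr_def)
      moreover have "exp (- ln u / 2) = inverse (exp (ln u / 2))" by (subst exp_minus[symmetric]) simp
      ultimately show ?thesis by (simp only: inverse_eq_divide)
    qed
    finally have "\<bar>D (- ln u)\<bar> \<le> C * (1 / sqrt u)" using C0 by (simp add: mult_left_mono)
    then have "u * \<bar>D (- ln u)\<bar> \<le> u * (C * (1 / sqrt u))" using u by (intro mult_left_mono) auto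
    moreover have "u * (C * (1 / sqrt u)) = C * (u / sqrt u)" by simp
    moreover have "\<bar>\<phi> u\<bar> = u * \<bar>D (- ln u)\<bar>" using u by (simp add: \<phi>_def abs_mult)
    ultimately show ?thesis using real_div_sqrt[of u] u by simp
  qed (simp add: \<phi>_def)
  have "continuous_on {0..1} \<phi>"
    unfolding continuous_on_eq_continuous_within
  proof
    fix u :: real assume u: "u \<in> {0..1}"
    show "continuous (at u within {0..1}) \<phi>"
    proof (cases "u = 0")
      case True
      have "(\<phi> \<longlongrightarrow> 0) (at 0 within {0..1})"
      proof (rule Lim_null_comparison)
        show "\<forall>\<^sub>F u in at 0 within {0..1}. norm (\<phi> u) \<le> C * sqrt u"
          using \<phi>_bound by (simp add: eventually_at_filter)
        show "((\<lambda>u. C * sqrt u) \<longlongrightarrow> 0) (at 0 within {0..1})"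
          using tendsto_mult_left[OF tendsto_real_sqrt[OF tendsto_ident_at], of C 0 "{0..1}"] by simp
      qed
      moreover have "\<phi> 0 = 0" by (simp add: \<phi>_def)
      ultimately show ?thesis unfolding continuous_within True by simp
    next
      case False
      have "continuous_on {0<..1} \<phi>"
        unfolding \<phi>_def
        by (intro continuous_intros continuous_on_compose2[OF cont]) (auto simp: ln_le_zero_iff)
      then have "continuous (at u within {0<..1}) \<phi>"
        using u False by (simp add: continuous_on_eq_continuous_within)
      moreover have "at u within {0..1} = at u within {0<..1}"
        by (rule at_within_nhd[of _ "{0<..}"]) (use u False in auto)
      ultimately show ?thesis by simp
    qed
  qed
  \<comment> \<open>As \<open>\<phi> (exp (- x))\<close> is \<open>exp (- x) * D x\<close>, this is
    the integral of exp (- 3 x) D^2. When \<open>\<phi>\<close> is replaced by a monomial of degree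
    i, it becomes the transform of D at s = 2 + i, which vanishes.\<close>
  define J where "J = (LINT x|lborel. indicator {0..} x * (exp (- 2 * x) * D x) * \<phi> (exp (- x)))"
  have J_eq: "indicator {0..} x * (exp (- 2 * x) * D x) * \<phi> (exp (- x)) = indicator {0..} x * (exp (- 3 * x) * (D x)\<^sup>2)" for x
  proof -
    have "exp (- 3 * x) = exp (- 2 * x) * exp (- x)" by (simp add: exp_add[symmetric])
    then show ?thesis by (simp add: \<phi>_def power2_eq_square mult_ac)
  qed
  have \<phi>1: "\<bar>\<phi> (exp (- x))\<bar> \<le> C" if "x \<ge> 0" for x
  proof -
    have "\<bar>\<phi> (exp (- x))\<bar> \<le> C * sqrt (exp (- x))" using that by (intro \<phi>_bound) auto
    also have "\<dots> \<le> C * 1" using that C0 by (intro mult_left_mono) (auto simp: real_sqrt_le_1_iff)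
    finally show ?thesis by simp
  qed
  have iJ: "integrable lborel (\<lambda>x. indicator {0..} x * (exp (- 2 * x) * D x) * \<phi> (exp (- x)))"
  proof (rule Bochner_Integration.integrable_bound)
    show "integrable lborel (\<lambda>x. C * (indicator {0..} x * (exp (- 2 * x) * D x)))"
      using int[of 2] by (intro integrable_mult_right) auto
    have "(\<lambda>x. indicator {0..} x *\<^sub>R (exp (- 3 * x) * (D x)\<^sup>2)) \<in> borel_measurable borel"
      by (rule borel_measurable_continuous_on_indicator) (auto intro!: continuous_intros cont)
    then show "(\<lambda>x. indicator {0..} x * (exp (- 2 * x) * D x) * \<phi> (exp (- x))) \<in> borel_measurable lborel"
      unfolding J_eq by simp
    show "AE x in lborel. norm (indicator {0..} x * (exp (- 2 * x) * D x) * \<phi> (exp (- x)))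
       \<le> norm (C * (indicator {0..} x * (exp (- 2 * x) * D x)))"
    proof (rule AE_I2)
      fix x :: real
      show "norm (indicator {0..} x * (exp (- 2 * x) * D x) * \<phi> (exp (- x)))
       \<le> norm (C * (indicator {0..} x * (exp (- 2 * x) * D x)))"
      proof (cases "x \<ge> 0")
        case True
        from mult_left_mono[OF \<phi>1[OF True], of "\<bar>exp (- 2 * x) * D x\<bar>"] show ?thesis
          using True C0 by (simp add: abs_mult mult_ac)
      qed auto
    qed
  qed
  define A where "A = (LINT x|lborel. \<bar>indicator {0..} x * (exp (- 2 * x) * D x)\<bar>)"
  have A0: "A \<ge> 0" unfolding A_def by (rule integral_nonneg_AE) auto
  \<comment> \<open>Only the error of the polynomial approximation contributes, and it is integrated
    against a fixed absolutely integrable function with integral \<open>A\<close>.\<close>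
  have J_small: "\<bar>J\<bar> \<le> \<epsilon> * A" if "\<epsilon> > 0" for \<epsilon>
  proof -
    obtain p where p: "real_polynomial_function p" "\<And>u. u \<in> {0..1} \<Longrightarrow> \<bar>\<phi> u - p u\<bar> < \<epsilon>"
      using Stone_Weierstrass_real_polynomial_function[OF compact_Icc \<open>continuous_on {0..1} \<phi>\<close> \<open>\<epsilon> > 0\<close>] by metis
    obtain c N where pc: "p = (\<lambda>u. \<Sum>i\<le>N. c i * u ^ i)"
      using p(1) unfolding real_polynomial_function_iff_sum by blast
    have eq: "indicator {0..} x * (exp (- 2 * x) * D x) * p (exp (- x)) =
       (\<Sum>i\<le>N. c i * (indicator {0..} x * (exp (- (2 + real i) * x) * D x)))" for x
    proof -
      have "exp (- (2 + real i) * x) = exp (- 2 * x) * exp (- x) ^ i" for i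
        by (simp add: exp_of_nat_mult[symmetric] exp_add[symmetric] algebra_simps)
      then show ?thesis unfolding pc by (simp add: sum_distrib_left mult_ac)
    qed
    have ip: "integrable lborel (\<lambda>x. indicator {0..} x * (exp (- 2 * x) * D x) * p (exp (- x)))"
      unfolding eq by (intro Bochner_Integration.integrable_sum integrable_mult_right int) auto
    have "(LINT x|lborel. indicator {0..} x * (exp (- 2 * x) * D x) * p (exp (- x))) =
        (\<Sum>i\<le>N. c i * (LINT x|lborel. indicator {0..} x * (exp (- (2 + real i) * x) * D x)))"
      unfolding eq
      by (subst Bochner_Integration.integral_sum, (intro integrable_mult_right int; simp), simp)
    also have "\<dots> = 0" by (subst zero) auto
    finally have "J = (LINT x|lborel. indicator {0..} x * (exp (- 2 * x) * D x) * \<phi> (exp (- x))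
       - indicator {0..} x * (exp (- 2 * x) * D x) * p (exp (- x)))"
      unfolding J_def by (subst Bochner_Integration.integral_diff[OF iJ ip]) simp
    also have "\<dots> = (LINT x|lborel. indicator {0..} x * (exp (- 2 * x) * D x) * (\<phi> (exp (- x)) - p (exp (- x))))"
      by (simp add: right_diff_distrib)
    also have "\<bar>\<dots>\<bar> \<le> (LINT x|lborel. \<epsilon> * \<bar>indicator {0..} x * (exp (- 2 * x) * D x)\<bar>)"
      unfolding real_norm_def[symmetric]
    proof (rule Bochner_Integration.integral_norm_bound_integral)
      show "integrable lborel (\<lambda>x. indicator {0..} x * (exp (- 2 * x) * D x) * (\<phi> (exp (- x)) - p (exp (- x))))"
        using Bochner_Integration.integrable_diff[OF iJ ip] by (simp add: right_diff_distrib)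
      show "integrable lborel (\<lambda>x. \<epsilon> * norm (indicator {0..} x * (exp (- 2 * x) * D x)))"
        using int[of 2] by (intro integrable_mult_right integrable_norm) auto
      fix x :: real
      show "norm (indicator {0..} x * (exp (- 2 * x) * D x) * (\<phi> (exp (- x)) - p (exp (- x))))
         \<le> \<epsilon> * norm (indicator {0..} x * (exp (- 2 * x) * D x))"
      proof (cases "x \<ge> 0")
        case True
        have "\<bar>\<phi> (exp (- x)) - p (exp (- x))\<bar> \<le> \<epsilon>" using p(2)[of "exp (- x)"] True by auto
        from mult_left_mono[OF this, of "\<bar>indicator {0..} x * (exp (- 2 * x) * D x)\<bar>"]
        show ?thesis by (simp add: abs_mult mult_ac)
      qed auto
    qed
    also have "\<dots> = \<epsilon> * A" by (simp add: A_def)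
    finally show ?thesis .
  qed
  have "\<bar>J\<bar> \<le> 0"
  proof (rule field_le_epsilon)
    fix e :: real assume "e > 0"
    have "\<bar>J\<bar> \<le> e / (A + 1) * A" using A0 \<open>e > 0\<close> by (intro J_small) auto
    also have "\<dots> \<le> e" using A0 \<open>e > 0\<close> by (simp add: field_simps)
    finally show "\<bar>J\<bar> \<le> 0 + e" by simp
  qed
  then have "J = 0" by simp
  then have "(LINT x|lborel. indicator {0..} x * (exp (- 3 * x) * (D x)\<^sup>2)) = 0"
    by (simp only: J_def J_eq)
  then have "AE x in lborel. indicator {0..} x * (exp (- 3 * x) * (D x)\<^sup>2) = 0"
    using iJ unfolding J_eq by (subst (asm) integral_nonneg_eq_0_iff_AE) auto
  \<comment> \<open>The argument max 0 y extends D continuously to the whole line, so its zero set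
    is closed. A closed set containing almost every point of an open set contains all of it.\<close>
  then have "AE y in lborel. y \<in> {0<..} \<longrightarrow> y \<in> {y. D (max 0 y) = 0}"
    by eventually_elim auto
  then have "AE y\<in>{0<..} in lebesgue. y \<in> {y. D (max 0 y) = 0}"
    by (rule AE_completion)
  then have "x \<in> {y. D (max 0 y) = 0}"
  proof (rule mem_closed_if_AE_lebesgue_open[rotated 2])
    have "continuous_on UNIV (\<lambda>y. D (max 0 y))"
      by (intro continuous_on_compose2[OF cont] continuous_intros) auto
    then show "closed {y. D (max 0 y) = 0}"
      by (intro closed_Collect_eq continuous_intros)
  qed (use x in auto)
  then show ?thesis using x by simp
qed

lemma laplace_unique:
  fixes g :: "real \<Rightarrow> complex"
  assumes g: "continuous_on {0..} g" "\<And>x. x \<ge> 0 \<Longrightarrow> cmod (g x) \<le> C * exp (x / 4)"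
    and zero: "\<And>s. s \<ge> 1 \<Longrightarrow> laplace s g = 0" and x: "x > 0"
  shows "g x = 0"
proof (rule complex_eqI)
  have int: "integrable lborel (\<lambda>x. indicator {0..} x *\<^sub>R (exp (- s * x) *\<^sub>R g x))" if "s \<ge> 1" for s
    by (rule integrable_laplace[OF g that])
  have "Re (g x) = 0"
  proof (rule laplace_unique_real[OF _ _ _ _ x])
    show "continuous_on {0..} (\<lambda>x. Re (g x))" by (intro continuous_intros g)
    show "\<bar>Re (g x)\<bar> \<le> C * exp (x / 4)" if "x \<ge> 0" for x
      using g(2)[OF that] abs_Re_le_cmod[of "g x"] by linarith
    fix s :: real assume s: "s \<ge> 1"
    show "integrable lborel (\<lambda>x. indicator {0..} x * (exp (- s * x) * Re (g x)))"
      using integrable_Re[OF int[OF s]] by (simp add: mult.assoc)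
    show "(LINT x|lborel. indicator {0..} x * (exp (- s * x) * Re (g x))) = 0"
      using integral_Re[OF int[OF s]] zero[OF s] by (simp add: laplace_def mult.assoc)
  qed
  then show "Re (g x) = Re 0" by simp
  have "Im (g x) = 0"
  proof (rule laplace_unique_real[OF _ _ _ _ x])
    show "continuous_on {0..} (\<lambda>x. Im (g x))" by (intro continuous_intros g)
    show "\<bar>Im (g x)\<bar> \<le> C * exp (x / 4)" if "x \<ge> 0" for x
      using g(2)[OF that] abs_Im_le_cmod[of "g x"] by linarith
    fix s :: real assume s: "s \<ge> 1"
    show "integrable lborel (\<lambda>x. indicator {0..} x * (exp (- s * x) * Im (g x)))"
      using integrable_Im[OF int[OF s]] by (simp add: mult.assoc)
    show "(LINT x|lborel. indicator {0..} x * (exp (- s * x) * Im (g x))) = 0"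
      using integral_Im[OF int[OF s]] zero[OF s] by (simp add: laplace_def mult.assoc)
  qed
  then show "Im (g x) = Im 0" by simp
qed

section \<open>The Voronoi formula\<close>

text \<open>Termwise, x^(n+j) / (n+j)! transforms to s^(- n - j - 1), and what remains is the
  exponential series in - b / s. Thus the kernel turns exp (- b / s) into a transform in s, which is
  how the point - 1 / z enters.\<close>

lemma laplace_voronoi_kernel:
  fixes s b :: real
  assumes "s > 0"
  shows "laplace s (\<lambda>x. of_real (voronoi_kernel n b x)) = of_real (exp (- b / s) / s ^ Suc n)"
proof -
  define G where "G = (\<lambda>j x. (- b) ^ j / fact j * (indicator {0..} x * (exp (- s * x) * (x ^ (n + j) / fact (n + j)))) :: real)"
  have int: "has_bochner_integral lborel (G j) ((- b) ^ j / fact j * (1 / s ^ Suc (n + j)))" for j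
    unfolding G_def by (intro has_bochner_integral_mult_right has_bochner_integral_power_exp assms)
  have norm_G: "norm (G j x) = \<bar>b\<bar> ^ j / fact j * (indicator {0..} x * (exp (- s * x) * (x ^ (n + j) / fact (n + j))))" for j x
    by (auto simp: G_def abs_mult power_abs split: split_indicator)
  have intn: "has_bochner_integral lborel (\<lambda>x. norm (G j x)) (\<bar>b\<bar> ^ j / fact j * (1 / s ^ Suc (n + j)))" for j
    unfolding norm_G by (intro has_bochner_integral_mult_right has_bochner_integral_power_exp assms)
  have ex: "(\<lambda>j. c ^ j / fact j * (1 / s ^ Suc (n + j))) sums (exp (c / s) / s ^ Suc n)" for c :: real
  proof -
    have "(\<lambda>j. (c / s) ^ j /\<^sub>R fact j) sums exp (c / s)" by (rule exp_converges)
    from sums_divide[OF this, of "s ^ Suc n"] show ?thesis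
      using assms by (simp add: power_divide power_add field_simps)
  qed
  have xG: "G j x = indicator {0..} x * exp (- s * x) * x ^ n * ((- (b * x)) ^ j / (fact j * fact (n + j)))" for j x
  proof -
    have "(- (b * x)) ^ j = (- b) ^ j * x ^ j" by (simp add: power_mult_distrib[symmetric])
    then show ?thesis unfolding G_def by (simp add: power_add field_simps)
  qed
  have sG: "(\<lambda>j. G j x) sums (indicator {0..} x * exp (- s * x) * x ^ n * bessel_clifford n (- (b * x)))" for x
    unfolding xG bessel_clifford_def by (intro sums_mult summable_sums summable_bessel_clifford)
  have "(\<lambda>j. integral\<^sup>L lborel (G j)) sums (LINT x|lborel. (\<Sum>j. G j x))"
  proof (rule sums_integral)
    show "integrable lborel (G j)" for j using int by (auto simp: has_bochner_integral_iff)
    have "summable (\<lambda>j. norm (G j x))" for x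
    proof -
      have "norm (G j x) = indicator {0..} x * exp (- s * x) * x ^ n * (((\<bar>b\<bar> * x)) ^ j / (fact j * fact (n + j)))" for j
        unfolding norm_G by (simp add: power_add power_mult_distrib field_simps)
      then show ?thesis using summable_mult[OF summable_bessel_clifford[of "\<bar>b\<bar> * x" n]] by simp
    qed
    then show "AE x in lborel. summable (\<lambda>j. norm (G j x))" by simp
    have "(LINT x|lborel. norm (G j x)) = \<bar>b\<bar> ^ j / fact j * (1 / s ^ Suc (n + j))" for j
      using intn by (rule has_bochner_integral_integral_eq)
    then show "summable (\<lambda>j. LINT x|lborel. norm (G j x))"
      using sums_summable[OF ex[of "\<bar>b\<bar>"]] by simp
  qed
  moreover have "integral\<^sup>L lborel (G j) = (- b) ^ j / fact j * (1 / s ^ Suc (n + j))" for j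
    using int by (rule has_bochner_integral_integral_eq)
  ultimately have "(\<lambda>j. (- b) ^ j / fact j * (1 / s ^ Suc (n + j))) sums (LINT x|lborel. (\<Sum>j. G j x))"
    by simp
  then have "(LINT x|lborel. (\<Sum>j. G j x)) = exp (- b / s) / s ^ Suc n"
    using ex[of "- b"] by (rule sums_unique2)
  moreover have "(\<Sum>j. G j x) = indicator {0..} x * (exp (- s * x) * voronoi_kernel n b x)" for x
    using sums_unique[OF sG[of x]] by (simp add: voronoi_kernel_def mult_ac)
  ultimately have "(LINT x|lborel. indicator {0..} x * (exp (- s * x) * voronoi_kernel n b x)) = exp (- b / s) / s ^ Suc n"
    by simp
  moreover have "laplace s (\<lambda>x. of_real (voronoi_kernel n b x)) =
      (LINT x|lborel. complex_of_real (indicator {0..} x * (exp (- s * x) * voronoi_kernel n b x)))"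
    unfolding laplace_def by (simp add: scaleR_conv_of_real)
  ultimately show ?thesis by (simp only: integral_complex_of_real)
qed

lemma laplace_ramp:
  fixes s c :: real
  assumes "s > 0" "c \<ge> 0"
  shows "laplace s (\<lambda>x. of_real (max 0 (x - c))) = of_real (exp (- s * c) / s\<^sup>2)"
proof -
  let ?F = "\<lambda>u. indicator {0..} u * (exp (- s * u) * (u ^ 1 / fact 1)) :: real"
  have "has_bochner_integral lborel (\<lambda>x. ?F (- c + 1 * x)) ((1 / s ^ Suc 1) /\<^sub>R \<bar>1\<bar>)"
    by (subst lborel_has_bochner_integral_real_affine_iff[symmetric])
       (use has_bochner_integral_power_exp[OF assms(1), of 1] in auto)
  then have "has_bochner_integral lborel (\<lambda>x. exp (- s * c) * ?F (- c + 1 * x)) (exp (- s * c) * ((1 / s ^ Suc 1) /\<^sub>R \<bar>1\<bar>))"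
    by (rule has_bochner_integral_mult_right)
  moreover have "exp (- s * c) * ?F (- c + 1 * x) = indicator {0..} x * (exp (- s * x) * max 0 (x - c))" for x
  proof -
    have "exp (- s * c) * exp (- s * (- c + x)) = exp (- s * x)"
      by (simp add: exp_add[symmetric] algebra_simps)
    then show ?thesis
      using assms(2) by (auto simp: max_def split: split_indicator)
  qed
  ultimately have "has_bochner_integral lborel (\<lambda>x. indicator {0..} x * (exp (- s * x) * max 0 (x - c)))
      (exp (- s * c) * ((1 / s ^ Suc 1) /\<^sub>R \<bar>1\<bar>))"
    by (simp only:)
  then have "(LINT x|lborel. indicator {0..} x * (exp (- s * x) * max 0 (x - c))) = exp (- s * c) / s\<^sup>2"
    by (subst has_bochner_integral_integral_eq) (auto simp: power2_eq_square)
  moreover have "laplace s (\<lambda>x. of_real (max 0 (x - c))) =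
      (LINT x|lborel. complex_of_real (indicator {0..} x * (exp (- s * x) * max 0 (x - c))))"
    unfolding laplace_def by (simp add: scaleR_conv_of_real)
  ultimately show ?thesis by (simp only: integral_complex_of_real)
qed

text \<open>A nonzero factor does not change integrability, and both sides are 0 if it fails or if c
  = 0; hence the identity holds for every g.\<close>

lemma laplace_cmult: "laplace s (\<lambda>x. c * g x) = c * laplace s g"
proof -
  have "laplace s (\<lambda>x. c * g x) = (LINT x|lborel. c * (indicator {0..} x *\<^sub>R (exp (- s * x) *\<^sub>R g x)))"
    unfolding laplace_def by (rule Bochner_Integration.integral_cong) auto
  then show ?thesis by (simp only: laplace_def integral_mult_right_zero)
qed

text \<open>Adapts the kernel bound to the exponential rate used for Laplace transforms, keeping the
  power of b, which provides the convergence over m. At x = 0 the kernel vanishes because its index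
  is positive.\<close>

lemma voronoi_kernel_exp_quarter_bound:
  "\<exists>C\<ge>0. \<forall>b>0. \<forall>x\<ge>0. \<bar>voronoi_kernel (Suc n) b x\<bar> \<le> C * b powr (- real (Suc n) / 2 - 1/4) * exp (x / 4)"
proof -
  obtain C where C: "\<And>b x. b > 0 \<Longrightarrow> x > 0 \<Longrightarrow>
      \<bar>voronoi_kernel (Suc n) b x\<bar> \<le> C * x powr (real (Suc n) / 2 - 1/4) * b powr (- real (Suc n) / 2 - 1/4)"
    using voronoi_kernel_bound[of "Suc n"] by blast
  have C0: "C \<ge> 0" using order_trans[OF abs_ge_zero C[of 1 1]] by simp
  define K :: real where "K = 1 + 4 ^ Suc n * fact (Suc n)"
  have K: "x powr (real (Suc n) / 2 - 1/4) \<le> K * exp (x / 4)" if "x > 0" for x :: real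
  proof -
    have "x powr (real (Suc n) / 2 - 1/4) \<le> 1 + x ^ Suc n"
    proof (cases "x \<ge> 1")
      case True
      have "x powr (real (Suc n) / 2 - 1/4) \<le> x powr (real (Suc n))"
        using True by (intro powr_mono) (auto simp: field_simps)
      then show ?thesis using that by (simp add: powr_realpow del: power_Suc of_nat_Suc)
    next
      case False
      have "x powr (real (Suc n) / 2 - 1/4) \<le> 1" using False that by (intro powr_le1) (auto simp: field_simps)
      moreover have "x ^ Suc n \<ge> 0" using that by simp
      ultimately show ?thesis by linarith
    qed
    also have "x ^ Suc n = 4 ^ Suc n * (x / 4) ^ Suc n" by (simp add: power_divide)
    also have "(x / 4) ^ Suc n \<le> fact (Suc n) * exp (x / 4)" using that by (intro power_le_fact_exp) auto
    finally have "x powr (real (Suc n) / 2 - 1/4) \<le> 1 + 4 ^ Suc n * (fact (Suc n) * exp (x / 4))" by simp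
    also have "\<dots> \<le> K * exp (x / 4)" using that by (simp add: K_def algebra_simps)
    finally show ?thesis .
  qed
  have "\<bar>voronoi_kernel (Suc n) b x\<bar> \<le> C * K * b powr (- real (Suc n) / 2 - 1/4) * exp (x / 4)" if "b > 0" "x \<ge> 0" for b x
  proof (cases "x = 0")
    case True
    have "voronoi_kernel (Suc n) b 0 = 0" by (simp add: voronoi_kernel_def)
    moreover have "K \<ge> 0" by (simp add: K_def)
    ultimately show ?thesis using True C0 by simp
  next
    case False
    have "\<bar>voronoi_kernel (Suc n) b x\<bar> \<le> C * x powr (real (Suc n) / 2 - 1/4) * b powr (- real (Suc n) / 2 - 1/4)"
      using False that by (intro C) auto
    also have "\<dots> \<le> C * (K * exp (x / 4)) * b powr (- real (Suc n) / 2 - 1/4)"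
      using False that C0 by (intro mult_right_mono mult_left_mono K) auto
    finally show ?thesis by (simp only: mult_ac)
  qed
  moreover have "C * K \<ge> 0" using C0 by (simp add: K_def)
  ultimately show ?thesis by blast
qed

text \<open>The matrix with rows (0, - 1) and (1, 0) acts by - 1 / z and takes the point i s / (2
  pi) to 2 pi i / s.\<close>

lemma cusp_form_inversion:
  assumes f: "cusp_form_SL2Z k f" and s: "s > 0"
  shows "f (\<i> * of_real (2 * pi / s)) = (\<i> * of_real (s / (2 * pi))) ^ k * f (\<i> * of_real (s / (2 * pi)))"
proof -
  let ?z = "\<i> * of_real (s / (2 * pi))"
  have "?z \<in> upper_half_plane" using s by (simp add: upper_half_plane_def)
  moreover have "(0::int) * 0 - (- 1) * 1 = 1" by simp
  ultimately have "f ((of_int 0 * ?z + of_int (- 1)) / (of_int 1 * ?z + of_int 0)) = (of_int 1 * ?z + of_int 0) ^ k * f ?z"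
    using f unfolding cusp_form_SL2Z_def by blast
  moreover have "(of_int 0 * ?z + of_int (- 1)) / (of_int 1 * ?z + of_int 0) = \<i> * of_real (2 * pi / s)"
    using s by (simp add: field_simps)
  ultimately show ?thesis by simp
qed

text \<open>The constant is the one that cancels the automorphy factor (i s / (2 pi))^k down to s^k.
  This s^k is exactly the quotient of the powers s^(k+2) and s^2 contributed by the kernel of order
  k + 1 and by the ramp.\<close>

theorem voronoi_formula:
  assumes f: "cusp_form_SL2Z k f" and fa: "cusp_fourier_expansion f a" and k: "k \<ge> 1" and x: "x > 0"
  shows "(\<Sum>n. a (Suc n) * of_real (max 0 (x - real (Suc n)))) =
     (2 * of_real pi / \<i>) ^ k * (\<Sum>n. a (Suc n) * of_real (voronoi_kernel (Suc k) (4 * pi\<^sup>2 * real (Suc n)) x))"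
proof -
  obtain C where C: "C \<ge> 0" "\<forall>M\<ge>1. (\<Sum>m=1..M. (cmod (a m))\<^sup>2) \<le> C * real M ^ k"
    using cusp_coeff_second_moment[OF f fa] by blast
  obtain B where B: "B \<ge> 0" "\<And>b x. b > 0 \<Longrightarrow> x \<ge> 0 \<Longrightarrow>
      \<bar>voronoi_kernel (Suc k) b x\<bar> \<le> B * b powr (- real (Suc k) / 2 - 1/4) * exp (x / 4)"
    using voronoi_kernel_exp_quarter_bound[of k] by blast
  define g where "g = (\<lambda>n x. a (Suc n) * of_real (max 0 (x - real (Suc n))))"
  define h where "h = (\<lambda>n x. a (Suc n) * of_real (voronoi_kernel (Suc k) (4 * pi\<^sup>2 * real (Suc n)) x))"
  \<comment> \<open>The height 1 / (8 pi) makes the n-th damping factor exp (- n / 4), matching the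
    bound 4 exp (d / 4) for the ramp at d = x - n.\<close>
  define Mg where "Mg = (\<lambda>n. 4 * (cmod (a (Suc n)) * exp (- (2 * pi * (1 / (8 * pi)))) ^ Suc n))"
  \<comment> \<open>Order k + 1 gives the exponent - (k + 1) / 2 - 1/4, which lies 1/4 below the
    threshold - k / 2 - 1/2 of absolute convergence.\<close>
  define Mh where "Mh = (\<lambda>n. B * (4 * pi\<^sup>2) powr (- real k / 2 - 1/2 - 1/4) * (cmod (a (Suc n)) * real (Suc n) powr (- real k / 2 - 1/2 - 1/4)))"
  have sMg: "summable Mg" unfolding Mg_def
    by (intro summable_mult summable_cusp_coeff_exp[OF fa]) auto
  have sMh: "summable Mh" unfolding Mh_def
    by (intro summable_mult summable_cusp_coeff_powr[OF C(2) C(1) k]) auto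
  have cg: "continuous_on {0..} (g n)" for n unfolding g_def by (intro continuous_intros)
  have ch: "continuous_on {0..} (h n)" for n unfolding h_def by (intro continuous_intros continuous_on_voronoi_kernel)
  have ramp: "max 0 d \<le> 4 * exp (d / 4)" for d :: real
    using exp_ge_add_one_self[of "d / 4"] exp_gt_zero[of "d / 4"] by (intro max.boundedI) linarith+
  have bg: "cmod (g n x) \<le> Mg n * exp (x / 4)" if "x \<ge> 0" for n x
  proof -
    have "max 0 (x - real (Suc n)) \<le> 4 * exp ((x - real (Suc n)) / 4)"
      by (rule ramp)
    also have "\<dots> = 4 * (exp (- (2 * pi * (1 / (8 * pi)))) ^ Suc n * exp (x / 4))"
    proof -
      have "exp (- (2 * pi * (1 / (8 * pi)))) ^ Suc n = exp (- (real (Suc n) / 4))"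
        by (subst exp_of_nat_mult[symmetric]) simp
      then show ?thesis by (simp add: exp_add[symmetric] diff_divide_distrib del: of_nat_Suc)
    qed
    finally have "cmod (a (Suc n)) * max 0 (x - real (Suc n)) \<le>
       cmod (a (Suc n)) * (4 * (exp (- (2 * pi * (1 / (8 * pi)))) ^ Suc n * exp (x / 4)))"
      by (intro mult_left_mono) auto
    moreover have "cmod (g n x) = cmod (a (Suc n)) * max 0 (x - real (Suc n))"
      by (simp add: g_def norm_mult)
    ultimately show ?thesis unfolding Mg_def by (simp only: mult_ac)
  qed
  have bh: "cmod (h n x) \<le> Mh n * exp (x / 4)" if "x \<ge> 0" for n x
  proof -
    have "cmod (h n x) = cmod (a (Suc n)) * \<bar>voronoi_kernel (Suc k) (4 * pi\<^sup>2 * real (Suc n)) x\<bar>"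
      by (simp add: h_def norm_mult)
    also have "\<dots> \<le> cmod (a (Suc n)) * (B * (4 * pi\<^sup>2 * real (Suc n)) powr (- real (Suc k) / 2 - 1/4) * exp (x / 4))"
      using that by (intro mult_left_mono B) auto
    also have "(4 * pi\<^sup>2 * real (Suc n)) powr (- real (Suc k) / 2 - 1/4) =
        (4 * pi\<^sup>2) powr (- real (Suc k) / 2 - 1/4) * real (Suc n) powr (- real (Suc k) / 2 - 1/4)"
      by (rule powr_mult)
    also have "- real (Suc k) / 2 - 1/4 = - real k / 2 - 1/2 - 1/4" by (simp add: field_simps)
    finally show ?thesis unfolding Mh_def by (simp only: mult_ac)
  qed
  let ?c = "(2 * of_real pi / \<i>) ^ k"
  note sg = series_exp_quarter_bound(2)[OF bg sMg] and sh = series_exp_quarter_bound(2)[OF bh sMh]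
  note cg' = continuous_on_series_exp_quarter[OF cg bg sMg] and ch' = continuous_on_series_exp_quarter[OF ch bh sMh]
  have "(\<Sum>n. g n x) - ?c * (\<Sum>n. h n x) = 0"
  proof (rule laplace_unique[OF _ _ _ x])
    show "continuous_on {0..} (\<lambda>x. (\<Sum>n. g n x) - ?c * (\<Sum>n. h n x))"
      by (intro continuous_intros cg' ch')
    show "cmod ((\<Sum>n. g n x) - ?c * (\<Sum>n. h n x)) \<le> (suminf Mg + cmod ?c * suminf Mh) * exp (x / 4)" if "x \<ge> 0" for x
    proof -
      have "cmod ((\<Sum>n. g n x) - ?c * (\<Sum>n. h n x)) \<le> cmod (\<Sum>n. g n x) + cmod ?c * cmod (\<Sum>n. h n x)"
        by (metis norm_mult norm_triangle_ineq4)
      also have "\<dots> \<le> suminf Mg * exp (x / 4) + cmod ?c * (suminf Mh * exp (x / 4))"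
        using that by (intro add_mono mult_left_mono sg sh) auto
      finally show ?thesis by (simp add: algebra_simps)
    qed
    fix s :: real assume s: "s \<ge> 1"
    then have s0: "s > 0" by simp
    have expansion: "(\<lambda>n. a (Suc n) * of_real (exp (- t * real (Suc n)))) sums f (\<i> * of_real (t / (2 * pi)))" if "t > 0" for t
    proof -
      have "\<i> * of_real (t / (2 * pi)) \<in> upper_half_plane" using that by (simp add: upper_half_plane_def)
      with fa have "(\<lambda>n. a (Suc n) * exp (2 * of_real pi * \<i> * of_nat (Suc n) * (\<i> * of_real (t / (2 * pi))))) sums f (\<i> * of_real (t / (2 * pi)))"
        unfolding cusp_fourier_expansion_def by blast
      moreover have "exp (2 * of_real pi * \<i> * of_nat (Suc n) * (\<i> * of_real (t / (2 * pi)))) = of_real (exp (- t * real (Suc n)))" for n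
        unfolding exp_of_real[symmetric] by (rule arg_cong[where f = exp]) (simp add: field_simps)
      ultimately show ?thesis by simp
    qed
    have "(\<lambda>n. laplace s (g n)) sums laplace s (\<lambda>x. \<Sum>n. g n x)"
      by (rule laplace_series[OF cg bg sMg s])
    moreover have "laplace s (g n) = a (Suc n) * of_real (exp (- s * real (Suc n))) / of_real (s\<^sup>2)" for n
      unfolding g_def laplace_cmult by (subst laplace_ramp[OF s0]) auto
    ultimately have Lg: "laplace s (\<lambda>x. \<Sum>n. g n x) = f (\<i> * of_real (s / (2 * pi))) / of_real (s\<^sup>2)"
      using sums_divide[OF expansion[OF s0], of "of_real (s\<^sup>2)"] by (simp add: sums_unique2)
    have "(\<lambda>n. laplace s (h n)) sums laplace s (\<lambda>x. \<Sum>n. h n x)"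
      by (rule laplace_series[OF ch bh sMh s])
    moreover have "laplace s (h n) = a (Suc n) * of_real (exp (- (4 * pi\<^sup>2 / s) * real (Suc n))) / of_real (s ^ Suc (Suc k))" for n
      unfolding h_def laplace_cmult by (subst laplace_voronoi_kernel[OF s0]) auto
    moreover have "4 * pi\<^sup>2 / s > 0" using s0 by simp
    ultimately have "laplace s (\<lambda>x. \<Sum>n. h n x) = f (\<i> * of_real (4 * pi\<^sup>2 / s / (2 * pi))) / of_real (s ^ Suc (Suc k))"
      using sums_divide[OF expansion[of "4 * pi\<^sup>2 / s"], of "of_real (s ^ Suc (Suc k))"] by (simp add: sums_unique2)
    also have "4 * pi\<^sup>2 / s / (2 * pi) = 2 * pi / s" by (simp add: power2_eq_square)
    also have "f (\<i> * of_real (2 * pi / s)) = (\<i> * of_real (s / (2 * pi))) ^ k * f (\<i> * of_real (s / (2 * pi)))"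
      by (rule cusp_form_inversion[OF f s0])
    finally have Lh: "laplace s (\<lambda>x. \<Sum>n. h n x) =
       (\<i> * of_real (s / (2 * pi))) ^ k * f (\<i> * of_real (s / (2 * pi))) / of_real (s ^ Suc (Suc k))" .
    have "?c * (\<i> * of_real (s / (2 * pi))) ^ k = of_real s ^ k"
      by (simp add: power_mult_distrib[symmetric])
    then have "?c * laplace s (\<lambda>x. \<Sum>n. h n x) = of_real s ^ k * f (\<i> * of_real (s / (2 * pi))) / of_real (s ^ Suc (Suc k))"
      unfolding Lh by (simp only: times_divide_eq_right mult.assoc[symmetric])
    also have "\<dots> = laplace s (\<lambda>x. \<Sum>n. g n x)"
      unfolding Lg using s0 by (simp add: power2_eq_square)
    finally show "laplace s (\<lambda>x. (\<Sum>n. g n x) - ?c * (\<Sum>n. h n x)) = 0"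
      by (subst laplace_diff_cmult[OF cg' sg ch' sh s]) simp_all
  qed
  then show ?thesis by (simp add: g_def h_def)
qed

section \<open>Mean squares of exponential sums\<close>

text \<open>For p = sqrt m and q = sqrt n one has 1 / (p - q) = (p + q) / (m - n). The square of x p
  - y q yields 2 x y p \<le> x^2 p (p^2 / q^2) + y^2 q, and p^2 / q^2 = 1 + (p^2 - q^2) / q^2 splits
  off a term without the small denominator.\<close>

lemma sqrt_gap_pair_bound_ordered:
  fixes x y p q :: real
  assumes q: "0 < q" "q < p" and xy: "0 \<le> x" "0 \<le> y"
  shows "x * y / (p - q) \<le> (x\<^sup>2 * p + y\<^sup>2 * q) / (p\<^sup>2 - q\<^sup>2) + x\<^sup>2 * p / q\<^sup>2"
proof -
  have pq: "p\<^sup>2 - q\<^sup>2 > 0" using q by (simp add: power_strict_mono)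
  have "0 \<le> q * (x * p - y * q)\<^sup>2" using q by simp
  also have "\<dots> = x\<^sup>2 * p\<^sup>2 * q + y\<^sup>2 * q ^ 3 - 2 * x * y * p * q\<^sup>2"
    by (simp add: power2_eq_square power3_eq_cube algebra_simps)
  also have "x\<^sup>2 * p\<^sup>2 * q \<le> x\<^sup>2 * p\<^sup>2 * p" using q by (intro mult_left_mono) auto
  finally have "2 * x * y * p * q\<^sup>2 \<le> x\<^sup>2 * p * p\<^sup>2 + y\<^sup>2 * q ^ 3" by (simp add: power2_eq_square mult_ac)
  then have "(2 * x * y * p * q\<^sup>2) / q\<^sup>2 \<le> (x\<^sup>2 * p * p\<^sup>2 + y\<^sup>2 * q ^ 3) / q\<^sup>2"
    by (intro divide_right_mono) auto
  then have 1: "2 * x * y * p \<le> x\<^sup>2 * p * p\<^sup>2 / q\<^sup>2 + y\<^sup>2 * q"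
    using q by (simp add: add_divide_distrib power2_eq_square power3_eq_cube)
  have "x * y / (p - q) = x * y * (p + q) / (p\<^sup>2 - q\<^sup>2)"
    using q pq by (simp add: field_simps power2_eq_square)
  also have "\<dots> \<le> (2 * x * y * p) / (p\<^sup>2 - q\<^sup>2)"
  proof (rule divide_right_mono)
    have "x * y * (p + q) \<le> x * y * (2 * p)" using q xy by (intro mult_left_mono) auto
    then show "x * y * (p + q) \<le> 2 * x * y * p" by (simp add: mult_ac)
  qed (use pq in auto)
  also have "\<dots> \<le> (x\<^sup>2 * p * p\<^sup>2 / q\<^sup>2 + y\<^sup>2 * q) / (p\<^sup>2 - q\<^sup>2)"
    using 1 pq by (intro divide_right_mono) auto
  also have "\<dots> = (x\<^sup>2 * p + y\<^sup>2 * q) / (p\<^sup>2 - q\<^sup>2) + x\<^sup>2 * p / q\<^sup>2"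
    using q pq by (simp add: divide_simps) (simp add: algebra_simps)
  finally show ?thesis .
qed

lemma sqrt_gap_pair_bound:
  fixes m n :: nat and x y :: real
  assumes "m \<ge> 1" "n \<ge> 1" "m \<noteq> n" "0 \<le> x" "0 \<le> y"
  shows "x * y / \<bar>sqrt m - sqrt n\<bar> \<le>
    (x\<^sup>2 * sqrt m + y\<^sup>2 * sqrt n) / \<bar>real m - real n\<bar> + x\<^sup>2 * sqrt m / real n + y\<^sup>2 * sqrt n / real m"
proof (cases "n < m")
  case True
  have "x * y / (sqrt m - sqrt n) \<le> (x\<^sup>2 * sqrt m + y\<^sup>2 * sqrt n) / ((sqrt m)\<^sup>2 - (sqrt n)\<^sup>2) + x\<^sup>2 * sqrt m / (sqrt n)\<^sup>2"
    using assms True by (intro sqrt_gap_pair_bound_ordered) auto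
  then show ?thesis using True assms by (simp add: add_increasing2)
next
  case False
  then have "m < n" using assms by simp
  have "y * x / (sqrt n - sqrt m) \<le> (y\<^sup>2 * sqrt n + x\<^sup>2 * sqrt m) / ((sqrt n)\<^sup>2 - (sqrt m)\<^sup>2) + y\<^sup>2 * sqrt n / (sqrt m)\<^sup>2"
    using assms \<open>m < n\<close> by (intro sqrt_gap_pair_bound_ordered) auto
  moreover have "0 \<le> x\<^sup>2 * sqrt m / real n" by simp
  moreover have "x * y / \<bar>sqrt m - sqrt n\<bar> = y * x / (sqrt n - sqrt m)"
    "(x\<^sup>2 * sqrt m + y\<^sup>2 * sqrt n) / \<bar>real m - real n\<bar> = (y\<^sup>2 * sqrt n + x\<^sup>2 * sqrt m) / ((sqrt n)\<^sup>2 - (sqrt m)\<^sup>2)"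
    "y\<^sup>2 * sqrt n / real m = y\<^sup>2 * sqrt n / (sqrt m)\<^sup>2"
    using \<open>m < n\<close> by (simp_all add: mult.commute add.commute)
  ultimately show ?thesis by linarith
qed

lemma sum_inverse_gap_le_harm:
  assumes "m \<in> {1..N}"
  shows "(\<Sum>n\<in>{1..N}-{m}. 1 / \<bar>real m - real n\<bar>) \<le> 2 * harm N"
proof -
  have m: "1 \<le> m" "m \<le> N" using assms by auto
  have "{1..N}-{m} = {1..<m} \<union> {m<..N}" using m by auto
  moreover have "(\<Sum>n\<in>{1..<m} \<union> {m<..N}. 1 / \<bar>real m - real n\<bar>) =
      (\<Sum>n\<in>{1..<m}. 1 / \<bar>real m - real n\<bar>) + (\<Sum>n\<in>{m<..N}. 1 / \<bar>real m - real n\<bar>)"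
    by (rule sum.union_disjoint) auto
  ultimately have "(\<Sum>n\<in>{1..N}-{m}. 1 / \<bar>real m - real n\<bar>) =
      (\<Sum>n\<in>{1..<m}. 1 / \<bar>real m - real n\<bar>) + (\<Sum>n\<in>{m<..N}. 1 / \<bar>real m - real n\<bar>)"
    by metis
  also have "(\<Sum>n\<in>{1..<m}. 1 / \<bar>real m - real n\<bar>) = (\<Sum>d\<in>{1..m - 1}. inverse (real d))"
    by (rule sum.reindex_bij_witness[of _ "\<lambda>d. m - d" "\<lambda>n. m - n"]) (auto simp: of_nat_diff divide_inverse)
  also have "\<dots> \<le> harm N" unfolding harm_def using m by (intro sum_mono2) auto
  also have "(\<Sum>n\<in>{m<..N}. 1 / \<bar>real m - real n\<bar>) = (\<Sum>d\<in>{1..N - m}. inverse (real d))"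
    by (rule sum.reindex_bij_witness[of _ "\<lambda>d. m + d" "\<lambda>n. n - m"]) (auto simp: of_nat_diff divide_inverse)
  also have "\<dots> \<le> harm N" unfolding harm_def using m by (intro sum_mono2) auto
  finally show ?thesis by simp
qed

text \<open>An elementary substitute for the weighted Hilbert inequality of Montgomery and Vaughan,
  at the cost of the factor \<open>harm N\<close>. The 6 collects 2 + 2 from the terms with
  denominator \<bar>m - n\<bar>, which has two sides, and 1 + 1 from the regular terms.\<close>

lemma sqrt_gap_bilinear_bound:
  fixes x :: "nat \<Rightarrow> real"
  assumes x: "\<And>m. x m \<ge> 0"
  shows "(\<Sum>m=1..N. \<Sum>n\<in>{1..N}-{m}. x m * x n / \<bar>sqrt m - sqrt n\<bar>) \<le> 6 * harm N * (\<Sum>m=1..N. (x m)\<^sup>2 * sqrt m)"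
proof -
  define d where "d = (\<lambda>m. (x m)\<^sup>2 * sqrt (real m))"
  have d: "d m \<ge> 0" for m by (simp add: d_def)
  let ?I = "{1..N}"
  have "(\<Sum>m\<in>?I. \<Sum>n\<in>?I-{m}. x m * x n / \<bar>sqrt m - sqrt n\<bar>) \<le>
     (\<Sum>m\<in>?I. \<Sum>n\<in>?I-{m}. (d m + d n) / \<bar>real m - real n\<bar> + d m / real n + d n / real m)"
    unfolding d_def by (intro sum_mono sqrt_gap_pair_bound x) auto
  also have "\<dots> = (\<Sum>m\<in>?I. \<Sum>n\<in>?I-{m}. d m * (1 / \<bar>real m - real n\<bar>)) + (\<Sum>m\<in>?I. \<Sum>n\<in>?I-{m}. d n * (1 / \<bar>real m - real n\<bar>))
     + (\<Sum>m\<in>?I. \<Sum>n\<in>?I-{m}. d m / real n) + (\<Sum>m\<in>?I. \<Sum>n\<in>?I-{m}. d n / real m)"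
    by (simp add: sum.distrib add_divide_distrib)
  also have "(\<Sum>m\<in>?I. \<Sum>n\<in>?I-{m}. d n * (1 / \<bar>real m - real n\<bar>)) = (\<Sum>m\<in>?I. \<Sum>n\<in>?I-{m}. d m * (1 / \<bar>real m - real n\<bar>))"
  proof -
    have "(\<Sum>m\<in>?I. \<Sum>n\<in>?I-{m}. d n * (1 / \<bar>real m - real n\<bar>)) = (\<Sum>m\<in>?I. \<Sum>n\<in>{n\<in>?I. m \<noteq> n}. d n * (1 / \<bar>real m - real n\<bar>))"
      by (intro sum.cong refl) auto
    also have "\<dots> = (\<Sum>n\<in>?I. \<Sum>m\<in>{m\<in>?I. m \<noteq> n}. d n * (1 / \<bar>real m - real n\<bar>))"
      by (rule sum.swap_restrict) auto
    also have "\<dots> = (\<Sum>n\<in>?I. \<Sum>m\<in>?I-{n}. d n * (1 / \<bar>real n - real m\<bar>))"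
      by (intro sum.cong) (auto simp: abs_minus_commute)
    finally show ?thesis .
  qed
  also have "(\<Sum>m\<in>?I. \<Sum>n\<in>?I-{m}. d n / real m) = (\<Sum>m\<in>?I. \<Sum>n\<in>?I-{m}. d m / real n)"
  proof -
    have "(\<Sum>m\<in>?I. \<Sum>n\<in>?I-{m}. d n / real m) = (\<Sum>m\<in>?I. \<Sum>n\<in>{n\<in>?I. m \<noteq> n}. d n / real m)"
      by (intro sum.cong refl) auto
    also have "\<dots> = (\<Sum>n\<in>?I. \<Sum>m\<in>{m\<in>?I. m \<noteq> n}. d n / real m)"
      by (rule sum.swap_restrict) auto
    also have "\<dots> = (\<Sum>n\<in>?I. \<Sum>m\<in>?I-{n}. d n / real m)"
      by (intro sum.cong) auto
    finally show ?thesis .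
  qed
  also have "(\<Sum>m\<in>?I. \<Sum>n\<in>?I-{m}. d m * (1 / \<bar>real m - real n\<bar>)) \<le> (\<Sum>m\<in>?I. d m * (2 * harm N))"
    unfolding sum_distrib_left[symmetric] by (intro sum_mono mult_left_mono sum_inverse_gap_le_harm d)
  also have "(\<Sum>m\<in>?I. \<Sum>n\<in>?I-{m}. d m / real n) \<le> (\<Sum>m\<in>?I. d m * harm N)"
  proof (rule sum_mono)
    fix m
    have "(\<Sum>n\<in>?I-{m}. inverse (real n)) \<le> harm N" unfolding harm_def by (intro sum_mono2) auto
    then have "d m * (\<Sum>n\<in>?I-{m}. inverse (real n)) \<le> d m * harm N" by (intro mult_left_mono d)
    then show "(\<Sum>n\<in>?I-{m}. d m / real n) \<le> d m * harm N" by (simp add: sum_distrib_left divide_inverse)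
  qed
  finally have "(\<Sum>m\<in>?I. \<Sum>n\<in>?I-{m}. x m * x n / \<bar>sqrt m - sqrt n\<bar>) \<le>
      (\<Sum>m\<in>?I. d m * (2 * harm N)) + (\<Sum>m\<in>?I. d m * (2 * harm N)) + (\<Sum>m\<in>?I. d m * harm N) + (\<Sum>m\<in>?I. d m * harm N)"
    by simp
  also have "\<dots> = 6 * harm N * (\<Sum>m\<in>?I. d m)"
    unfolding sum_distrib_right[symmetric] by (simp add: algebra_simps)
  finally show ?thesis by (simp add: d_def)
qed

text \<open>The weight \<open>1 / (2 * sqrt x)\<close>, at least \<open>1 / (2 * sqrt B)\<close> on the interval, makes the off-diagonal integrals elementary.\<close>

lemma exponential_sum_mean_square:
  fixes c :: "nat \<Rightarrow> complex" and A B \<sigma> :: real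
  assumes A: "0 < A" "A \<le> B" and \<sigma>: "\<bar>\<sigma>\<bar> = 1"
  shows "integral {A..B} (\<lambda>x. (cmod (\<Sum>m=1..N. c m * cis (\<sigma> * (4 * pi * sqrt m * sqrt x))))\<^sup>2) \<le>
    2 * sqrt B * ((sqrt B - sqrt A) * (\<Sum>m=1..N. (cmod (c m))\<^sup>2) + 6 * harm N * (\<Sum>m=1..N. (cmod (c m))\<^sup>2 * sqrt m))"
proof -
  let ?I = "{1..N}"
  define L where "L = (\<lambda>m. \<sigma> * 4 * pi * sqrt (real m))"
  define P where "P = (\<lambda>x. \<Sum>m\<in>?I. c m * cis (L m * sqrt x))"
  define T where "T = (\<lambda>m n. c m * cnj (c n) * (if m = n then of_real (sqrt B - sqrt A)
        else (cis ((L m - L n) * sqrt B) - cis ((L m - L n) * sqrt A)) / (\<i> * of_real (L m - L n))))"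
  have \<sigma>0: "\<sigma> \<noteq> 0" using \<sigma> by auto
  have "((\<lambda>x. of_real ((cmod (P x))\<^sup>2 * (inverse (sqrt x) / 2))) has_integral (\<Sum>m\<in>?I. \<Sum>n\<in>?I. T m n)) {A..B}"
    unfolding P_def T_def
  proof (rule has_integral_norm_exponential_sum_squared)
    show "inj_on L ?I" using \<sigma>0 by (auto simp: inj_on_def L_def)
    fix x assume "x \<in> {A..B}"
    then show "(sqrt has_real_derivative inverse (sqrt x) / 2) (at x within {A..B})"
      using A by (intro has_field_derivative_at_within[OF DERIV_real_sqrt]) auto
  qed (use A in auto)
  from has_integral_linear[OF this bounded_linear_Re]
  have I: "((\<lambda>x. (cmod (P x))\<^sup>2 * (inverse (sqrt x) / 2)) has_integral Re (\<Sum>m\<in>?I. \<Sum>n\<in>?I. T m n)) {A..B}"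
    by (simp only: o_def Re_complex_of_real)
  have cont: "continuous_on {A..B} P" unfolding P_def by (intro continuous_intros)
  have "integral {A..B} (\<lambda>x. (cmod (P x))\<^sup>2) \<le> 2 * sqrt B * Re (\<Sum>m\<in>?I. \<Sum>n\<in>?I. T m n)"
  proof (rule has_integral_le)
    show "((\<lambda>x. (cmod (P x))\<^sup>2) has_integral integral {A..B} (\<lambda>x. (cmod (P x))\<^sup>2)) {A..B}"
      by (intro integrable_integral integrable_continuous_interval continuous_intros cont)
    show "((\<lambda>x. 2 * sqrt B * ((cmod (P x))\<^sup>2 * (inverse (sqrt x) / 2))) has_integral
        2 * sqrt B * Re (\<Sum>m\<in>?I. \<Sum>n\<in>?I. T m n)) {A..B}"
      by (intro has_integral_mult_right I)
    fix x assume x: "x \<in> {A..B}"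
    have "1 \<le> sqrt B * inverse (sqrt x)" using x A by (simp add: field_simps)
    then have "(cmod (P x))\<^sup>2 * 1 \<le> (cmod (P x))\<^sup>2 * (sqrt B * inverse (sqrt x))"
      by (intro mult_left_mono) auto
    then show "(cmod (P x))\<^sup>2 \<le> 2 * sqrt B * ((cmod (P x))\<^sup>2 * (inverse (sqrt x) / 2))"
      by (simp add: mult_ac)
  qed
  also have "Re (\<Sum>m\<in>?I. \<Sum>n\<in>?I. T m n) \<le> (\<Sum>m\<in>?I. \<Sum>n\<in>?I. cmod (T m n))"
    by (rule order_trans[OF complex_Re_le_cmod]) (intro norm_sum[THEN order_trans] sum_mono norm_sum)
  also have "\<dots> = (\<Sum>m\<in>?I. cmod (T m m)) + (\<Sum>m\<in>?I. \<Sum>n\<in>?I-{m}. cmod (T m n))"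
    by (subst sum.distrib[symmetric], intro sum.cong refl sum.remove) auto
  also have "(\<Sum>m\<in>?I. cmod (T m m)) = (sqrt B - sqrt A) * (\<Sum>m\<in>?I. (cmod (c m))\<^sup>2)"
  proof -
    have "cmod (complex_of_real (sqrt B - sqrt A)) = sqrt B - sqrt A"
      unfolding norm_of_real using A by simp
    then have "cmod (T m m) = (sqrt B - sqrt A) * (cmod (c m))\<^sup>2" for m
      by (simp only: T_def if_True norm_mult complex_mod_cnj power2_eq_square refl mult_ac)
    then show ?thesis by (simp add: sum_distrib_left)
  qed
  also have "(\<Sum>m\<in>?I. \<Sum>n\<in>?I-{m}. cmod (T m n)) \<le> (\<Sum>m\<in>?I. \<Sum>n\<in>?I-{m}. cmod (c m) * cmod (c n) / \<bar>sqrt m - sqrt n\<bar>)"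
  proof (intro sum_mono)
    fix m n assume mn: "m \<in> ?I" "n \<in> ?I - {m}"
    define D where "D = \<bar>sqrt (real m) - sqrt (real n)\<bar>"
    have D: "D > 0" using mn by (auto simp: D_def)
    have Lmn: "\<bar>L m - L n\<bar> = 4 * pi * D"
    proof -
      have "L m - L n = \<sigma> * (4 * pi * (sqrt m - sqrt n))" by (simp add: L_def algebra_simps)
      then show ?thesis using \<sigma> by (simp add: abs_mult D_def)
    qed
    have "cmod (cis ((L m - L n) * sqrt B) - cis ((L m - L n) * sqrt A)) \<le> 2"
      using norm_triangle_ineq4[of "cis ((L m - L n) * sqrt B)" "cis ((L m - L n) * sqrt A)"] by simp
    moreover have "2 \<le> 4 * pi" using pi_ge_two by simp
    ultimately have "cmod (cis ((L m - L n) * sqrt B) - cis ((L m - L n) * sqrt A)) / (4 * pi * D) \<le> 4 * pi / (4 * pi * D)"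
      using D by (intro divide_right_mono) auto
    then have "cmod (cis ((L m - L n) * sqrt B) - cis ((L m - L n) * sqrt A)) / (4 * pi * D) \<le> 1 / D" by simp
    then have "cmod (c m) * cmod (c n) * (cmod (cis ((L m - L n) * sqrt B) - cis ((L m - L n) * sqrt A)) / (4 * pi * D)) \<le>
       cmod (c m) * cmod (c n) * (1 / D)" by (intro mult_left_mono) auto
    moreover have "cmod (T m n) = cmod (c m) * cmod (c n) * (cmod (cis ((L m - L n) * sqrt B) - cis ((L m - L n) * sqrt A)) / (4 * pi * D))"
    proof -
      have "cmod (\<i> * of_real (L m - L n)) = 4 * pi * D" using Lmn by (simp add: norm_mult del: of_real_diff)
      moreover have "m \<noteq> n" using mn by auto
      ultimately show ?thesis by (simp only: T_def if_False norm_mult complex_mod_cnj norm_divide)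
    qed
    ultimately show "cmod (T m n) \<le> cmod (c m) * cmod (c n) / \<bar>sqrt m - sqrt n\<bar>" by (simp add: D_def)
  qed
  also have "\<dots> \<le> 6 * harm N * (\<Sum>m\<in>?I. (cmod (c m))\<^sup>2 * sqrt m)"
    by (rule sqrt_gap_bilinear_bound) simp
  finally have "integral {A..B} (\<lambda>x. (cmod (P x))\<^sup>2) \<le> 2 * sqrt B * ((sqrt B - sqrt A) * (\<Sum>m\<in>?I. (cmod (c m))\<^sup>2) + 6 * harm N * (\<Sum>m\<in>?I. (cmod (c m))\<^sup>2 * sqrt m))"
    using A by (simp add: mult_left_mono)
  moreover have "P = (\<lambda>x. \<Sum>m=1..N. c m * cis (\<sigma> * (4 * pi * sqrt m * sqrt x)))"
    by (simp add: P_def L_def mult_ac)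
  ultimately show ?thesis by simp
qed

section \<open>The mean square of the coefficient sums\<close>

text \<open>Cauchy-Schwarz on an interval of length one, by integrating \<bar>g - I\<bar>^2 \<ge> 0
  after expansion.\<close>

lemma norm_integral_squared_le:
  fixes g :: "real \<Rightarrow> complex"
  assumes I: "(g has_integral I) {p..p + 1}" and J: "((\<lambda>x. (cmod (g x))\<^sup>2) has_integral J) {p..p + 1}"
  shows "(cmod I)\<^sup>2 \<le> J"
proof -
  have "((\<lambda>x. 2 * Re (g x * cnj I) - (cmod I)\<^sup>2) has_integral 2 * Re (I * cnj I) - (cmod I)\<^sup>2) {p..p + 1}"
  proof (intro has_integral_diff has_integral_mult_right)
    show "((\<lambda>x. Re (g x * cnj I)) has_integral Re (I * cnj I)) {p..p + 1}"
      using has_integral_linear[OF has_integral_mult_left[OF I] bounded_linear_Re] by (simp only: o_def)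
    show "((\<lambda>x. (cmod I)\<^sup>2) has_integral (cmod I)\<^sup>2) {p..p + 1}"
      using has_integral_const_real[of "(cmod I)\<^sup>2" p "p + 1"] by simp
  qed
  then have "2 * Re (I * cnj I) - (cmod I)\<^sup>2 \<le> J"
  proof (rule has_integral_le[OF _ J])
    fix x
    have "0 \<le> (Re (g x) - Re I)\<^sup>2 + (Im (g x) - Im I)\<^sup>2" by simp
    then show "2 * Re (g x * cnj I) - (cmod I)\<^sup>2 \<le> (cmod (g x))\<^sup>2"
      by (simp add: cmod_power2 power2_diff)
  qed
  moreover have "Re (I * cnj I) = (cmod I)\<^sup>2" by (simp add: complex_mult_cnj cmod_power2)
  ultimately show ?thesis by simp
qed

text \<open>Since h is nonnegative, the gaps of F can be filled. With h = 1 the same statement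
  bounds the number of elements of F.\<close>

lemma sum_unit_integrals_le:
  fixes h :: "real \<Rightarrow> real" and F :: "nat set"
  assumes F: "finite F" "\<And>n. n \<in> F \<Longrightarrow> A \<le> real n \<and> real n + 1 \<le> B"
    and h: "continuous_on {A..B} h" "\<And>x. x \<in> {A..B} \<Longrightarrow> 0 \<le> h x"
  shows "(\<Sum>n\<in>F. integral {real n..real n + 1} h) \<le> integral {A..B} h"
proof (cases "F = {}")
  case True
  then show ?thesis using h by (auto intro!: integral_nonneg integrable_continuous_interval)
next
  case False
  define p where "p = Min F"
  define q where "q = Max F"
  have pq: "p \<in> F" "q \<in> F" "F \<subseteq> {p..q}" "p \<le> q" using F(1) False by (auto simp: p_def q_def)
  have Ap: "A \<le> real p" and qB: "real q + 1 \<le> B" using F(2) pq by auto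
  have int: "h integrable_on {s..t}" if "A \<le> s" "t \<le> B" for s t
    using that by (intro integrable_continuous_interval continuous_on_subset[OF h(1)]) auto
  have "(\<Sum>n\<in>F. integral {real n..real n + 1} h) \<le> (\<Sum>n=p..q. integral {real n..real n + 1} h)"
  proof (rule sum_mono2)
    fix n assume "n \<in> {p..q} - F"
    then have "real p \<le> real n" "real n \<le> real q" by auto
    then have "A \<le> real n" "real n + 1 \<le> B" using Ap qB by linarith+
    then show "0 \<le> integral {real n..real n + 1} h"
      using h(2) by (intro integral_nonneg int) auto
  qed (use pq in auto)
  also have "(\<Sum>n=p..r. integral {real n..real n + 1} h) = integral {real p..real r + 1} h"
    if "p \<le> r" "r \<le> q" for r
    using that
  proof (induction r rule: dec_induct)
    case (step r)
    have "Suc r \<le> q" "p \<le> r" using step by auto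
    then have r: "real (Suc r) \<le> real q" "real p \<le> real r" by (simp_all only: of_nat_le_iff)
    have "h integrable_on {real p..real (Suc r) + 1}" using r qB Ap by (intro int) linarith+
    then have "integral {real p..real r + 1} h + integral {real r + 1..real (Suc r) + 1} h = integral {real p..real (Suc r) + 1} h"
      using r by (intro Henstock_Kurzweil_Integration.integral_combine) auto
    with step show ?case by (simp add: add.commute)
  qed simp
  from this[OF pq(4)] have "(\<Sum>n=p..q. integral {real n..real n + 1} h) = integral {real p..real q + 1} h" by simp
  also have "integral {real p..real q + 1} h \<le> integral {A..B} h"
    using Ap qB h(2) by (intro integral_subset_le int) auto
  finally show ?thesis .
qed

section \<open>From the Riesz mean to the coefficient sums\<close>

lemma ramp_series_at_nat:
  "(\<Sum>j. a (Suc j) * of_real (max 0 (real n - real (Suc j)))) = (\<Sum>j<n. a (Suc j) * of_real (real n - real (Suc j)) :: complex)"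
proof -
  have "(\<Sum>j. a (Suc j) * of_real (max 0 (real n - real (Suc j)))) = (\<Sum>j<n. a (Suc j) * of_real (max 0 (real n - real (Suc j))) :: complex)"
    by (rule suminf_finite) auto
  also have "\<dots> = (\<Sum>j<n. a (Suc j) * of_real (real n - real (Suc j)))"
    by (intro sum.cong refl) (simp add: max_def)
  finally show ?thesis .
qed

text \<open>From n to n + 1 the ramp of every m \<le> n rises by exactly 1, while that of m = n + 1
  is still 0 at n + 1.\<close>

lemma coeff_sum_eq_ramp_diff:
  "coeff_sum a n = (\<Sum>j. a (Suc j) * of_real (max 0 (real (Suc n) - real (Suc j)))) -
     (\<Sum>j. a (Suc j) * of_real (max 0 (real n - real (Suc j))))"
proof -
  have "(\<Sum>j<Suc n. a (Suc j) * of_real (real (Suc n) - real (Suc j))) - (\<Sum>j<n. a (Suc j) * of_real (real n - real (Suc j)))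
     = (\<Sum>j<n. a (Suc j) * of_real (real (Suc n) - real (Suc j)) - a (Suc j) * of_real (real n - real (Suc j)))"
    by (simp add: sum_subtractf)
  also have "\<dots> = (\<Sum>j<n. a (Suc j))"
    by (intro sum.cong refl) (simp add: algebra_simps)
  also have "\<dots> = coeff_sum a n"
    unfolding coeff_sum_def by (rule sum.reindex_bij_witness[of _ "\<lambda>m. m - 1" Suc]) auto
  finally show ?thesis unfolding ramp_series_at_nat ..
qed

text \<open>The derivative in x of the first N terms of the order k + 1 series, without the constant
  (2 pi / i)^k.\<close>

definition voronoi_head :: "nat \<Rightarrow> (nat \<Rightarrow> complex) \<Rightarrow> nat \<Rightarrow> real \<Rightarrow> complex" where
  "voronoi_head k a N x = (\<Sum>m=1..N. a m * of_real (voronoi_kernel k (4 * pi\<^sup>2 * real m) x))"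

lemma continuous_on_voronoi_head: "continuous_on S (voronoi_head k a N)"
  unfolding voronoi_head_def[abs_def] by (intro continuous_intros continuous_on_voronoi_kernel)

text \<open>The surplus 1/4 in the exponent of m is shared: one eighth secures absolute convergence,
  the other becomes the decay in N.\<close>

lemma voronoi_tail_bound:
  assumes C: "\<forall>M\<ge>1. (\<Sum>m=1..M. (cmod (a m))\<^sup>2) \<le> C * real M ^ k" "C \<ge> 0" and k: "k \<ge> 1"
  shows "\<exists>K\<ge>0. \<forall>N\<ge>1. \<forall>x>0. summable (\<lambda>j. a (Suc j) * of_real (voronoi_kernel (Suc k) (4 * pi\<^sup>2 * real (Suc j)) x)) \<and>
     cmod (\<Sum>j. a (Suc (j + N)) * of_real (voronoi_kernel (Suc k) (4 * pi\<^sup>2 * real (Suc (j + N))) x))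
       \<le> K * x powr (real k / 2 + 1/4) * real N powr (- 1/8)"
proof -
  obtain B where B: "\<And>b x. b > 0 \<Longrightarrow> x > 0 \<Longrightarrow>
      \<bar>voronoi_kernel (Suc k) b x\<bar> \<le> B * x powr (real (Suc k) / 2 - 1/4) * b powr (- real (Suc k) / 2 - 1/4)"
    using voronoi_kernel_bound[of "Suc k"] by blast
  have B0: "B \<ge> 0" using order_trans[OF abs_ge_zero B[of 1 1]] by simp
  define D where "D = B * (4 * pi\<^sup>2) powr (- real k / 2 - 1/2 - 1/4)"
  have D0: "D \<ge> 0" using B0 by (simp add: D_def)
  define u where "u = (\<lambda>j. cmod (a (Suc j)) * real (Suc j) powr (- real k / 2 - 1/2 - 1/8))"
  have u: "summable u" unfolding u_def by (rule summable_cusp_coeff_powr[OF C k]) auto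
  have u0: "u j \<ge> 0" for j by (simp add: u_def)
  define h where "h = (\<lambda>x j. a (Suc j) * complex_of_real (voronoi_kernel (Suc k) (4 * pi\<^sup>2 * real (Suc j)) x))"
  have hb: "cmod (h x j) \<le> D * x powr (real k / 2 + 1/4) * real (Suc j) powr (- 1/8) * u j" if x: "x > 0" for x j
  proof -
    have "cmod (h x j) = cmod (a (Suc j)) * \<bar>voronoi_kernel (Suc k) (4 * pi\<^sup>2 * real (Suc j)) x\<bar>"
      by (simp add: h_def norm_mult)
    also have "\<dots> \<le> cmod (a (Suc j)) * (B * x powr (real (Suc k) / 2 - 1/4) * (4 * pi\<^sup>2 * real (Suc j)) powr (- real (Suc k) / 2 - 1/4))"
      using x by (intro mult_left_mono B) auto
    also have "real (Suc k) / 2 - 1/4 = real k / 2 + 1/4" by (simp add: field_simps)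
    also have "- real (Suc k) / 2 - 1/4 = - real k / 2 - 1/2 - 1/4" by (simp add: field_simps)
    also have "(4 * pi\<^sup>2 * real (Suc j)) powr (- real k / 2 - 1/2 - 1/4) =
        (4 * pi\<^sup>2) powr (- real k / 2 - 1/2 - 1/4) * (real (Suc j) powr (- 1/8) * real (Suc j) powr (- real k / 2 - 1/2 - 1/8))"
    proof -
      have "- real k / 2 - 1/2 - 1/4 = - 1/8 + (- real k / 2 - 1/2 - 1/8)" by simp
      then have "real (Suc j) powr (- real k / 2 - 1/2 - 1/4) = real (Suc j) powr (- 1/8) * real (Suc j) powr (- real k / 2 - 1/2 - 1/8)"
        by (simp only: powr_add)
      then show ?thesis by (simp only: powr_mult)
    qed
    finally show ?thesis unfolding D_def u_def by (simp only: mult_ac)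
  qed
  have mono: "real (Suc (j + N)) powr (- 1/8) \<le> real N powr (- 1/8)" if "N \<ge> 1" for j N
    using that by (intro powr_mono2') auto
  have "summable (h x) \<and> cmod (\<Sum>j. h x (j + N)) \<le> (D * suminf u) * x powr (real k / 2 + 1/4) * real N powr (- 1/8)"
    if x: "x > 0" and N: "N \<ge> 1" for x N
  proof
    define E where "E = D * x powr (real k / 2 + 1/4)"
    have E0: "E \<ge> 0" using D0 by (simp add: E_def)
    have le: "cmod (h x (j + N)) \<le> E * real N powr (- 1/8) * u (j + N)" for j
    proof -
      have "cmod (h x (j + N)) \<le> E * real (Suc (j + N)) powr (- 1/8) * u (j + N)"
        using hb[OF x, of "j + N"] by (simp add: E_def)
      also have "\<dots> \<le> E * real N powr (- 1/8) * u (j + N)"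
        using mono[OF N, of j] E0 u0 by (intro mult_right_mono mult_left_mono) auto
      finally show ?thesis .
    qed
    have su: "summable (\<lambda>j. u (j + N))" using u by (simp add: summable_iff_shift)
    have s: "summable (\<lambda>j. E * real N powr (- 1/8) * u (j + N))"
      using su by (rule summable_mult)
    have "summable (\<lambda>j. h x (j + N))"
      by (rule summable_norm_cancel, rule summable_comparison_test'[OF s]) (use le in simp)
    then show "summable (h x)" by (simp add: summable_iff_shift)
    have "cmod (\<Sum>j. h x (j + N)) \<le> (\<Sum>j. E * real N powr (- 1/8) * u (j + N))"
      by (rule norm_suminf_le[OF le s])
    also have "\<dots> = E * real N powr (- 1/8) * (\<Sum>j. u (j + N))" by (rule suminf_mult[OF su])
    also have "\<dots> \<le> E * real N powr (- 1/8) * suminf u"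
      using suminf_split_initial_segment[OF u, of N] sum_nonneg[of "{..<N}" u] u0 E0
      by (intro mult_left_mono) auto
    finally show "cmod (\<Sum>j. h x (j + N)) \<le> (D * suminf u) * x powr (real k / 2 + 1/4) * real N powr (- 1/8)"
      by (simp only: E_def mult_ac)
  qed
  moreover have "D * suminf u \<ge> 0" using D0 u0 suminf_nonneg[OF u] by simp
  ultimately show ?thesis unfolding h_def by (intro exI[of _ "D * suminf u"]) auto
qed

text \<open>The head of the series is differenced exactly, as the integral of its derivative over
  [n, n + 1]. The tails at n and n + 1 are merely estimated separately, which a large N makes
  affordable.\<close>

lemma coeff_sum_square_le_voronoi_head:
  assumes f: "cusp_form_SL2Z k f" and fa: "cusp_fourier_expansion f a" and k: "k \<ge> 1"
  shows "\<exists>K\<ge>0. \<forall>n\<ge>1. \<forall>N\<ge>1. (cmod (coeff_sum a n))\<^sup>2 \<le>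
     K * integral {real n..real n + 1} (\<lambda>x. (cmod (voronoi_head k a N x))\<^sup>2)
     + K * (real n + 1) powr (real k + 1/2) * real N powr (- 1/4)"
proof -
  obtain C where C: "C \<ge> 0" "\<forall>M\<ge>1. (\<Sum>m=1..M. (cmod (a m))\<^sup>2) \<le> C * real M ^ k"
    using cusp_coeff_second_moment[OF f fa] by blast
  define h where "h = (\<lambda>x j. a (Suc j) * complex_of_real (voronoi_kernel (Suc k) (4 * pi\<^sup>2 * real (Suc j)) x))"
  have "\<exists>K\<ge>0. \<forall>N\<ge>1. \<forall>x>0. summable (h x) \<and>
      cmod (\<Sum>j. h x (j + N)) \<le> K * x powr (real k / 2 + 1/4) * real N powr (- 1/8)"
    unfolding h_def by (rule voronoi_tail_bound[OF C(2) C(1) k])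
  then obtain T where T0: "T \<ge> 0" "\<forall>N\<ge>1. \<forall>x>0. summable (h x) \<and>
      cmod (\<Sum>j. h x (j + N)) \<le> T * x powr (real k / 2 + 1/4) * real N powr (- 1/8)"
    by (elim exE conjE)
  have T: "T \<ge> 0" "\<And>x. x > 0 \<Longrightarrow> summable (h x)"
    "\<And>N x. N \<ge> 1 \<Longrightarrow> x > 0 \<Longrightarrow> cmod (\<Sum>j. h x (j + N)) \<le> T * x powr (real k / 2 + 1/4) * real N powr (- 1/8)"
    using T0 by (blast, metis order_refl, metis)
  define c where "c = (2 * complex_of_real pi / \<i>) ^ k"
  define K where "K = 2 * (cmod c)\<^sup>2 * (1 + 4 * T\<^sup>2)"
  have "(cmod (coeff_sum a n))\<^sup>2 \<le> K * integral {real n..real n + 1} (\<lambda>x. (cmod (voronoi_head k a N x))\<^sup>2)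
     + K * (real n + 1) powr (real k + 1/2) * real N powr (- 1/4)" if n: "n \<ge> 1" and N: "N \<ge> 1" for n N
  proof -
    define I where "I = (\<Sum>m=1..N. a m * of_real (voronoi_kernel (Suc k) (4 * pi\<^sup>2 * real m) (real n + 1) - voronoi_kernel (Suc k) (4 * pi\<^sup>2 * real m) (real n)))"
    define J where "J = integral {real n..real n + 1} (\<lambda>x. (cmod (voronoi_head k a N x))\<^sup>2)"
    define R where "R = (\<Sum>j. h (real n + 1) (j + N)) - (\<Sum>j. h (real n) (j + N))"
    have split: "suminf (h x) = (\<Sum>j. h x (j + N)) + (\<Sum>m=1..N. a m * of_real (voronoi_kernel (Suc k) (4 * pi\<^sup>2 * real m) x))" if "x > 0" for x
    proof -
      have "(\<Sum>j<N. h x j) = (\<Sum>m=1..N. a m * of_real (voronoi_kernel (Suc k) (4 * pi\<^sup>2 * real m) x))"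
        unfolding h_def by (rule sum.reindex_bij_witness[of _ "\<lambda>m. m - 1" Suc]) auto
      then show ?thesis using suminf_split_initial_segment[OF T(2)[OF that], of N] by simp
    qed
    have "coeff_sum a n = c * suminf (h (real n + 1)) - c * suminf (h (real n))"
      using voronoi_formula[OF f fa k, of "real n + 1"] voronoi_formula[OF f fa k, of "real n"] n
      unfolding coeff_sum_eq_ramp_diff[of a n] c_def h_def by (simp add: add.commute)
    also have "\<dots> = c * (I + R)"
      using n split[of "real n + 1"] split[of "real n"]
      by (simp add: I_def R_def algebra_simps sum_subtractf)
    finally have "(cmod (coeff_sum a n))\<^sup>2 = (cmod c)\<^sup>2 * (cmod (I + R))\<^sup>2"
      by (simp add: norm_mult power_mult_distrib)
    also have "(cmod (I + R))\<^sup>2 \<le> (cmod I + cmod R)\<^sup>2" by (intro power_mono norm_triangle_ineq) auto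
    also have "\<dots> \<le> 2 * (cmod I)\<^sup>2 + 2 * (cmod R)\<^sup>2"
      using sum_squares_bound[of "cmod I" "cmod R"] by (simp add: power2_sum)
    also have "(cmod I)\<^sup>2 \<le> J"
    proof (rule norm_integral_squared_le)
      show "(voronoi_head k a N has_integral I) {real n..real n + 1}"
        unfolding voronoi_head_def[abs_def] I_def
      proof (intro has_integral_sum has_integral_mult_right has_integral_of_real finite_atLeastAtMost)
        fix m
        show "(voronoi_kernel k (4 * pi\<^sup>2 * real m) has_integral voronoi_kernel (Suc k) (4 * pi\<^sup>2 * real m) (real n + 1) -
            voronoi_kernel (Suc k) (4 * pi\<^sup>2 * real m) (real n)) {real n..real n + 1}"
          by (rule fundamental_theorem_of_calculus)
             (auto intro!: has_field_derivative_at_within[OF has_real_derivative_voronoi_kernel]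
               simp: has_real_derivative_iff_has_vector_derivative[symmetric])
      qed
      show "((\<lambda>x. (cmod (voronoi_head k a N x))\<^sup>2) has_integral J) {real n..real n + 1}"
        unfolding J_def
        by (intro integrable_integral integrable_continuous_interval continuous_intros continuous_on_voronoi_head)
    qed
    also have "(cmod R)\<^sup>2 \<le> 4 * T\<^sup>2 * (real n + 1) powr (real k + 1/2) * real N powr (- 1/4)"
    proof -
      define E where "E = T * (real n + 1) powr (real k / 2 + 1/4) * real N powr (- 1/8)"
      have "real n powr (real k / 2 + 1/4) \<le> (real n + 1) powr (real k / 2 + 1/4)" by (intro powr_mono2) auto
      then have "T * real n powr (real k / 2 + 1/4) * real N powr (- 1/8) \<le> E"
        unfolding E_def using T(1) by (intro mult_right_mono mult_left_mono) auto
      then have "cmod (\<Sum>j. h (real n) (j + N)) \<le> E"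
        using T(3)[OF N, of "real n"] n by linarith
      moreover have "cmod (\<Sum>j. h (real n + 1) (j + N)) \<le> E"
        unfolding E_def using n by (intro T(3)[OF N]) auto
      ultimately have "cmod R \<le> 2 * E"
        unfolding R_def using norm_triangle_ineq4[of "\<Sum>j. h (real n + 1) (j + N)" "\<Sum>j. h (real n) (j + N)"] by linarith
      then have "(cmod R)\<^sup>2 \<le> (2 * E)\<^sup>2" by (intro power_mono) auto
      also have "\<dots> = 4 * T\<^sup>2 * (((real n + 1) powr (real k / 2 + 1/4))\<^sup>2) * (real N powr (- 1/8))\<^sup>2"
        unfolding E_def by (simp add: power_mult_distrib)
      also have "((real n + 1) powr (real k / 2 + 1/4))\<^sup>2 = (real n + 1) powr (real k + 1/2)"
        by (simp add: power2_eq_square powr_add[symmetric])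
      also have "(real N powr (- 1/8))\<^sup>2 = real N powr (- 1/4)"
        by (simp add: power2_eq_square powr_add[symmetric])
      finally show ?thesis .
    qed
    finally have "(cmod (coeff_sum a n))\<^sup>2 \<le> (cmod c)\<^sup>2 * (2 * J + 2 * (4 * T\<^sup>2 * (real n + 1) powr (real k + 1/2) * real N powr (- 1/4)))"
      by (simp add: mult_left_mono)
    also have "\<dots> = 2 * (cmod c)\<^sup>2 * J + 2 * (cmod c)\<^sup>2 * (4 * T\<^sup>2) * ((real n + 1) powr (real k + 1/2) * real N powr (- 1/4))"
      by (simp add: algebra_simps)
    also have "\<dots> \<le> K * J + K * ((real n + 1) powr (real k + 1/2) * real N powr (- 1/4))"
    proof (intro add_mono mult_right_mono)
      show "2 * (cmod c)\<^sup>2 \<le> K" "2 * (cmod c)\<^sup>2 * (4 * T\<^sup>2) \<le> K" by (auto simp: K_def algebra_simps)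
      show "J \<ge> 0" unfolding J_def
        by (intro integral_nonneg integrable_continuous_interval continuous_intros continuous_on_voronoi_head) auto
    qed auto
    finally show ?thesis by (simp add: J_def mult.assoc)
  qed
  moreover have "K \<ge> 0" by (simp add: K_def)
  ultimately show ?thesis by blast
qed

text \<open>With \<sigma> = 1 and \<sigma> = - 1 these are the two exponential halves of the
  oscillating main term. The \<open>a m\<close> are complex, so the halves need not be conjugate to
  each other.\<close>

definition voronoi_wave :: "nat \<Rightarrow> (nat \<Rightarrow> complex) \<Rightarrow> real \<Rightarrow> nat \<Rightarrow> real \<Rightarrow> complex" where
  "voronoi_wave k a \<sigma> N x =
     (\<Sum>m=1..N. (a m * of_real (real m powr (- real k / 2 - 1/4))) * cis (\<sigma> * (4 * pi * sqrt m * sqrt x)))"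

lemma sum_nat_shift_le_suminf:
  fixes u :: "nat \<Rightarrow> real"
  assumes "summable (\<lambda>n. u (Suc n))" "\<And>m. u m \<ge> 0"
  shows "(\<Sum>m=1..N. u m) \<le> (\<Sum>n. u (Suc n))"
proof -
  have "(\<Sum>m=1..N. u m) = (\<Sum>n<N. u (Suc n))"
    by (rule sum.reindex_bij_witness[of _ Suc "\<lambda>m. m - 1"]) auto
  then show ?thesis using sum_le_suminf[OF assms(1), of "{..<N}"] assms(2) by simp
qed

lemma norm_sum3_squared_le:
  fixes x y z :: complex
  shows "(cmod (x + y + z))\<^sup>2 \<le> 3 * ((cmod x)\<^sup>2 + (cmod y)\<^sup>2 + (cmod z)\<^sup>2)"
proof -
  have "cmod (x + y + z) \<le> cmod x + cmod y + cmod z"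
    using norm_triangle_ineq[of "x + y" z] norm_triangle_ineq[of x y] by linarith
  then have "(cmod (x + y + z))\<^sup>2 \<le> (cmod x + cmod y + cmod z)\<^sup>2" by (intro power_mono) auto
  also have "\<dots> \<le> 3 * ((cmod x)\<^sup>2 + (cmod y)\<^sup>2 + (cmod z)\<^sup>2)"
    using sum_squares_bound[of "cmod x" "cmod y"] sum_squares_bound[of "cmod x" "cmod z"] sum_squares_bound[of "cmod y" "cmod z"]
    by (simp add: power2_eq_square algebra_simps)
  finally show ?thesis .
qed

text \<open>The error D / t of the Bessel asymptotics, at t = 4 pi sqrt (m x), gains a factor m^(-
  1/2) and makes the remaining series absolutely convergent, uniformly in N and x \<ge> 1. It
  accounts for the summand 1.\<close>

lemma voronoi_head_square_le_waves:
  assumes C: "\<forall>M\<ge>1. (\<Sum>m=1..M. (cmod (a m))\<^sup>2) \<le> C * real M ^ k" "C \<ge> 0" and k: "k \<ge> 1"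
  shows "\<exists>K\<ge>0. \<forall>N. \<forall>x\<ge>1. (cmod (voronoi_head k a N x))\<^sup>2 \<le>
     K * x powr (real k - 1/2) * ((cmod (voronoi_wave k a 1 N x))\<^sup>2 + (cmod (voronoi_wave k a (- 1) N x))\<^sup>2 + 1)"
proof -
  obtain \<alpha> \<beta> D where D: "\<And>t. t \<ge> 1 \<Longrightarrow> \<bar>bessel_osc k t - (\<alpha> * cos t + \<beta> * sin t)\<bar> \<le> D / t"
    using bessel_osc_asymptotics[of k] by blast
  have D0: "D \<ge> 0" using D[of 1] by simp
  define r where "r = (\<lambda>t. bessel_osc k t - (\<alpha> * cos t + \<beta> * sin t))"
  \<comment> \<open>\<alpha> cos t + \<beta> sin t equals \<gamma> exp (i t) + \<gamma>' exp (- i t)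
    with \<gamma> = (\<alpha> - i \<beta>) / 2 and \<gamma>' = (\<alpha> + i \<beta>) / 2.\<close>
  define \<gamma> where "\<gamma> = Complex (\<alpha> / 2) (- \<beta> / 2)"
  define \<gamma>' where "\<gamma>' = Complex (\<alpha> / 2) (\<beta> / 2)"
  have osc: "complex_of_real (bessel_osc k t) = \<gamma> * cis (1 * t) + \<gamma>' * cis (- 1 * t) + of_real (r t)" for t
    by (simp add: complex_eq_iff \<gamma>_def \<gamma>'_def r_def)
  define u where "u = (\<lambda>m. cmod (a m) * real m powr (- real k / 2 - 1/2 - 1/4))"
  have u: "summable (\<lambda>n. u (Suc n))" unfolding u_def by (rule summable_cusp_coeff_powr[OF C k]) auto
  define U where "U = (\<Sum>n. u (Suc n))"
  have u0: "u m \<ge> 0" for m by (simp add: u_def)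
  define \<kappa> where "\<kappa> = 2 powr (- real k - 1/2) * (4 * pi\<^sup>2) powr (- real k / 2 - 1/4)"
  define G where "G = (cmod \<gamma>)\<^sup>2 + (cmod \<gamma>')\<^sup>2 + (D * U)\<^sup>2"
  have "(cmod (voronoi_head k a N x))\<^sup>2 \<le> (\<kappa>\<^sup>2 * (3 * G)) * x powr (real k - 1/2) *
      ((cmod (voronoi_wave k a 1 N x))\<^sup>2 + (cmod (voronoi_wave k a (- 1) N x))\<^sup>2 + 1)" if x: "x \<ge> 1" for N x
  proof -
    define t where "t = (\<lambda>m::nat. 4 * pi * sqrt m * sqrt x)"
    define c where "c = (\<lambda>m. a m * of_real (real m powr (- real k / 2 - 1/4)))"
    define R where "R = (\<Sum>m=1..N. c m * of_real (r (t m)))"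
    have ker: "voronoi_kernel k (4 * pi\<^sup>2 * real m) x =
       \<kappa> * x powr (real k / 2 - 1/4) * (real m powr (- real k / 2 - 1/4) * bessel_osc k (t m))" if "m \<in> {1..N}" for m
    proof -
      have "2 * sqrt (4 * pi\<^sup>2 * real m * x) = t m"
        by (simp add: t_def real_sqrt_mult)
      moreover have "(4 * pi\<^sup>2 * real m) powr (- real k / 2 - 1/4) = (4 * pi\<^sup>2) powr (- real k / 2 - 1/4) * real m powr (- real k / 2 - 1/4)"
        by (rule powr_mult)
      moreover have "4 * pi\<^sup>2 * real m > 0" "x > 0" using that x by auto
      ultimately show ?thesis
        by (simp only: voronoi_kernel_eq_bessel_osc \<kappa>_def mult_ac)
    qed
    have wave: "voronoi_wave k a \<sigma> N x = (\<Sum>m=1..N. c m * cis (\<sigma> * t m))" for \<sigma>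
      by (simp only: voronoi_wave_def c_def t_def)
    have "voronoi_head k a N x = (\<Sum>m=1..N. of_real (\<kappa> * x powr (real k / 2 - 1/4)) * (c m * complex_of_real (bessel_osc k (t m))))"
      unfolding voronoi_head_def
    proof (rule sum.cong[OF refl])
      fix m assume "m \<in> {1..N}"
      then show "a m * of_real (voronoi_kernel k (4 * pi\<^sup>2 * real m) x) =
         of_real (\<kappa> * x powr (real k / 2 - 1/4)) * (c m * complex_of_real (bessel_osc k (t m)))"
        by (subst ker) (simp_all only: c_def of_real_mult mult_ac)
    qed
    also have "\<dots> = of_real (\<kappa> * x powr (real k / 2 - 1/4)) *
       (\<gamma> * voronoi_wave k a 1 N x + \<gamma>' * voronoi_wave k a (- 1) N x + R)"
    proof -
      have "(\<Sum>m=1..N. c m * complex_of_real (bessel_osc k (t m))) =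
         \<gamma> * voronoi_wave k a 1 N x + \<gamma>' * voronoi_wave k a (- 1) N x + R"
        unfolding osc wave R_def sum_distrib_left sum.distrib[symmetric]
        by (rule sum.cong) (simp_all only: distrib_left mult_ac)
      then show ?thesis by (simp only: sum_distrib_left[symmetric])
    qed
    finally have "(cmod (voronoi_head k a N x))\<^sup>2 = (\<kappa> * x powr (real k / 2 - 1/4))\<^sup>2 *
       (cmod (\<gamma> * voronoi_wave k a 1 N x + \<gamma>' * voronoi_wave k a (- 1) N x + R))\<^sup>2"
      by (simp only: norm_mult norm_of_real power_mult_distrib power2_abs)
    also have "\<dots> \<le> (\<kappa> * x powr (real k / 2 - 1/4))\<^sup>2 * (3 * ((cmod (\<gamma> * voronoi_wave k a 1 N x))\<^sup>2 + (cmod (\<gamma>' * voronoi_wave k a (- 1) N x))\<^sup>2 + (cmod R)\<^sup>2))"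
      by (intro mult_left_mono norm_sum3_squared_le) auto
    also have "\<dots> \<le> (\<kappa> * x powr (real k / 2 - 1/4))\<^sup>2 * (3 * (G * ((cmod (voronoi_wave k a 1 N x))\<^sup>2 + (cmod (voronoi_wave k a (- 1) N x))\<^sup>2 + 1)))"
    proof (intro mult_left_mono)
      have "cmod R \<le> D * U"
      proof -
        have "cmod R \<le> (\<Sum>m=1..N. cmod (c m * of_real (r (t m))))" unfolding R_def by (rule norm_sum)
        also have "\<dots> \<le> (\<Sum>m=1..N. D * u m)"
        proof (rule sum_mono)
          fix m assume m: "m \<in> {1..N}"
          have sm: "1 \<le> sqrt m" "1 \<le> sqrt x" using m x by auto
          then have "1 * (sqrt m * 1) \<le> (4 * pi) * (sqrt m * sqrt x)" using pi_ge_two by (intro mult_mono) auto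
          then have tm: "sqrt m \<le> t m" by (simp add: t_def mult_ac)
          then have "\<bar>r (t m)\<bar> \<le> D / t m" using sm unfolding r_def by (intro D) linarith
          also have "\<dots> \<le> D / sqrt m"
          proof (intro divide_left_mono D0 tm)
            show "0 < t m * sqrt m" using tm sm by (intro mult_pos_pos) linarith+
          qed
          also have "\<dots> = D * real m powr (- 1/2)"
          proof -
            have "real m powr (- 1/2) = inverse (real m powr (1/2))"
              unfolding powr_minus[symmetric] by simp
            also have "real m powr (1/2) = sqrt m" by (rule powr_half_sqrt) simp
            finally show ?thesis by (simp only: divide_inverse[of D])
          qed
          finally have "cmod (c m) * \<bar>r (t m)\<bar> \<le> cmod (c m) * (D * real m powr (- 1/2))" by (intro mult_left_mono) auto
          also have "\<dots> = D * u m"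
          proof -
            have "real m powr (- real k / 2 - 1/4) * real m powr (- 1/2) = real m powr (- real k / 2 - 1/2 - 1/4)"
              unfolding powr_add[symmetric] by (rule arg_cong[where f = "\<lambda>e. real m powr e"]) simp
            then show ?thesis by (simp add: c_def u_def norm_mult mult_ac)
          qed
          finally show "cmod (c m * of_real (r (t m))) \<le> D * u m" by (simp add: norm_mult)
        qed
        also have "\<dots> = D * (\<Sum>m=1..N. u m)" by (simp add: sum_distrib_left)
        also have "\<dots> \<le> D * U" unfolding U_def by (intro mult_left_mono sum_nat_shift_le_suminf u u0 D0)
        finally show ?thesis .
      qed
      then have "(cmod R)\<^sup>2 \<le> (D * U)\<^sup>2 * 1" by (simp add: power_mono)
      then have R: "(cmod R)\<^sup>2 \<le> G * 1" by (simp add: G_def add_increasing)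
      have 1: "(cmod (\<gamma> * voronoi_wave k a 1 N x))\<^sup>2 \<le> G * (cmod (voronoi_wave k a 1 N x))\<^sup>2"
        unfolding norm_mult power_mult_distrib by (intro mult_right_mono) (simp_all add: G_def)
      have 2: "(cmod (\<gamma>' * voronoi_wave k a (- 1) N x))\<^sup>2 \<le> G * (cmod (voronoi_wave k a (- 1) N x))\<^sup>2"
        unfolding norm_mult power_mult_distrib by (intro mult_right_mono) (simp_all add: G_def)
      show "(cmod (\<gamma> * voronoi_wave k a 1 N x))\<^sup>2 + (cmod (\<gamma>' * voronoi_wave k a (- 1) N x))\<^sup>2 + (cmod R)\<^sup>2
        \<le> G * ((cmod (voronoi_wave k a 1 N x))\<^sup>2 + (cmod (voronoi_wave k a (- 1) N x))\<^sup>2 + 1)"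
        using 1 2 R unfolding distrib_left by linarith
    qed auto
    also have "(\<kappa> * x powr (real k / 2 - 1/4))\<^sup>2 = \<kappa>\<^sup>2 * x powr (real k - 1/2)"
      by (simp add: power_mult_distrib power2_eq_square powr_add[symmetric])
    finally show ?thesis by (simp only: mult_ac)
  qed
  moreover have "\<kappa>\<^sup>2 * (3 * G) \<ge> 0" by (simp add: G_def)
  ultimately show ?thesis by blast
qed

text \<open>The diagonal sum of \<bar>a m\<bar>^2 m^(- k - 1/2) converges. The off-diagonal bound
  needs the weight m^(- k), where the second moment only gives \<open>harm N\<close>; the other
  factor \<open>harm N\<close> comes from the gaps between the square roots.\<close>

lemma voronoi_wave_mean_square:
  assumes C: "\<forall>M\<ge>1. (\<Sum>m=1..M. (cmod (a m))\<^sup>2) \<le> C * real M ^ k" "C \<ge> 0" and k: "k \<ge> 1"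
  shows "\<exists>K\<ge>0. \<forall>N A B \<sigma>. 0 < A \<and> A \<le> B \<and> \<bar>\<sigma>\<bar> = 1 \<longrightarrow>
    integral {A..B} (\<lambda>x. (cmod (voronoi_wave k a \<sigma> N x))\<^sup>2) \<le> K * ((B - A) + sqrt B * (harm N)\<^sup>2)"
proof -
  define c where "c = (\<lambda>m. a m * of_real (real m powr (- real k / 2 - 1/4)))"
  define u where "u = (\<lambda>m. (cmod (a m))\<^sup>2 * real m powr (- real k - 1/2))"
  have u: "summable (\<lambda>n. u (Suc n))" unfolding u_def by (rule summable_cusp_coeff_square_powr[OF C k]) auto
  define U where "U = (\<Sum>n. u (Suc n))"
  have u0: "u m \<ge> 0" for m by (simp add: u_def)
  have U0: "U \<ge> 0" unfolding U_def by (rule suminf_nonneg[OF u u0])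
  have c2: "(cmod (c m))\<^sup>2 = u m" for m
  proof -
    have "(real m powr (- real k / 2 - 1/4))\<^sup>2 = real m powr (- real k - 1/2)"
      by (simp add: power2_eq_square powr_add[symmetric])
    then show ?thesis by (simp add: c_def u_def norm_mult power_mult_distrib)
  qed
  have S1: "(\<Sum>m=1..N. (cmod (c m))\<^sup>2) \<le> U" for N
    unfolding c2 U_def by (rule sum_nat_shift_le_suminf[OF u u0])
  have S2: "(\<Sum>m=1..N. (cmod (c m))\<^sup>2 * sqrt m) \<le> C * real k * harm N" for N
  proof -
    have "(\<Sum>m=1..N. (cmod (c m))\<^sup>2 * sqrt m) = (\<Sum>m=1..N. (cmod (a m))\<^sup>2 * real m powr (- real k))"
    proof (rule sum.cong[OF refl])
      fix m
      have "real m powr (- real k - 1/2) * sqrt m = real m powr (- real k)"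
        unfolding powr_half_sqrt[symmetric, OF of_nat_0_le_iff] powr_add[symmetric] by simp
      then show "(cmod (c m))\<^sup>2 * sqrt m = (cmod (a m))\<^sup>2 * real m powr (- real k)"
        by (simp add: c2 u_def)
    qed
    also have "\<dots> \<le> C * real k * (\<Sum>m=1..N. real m ^ (k - 1) * real m powr (- real k))"
      by (rule weighted_sum_le_of_power_growth[OF C(1)[rule_format] C(2) k]) (auto intro!: powr_mono2')
    also have "(\<Sum>m=1..N. real m ^ (k - 1) * real m powr (- real k)) = harm N"
      unfolding harm_def
    proof (rule sum.cong[OF refl])
      fix m assume m: "m \<in> {1..N}"
      have "real m ^ (k - 1) = real m powr (real k - 1)"
        using k m by (simp add: powr_realpow[symmetric] of_nat_diff)
      then show "real m ^ (k - 1) * real m powr (- real k) = inverse (of_nat m)"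
      proof -
        have "real m powr (real k - 1) * real m powr (- real k) = real m powr (- 1)"
          unfolding powr_add[symmetric] by simp
        with \<open>real m ^ (k - 1) = real m powr (real k - 1)\<close> show ?thesis
          using m by (simp only: powr_minus powr_one_gt_zero_iff) simp
      qed
    qed
    finally show ?thesis .
  qed
  define K where "K = 2 * U + 12 * (C * real k)"
  have "integral {A..B} (\<lambda>x. (cmod (voronoi_wave k a \<sigma> N x))\<^sup>2) \<le> K * ((B - A) + sqrt B * (harm N)\<^sup>2)"
    if AB: "0 < A" "A \<le> B" and \<sigma>: "\<bar>\<sigma>\<bar> = 1" for N A B \<sigma>
  proof -
    have "integral {A..B} (\<lambda>x. (cmod (voronoi_wave k a \<sigma> N x))\<^sup>2) \<le>
       2 * sqrt B * ((sqrt B - sqrt A) * (\<Sum>m=1..N. (cmod (c m))\<^sup>2) + 6 * harm N * (\<Sum>m=1..N. (cmod (c m))\<^sup>2 * sqrt m))"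
    proof -
      have "voronoi_wave k a \<sigma> N = (\<lambda>x. \<Sum>m=1..N. c m * cis (\<sigma> * (4 * pi * sqrt m * sqrt x)))"
        by (rule ext) (simp only: voronoi_wave_def c_def)
      then show ?thesis using exponential_sum_mean_square[OF AB \<sigma>, where c = c and N = N] by (simp only:)
    qed
    also have "\<dots> \<le> 2 * sqrt B * ((sqrt B - sqrt A) * U + 6 * harm N * (C * real k * harm N))"
      using AB harm_nonneg[of N, where 'a = real] by (intro mult_left_mono add_mono S1 S2) auto
    also have "\<dots> = 2 * U * (sqrt B * (sqrt B - sqrt A)) + 12 * (C * real k) * (sqrt B * (harm N)\<^sup>2)"
      by (simp add: algebra_simps power2_eq_square)
    also have "\<dots> \<le> 2 * U * (B - A) + 12 * (C * real k) * (sqrt B * (harm N)\<^sup>2)"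
    proof -
      have "sqrt A * sqrt A \<le> sqrt B * sqrt A" using AB by (intro mult_right_mono) auto
      then have "sqrt B * (sqrt B - sqrt A) \<le> B - A" using AB by (simp add: algebra_simps)
      then show ?thesis using U0 by (simp add: mult_left_mono)
    qed
    also have "\<dots> \<le> K * (B - A) + K * (sqrt B * (harm N)\<^sup>2)"
      unfolding K_def using AB U0 C(2) by (intro add_mono mult_right_mono) auto
    finally show ?thesis by (simp add: distrib_left)
  qed
  moreover have "K \<ge> 0" using U0 C(2) by (simp add: K_def)
  ultimately show ?thesis by blast
qed

text \<open>The bounded remainder contributes the length B - A, so it is absorbed by the diagonal
  terms of the two waves.\<close>

lemma voronoi_head_mean_square:
  assumes C: "\<forall>M\<ge>1. (\<Sum>m=1..M. (cmod (a m))\<^sup>2) \<le> C * real M ^ k" "C \<ge> 0" and k: "k \<ge> 1"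
  shows "\<exists>K\<ge>0. \<forall>N A B. 1 \<le> A \<and> A \<le> B \<longrightarrow>
    integral {A..B} (\<lambda>x. (cmod (voronoi_head k a N x))\<^sup>2) \<le> K * B powr (real k - 1/2) * ((B - A) + sqrt B * (harm N)\<^sup>2)"
proof -
  obtain K1 where K1: "K1 \<ge> 0" "\<forall>N. \<forall>x\<ge>1. (cmod (voronoi_head k a N x))\<^sup>2 \<le>
     K1 * x powr (real k - 1/2) * ((cmod (voronoi_wave k a 1 N x))\<^sup>2 + (cmod (voronoi_wave k a (- 1) N x))\<^sup>2 + 1)"
    using voronoi_head_square_le_waves[OF C k] by (elim exE conjE)
  obtain K2 where K2: "K2 \<ge> 0" "\<forall>N A B \<sigma>. 0 < A \<and> A \<le> B \<and> \<bar>\<sigma>\<bar> = 1 \<longrightarrow>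
    integral {A..B} (\<lambda>x. (cmod (voronoi_wave k a \<sigma> N x))\<^sup>2) \<le> K2 * ((B - A) + sqrt B * (harm N)\<^sup>2)"
    using voronoi_wave_mean_square[OF C k] by (elim exE conjE)
  have "integral {A..B} (\<lambda>x. (cmod (voronoi_head k a N x))\<^sup>2) \<le>
      (K1 * (2 * K2 + 1)) * B powr (real k - 1/2) * ((B - A) + sqrt B * (harm N)\<^sup>2)" if AB: "1 \<le> A" "A \<le> B" for N A B
  proof -
    define W where "W = (\<lambda>\<sigma> x. (cmod (voronoi_wave k a \<sigma> N x))\<^sup>2)"
    define Q where "Q = (B - A) + sqrt B * (harm N)\<^sup>2"
    have cW: "continuous_on {A..B} (W \<sigma>)" for \<sigma>
      unfolding W_def voronoi_wave_def by (intro continuous_intros)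
    have iW: "(W \<sigma> has_integral integral {A..B} (W \<sigma>)) {A..B}" for \<sigma>
      by (intro integrable_integral integrable_continuous_interval cW)
    have bW: "integral {A..B} (W \<sigma>) \<le> K2 * Q" if "\<bar>\<sigma>\<bar> = 1" for \<sigma>
      using K2(2) AB that unfolding W_def Q_def by auto
    have "integral {A..B} (\<lambda>x. (cmod (voronoi_head k a N x))\<^sup>2) \<le>
      (K1 * B powr (real k - 1/2)) * (integral {A..B} (W 1) + integral {A..B} (W (- 1)) + (B - A))"
    proof (rule has_integral_le)
      show "((\<lambda>x. (cmod (voronoi_head k a N x))\<^sup>2) has_integral integral {A..B} (\<lambda>x. (cmod (voronoi_head k a N x))\<^sup>2)) {A..B}"
        by (intro integrable_integral integrable_continuous_interval continuous_intros continuous_on_voronoi_head)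
      have "((\<lambda>x. 1) has_integral (B - A)) {A..B}" using has_integral_const_real[of "1::real" A B] AB by simp
      then show "((\<lambda>x. (K1 * B powr (real k - 1/2)) * (W 1 x + W (- 1) x + 1)) has_integral
         (K1 * B powr (real k - 1/2)) * (integral {A..B} (W 1) + integral {A..B} (W (- 1)) + (B - A))) {A..B}"
        by (intro has_integral_mult_right has_integral_add iW)
      fix x assume x: "x \<in> {A..B}"
      have "(cmod (voronoi_head k a N x))\<^sup>2 \<le> K1 * x powr (real k - 1/2) * (W 1 x + W (- 1) x + 1)"
        using K1(2) AB x unfolding W_def by auto
      also have "\<dots> \<le> (K1 * B powr (real k - 1/2)) * (W 1 x + W (- 1) x + 1)"
        using K1(1) x AB k by (intro mult_right_mono mult_left_mono powr_mono2) (auto simp: W_def)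
      finally show "(cmod (voronoi_head k a N x))\<^sup>2 \<le> (K1 * B powr (real k - 1/2)) * (W 1 x + W (- 1) x + 1)" .
    qed
    also have "\<dots> \<le> (K1 * B powr (real k - 1/2)) * (K2 * Q + K2 * Q + Q)"
      using K1(1) AB by (intro mult_left_mono add_mono bW) (auto simp: Q_def)
    finally show ?thesis unfolding Q_def[symmetric] by (simp add: algebra_simps)
  qed
  moreover have "K1 * (2 * K2 + 1) \<ge> 0" using K1(1) K2(1) by simp
  ultimately show ?thesis by blast
qed

section \<open>Short sums and the choice of parameters\<close>

lemma harm_le_one_plus_ln: "n \<ge> 1 \<Longrightarrow> harm n \<le> 1 + ln (real n)"
  using euler_mascheroni_sequence_decreasing[of 1 n] by (simp add: harm_expand)

lemma finite_short_interval: "finite {n::nat. 1 \<le> n \<and> \<bar>real n - X\<bar> < H}"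
proof (rule finite_subset)
  show "{n::nat. 1 \<le> n \<and> \<bar>real n - X\<bar> < H} \<subseteq> {..nat \<lceil>X + H\<rceil>}" by (auto simp: le_nat_iff) linarith
qed simp

lemma short_sum_mono: "H \<le> H' \<Longrightarrow> short_sum k a X H \<le> short_sum k a X H'"
  unfolding short_sum_def by (intro sum_mono2 finite_short_interval) auto

lemma short_sum_nonneg: "short_sum k a X H \<ge> 0"
  unfolding short_sum_def by (intro sum_nonneg) auto

theorem short_sum_bound:
  assumes f: "cusp_form_SL2Z k f" and fa: "cusp_fourier_expansion f a" and k: "k \<ge> 1"
  shows "\<exists>K\<ge>0. \<forall>\<^sub>F X in at_top. \<forall>H. X powr (2/3) \<le> H \<and> H \<le> X / 2 \<longrightarrow> short_sum k a X H \<le> K * H * X powr (1/2)"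
proof -
  obtain C where C: "C \<ge> 0" "\<forall>M\<ge>1. (\<Sum>m=1..M. (cmod (a m))\<^sup>2) \<le> C * real M ^ k"
    using cusp_coeff_second_moment[OF f fa] by blast
  obtain K1 where K1: "K1 \<ge> 0" "\<forall>n\<ge>1. \<forall>N\<ge>1. (cmod (coeff_sum a n))\<^sup>2 \<le>
     K1 * integral {real n..real n + 1} (\<lambda>x. (cmod (voronoi_head k a N x))\<^sup>2)
     + K1 * (real n + 1) powr (real k + 1/2) * real N powr (- 1/4)"
    using coeff_sum_square_le_voronoi_head[OF f fa k] by (elim exE conjE)
  obtain K2 where K2: "K2 \<ge> 0" "\<forall>N A B. 1 \<le> A \<and> A \<le> B \<longrightarrow>
    integral {A..B} (\<lambda>x. (cmod (voronoi_head k a N x))\<^sup>2) \<le> K2 * B powr (real k - 1/2) * ((B - A) + sqrt B * (harm N)\<^sup>2)"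
    using voronoi_head_mean_square[OF C(2) C(1) k] by (elim exE conjE)
  \<comment> \<open>The 5 bounds (B - A) + sqrt B (harm N)^2 by 3 H + 2 H. The 6 is the product of
    at most 3 H values of n and the tail 2 K1 M for each of them.\<close>
  define K3 where "K3 = K1 * K2 * 5 + 6 * K1"
  define K where "K = K3 * 2 powr (real k - 1/2) * 2 ^ (k - 1)"
  have K3: "K3 \<ge> 0" using K1(1) K2(1) by (simp add: K3_def)
  have "\<forall>\<^sub>F X::real in at_top. (1 + 5 * ln X)\<^sup>2 \<le> X powr (1/6)" by real_asymp
  moreover have "\<forall>\<^sub>F X::real in at_top. X \<ge> 4" by (rule eventually_ge_at_top)
  ultimately have "\<forall>\<^sub>F X in at_top. \<forall>H. X powr (2/3) \<le> H \<and> H \<le> X / 2 \<longrightarrow> short_sum k a X H \<le> K * H * X powr (1/2)"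
  proof eventually_elim
    case (elim X)
    show ?case
    proof (intro allI impI)
      fix H assume H: "X powr (2/3) \<le> H \<and> H \<le> X / 2"
      define A where "A = X - H"
      \<comment> \<open>The extra 1 makes room for the unit interval [n, n + 1] at the right
        end.\<close>
      define B where "B = X + H + 1"
      \<comment> \<open>The squared tail has size X^(k + 1/2) N^(- 1/4); it drops to X^(k - 1/2),
        the order of the main term for a single n, once N reaches X^4. A polynomial N keeps
        \<open>harm N\<close> logarithmic.\<close>
      define N where "N = nat \<lceil>X ^ 4\<rceil>"
      define F where "F = {n::nat. 1 \<le> n \<and> \<bar>real n - X\<bar> < H}"
      define M where "M = (2 * X) powr (real k - 1/2)"
      have X: "X \<ge> 4" using elim by simp
      have H1: "H \<ge> 1" using H X ge_one_powr_ge_zero[of X "2/3"] by linarith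
      have AB: "1 \<le> A" "A \<le> B" "X / 2 \<le> A" "B \<le> 2 * X" "B - A \<le> 3 * H"
        using H X H1 unfolding A_def B_def by linarith+
      have N: "N \<ge> 1" "real N \<ge> X ^ 4" "real N \<le> X ^ 5"
      proof -
        have "X ^ 4 \<ge> 1" using X by (simp add: one_le_power)
        then have ce: "\<lceil>X ^ 4\<rceil> \<ge> 1" by linarith
        then show "N \<ge> 1" unfolding N_def by linarith
        have eq: "real N = of_int \<lceil>X ^ 4\<rceil>" using ce by (simp add: N_def)
        show "real N \<ge> X ^ 4" unfolding eq by simp
        have "real N \<le> X ^ 4 + 1" unfolding eq by linarith
        also have "\<dots> \<le> 4 * X ^ 4" using \<open>X ^ 4 \<ge> 1\<close> by linarith
        also have "\<dots> \<le> X * X ^ 4" using X by (intro mult_right_mono) auto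
        finally show "real N \<le> X ^ 5" by (simp add: power_Suc[symmetric] del: power_Suc)
      qed
      \<comment> \<open>The allowance X^(1/6) is what turns X^(1/2) into X^(2/3), so that the
        off-diagonal terms are at most a multiple of H.\<close>
      have harm: "(harm N)\<^sup>2 \<le> X powr (1/6)"
      proof -
        have "ln (real N) \<le> ln (X ^ 5)" using N X by (subst ln_le_cancel_iff) auto
        also have "\<dots> = 5 * ln X" using X by (simp add: ln_realpow)
        finally have "harm N \<le> 1 + 5 * ln X" using harm_le_one_plus_ln[OF N(1)] by linarith
        then have "(harm N)\<^sup>2 \<le> (1 + 5 * ln X)\<^sup>2" by (intro power_mono harm_nonneg)
        then show ?thesis using elim by linarith
      qed
      have F: "finite F" "\<And>n. n \<in> F \<Longrightarrow> A \<le> real n \<and> real n + 1 \<le> B"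
        unfolding F_def A_def B_def using finite_short_interval by auto
      have card: "real (card F) \<le> 3 * H"
        using sum_unit_integrals_le[of F A B "\<lambda>_. 1", OF F] AB by simp
      have "sqrt B * (harm N)\<^sup>2 \<le> 2 * X powr (1/2) * X powr (1/6)"
      proof (rule mult_mono[OF _ harm])
        have "sqrt B \<le> sqrt (4 * X)" using AB X by (intro real_sqrt_le_mono) linarith
        also have "\<dots> = 2 * X powr (1/2)" using X by (simp add: real_sqrt_mult powr_half_sqrt)
        finally show "sqrt B \<le> 2 * X powr (1/2)" .
      qed (use X in auto)
      also have "\<dots> = 2 * X powr (2/3)" by (simp add: powr_add[symmetric])
      also have "\<dots> \<le> 2 * H" using H by simp
      finally have Q: "(B - A) + sqrt B * (harm N)\<^sup>2 \<le> 5 * H" using AB by linarith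
      have BM: "B powr (real k - 1/2) \<le> M" unfolding M_def using AB k by (intro powr_mono2) auto
      have M0: "M \<ge> 0" by (simp add: M_def)
      have int: "(\<Sum>n\<in>F. integral {real n..real n + 1} (\<lambda>x. (cmod (voronoi_head k a N x))\<^sup>2)) \<le> K2 * M * (5 * H)"
      proof -
        have "(\<Sum>n\<in>F. integral {real n..real n + 1} (\<lambda>x. (cmod (voronoi_head k a N x))\<^sup>2)) \<le>
           integral {A..B} (\<lambda>x. (cmod (voronoi_head k a N x))\<^sup>2)"
          by (intro sum_unit_integrals_le F continuous_intros continuous_on_voronoi_head) auto
        also have "\<dots> \<le> K2 * B powr (real k - 1/2) * ((B - A) + sqrt B * (harm N)\<^sup>2)"
          using K2(2) AB by blast
        also have "\<dots> \<le> K2 * M * (5 * H)"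
          using K2(1) BM Q M0 AB X by (intro mult_mono mult_left_mono mult_nonneg_nonneg add_nonneg_nonneg) auto
        finally show ?thesis .
      qed
      have tail: "K1 * (real n + 1) powr (real k + 1/2) * real N powr (- 1/4) \<le> 2 * K1 * M" if "n \<in> F" for n
      proof -
        have "(real n + 1) powr (real k + 1/2) \<le> (2 * X) powr (real k + 1/2)"
          using F(2)[OF that] AB by (intro powr_mono2) auto
        also have "(2 * X) powr (real k + 1/2) = M * (2 * X) powr 1"
          unfolding M_def powr_add[symmetric] by (simp add: add.commute)
        also have "\<dots> = M * (2 * X)" using X by simp
        finally have 1: "(real n + 1) powr (real k + 1/2) \<le> M * (2 * X)" .
        have "real N powr (- 1/4) \<le> (X ^ 4) powr (- 1/4)" using N X by (intro powr_mono2') auto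
        also have "(X ^ 4) powr (- 1/4) = (X powr 4) powr (- 1/4)" using X by (simp add: powr_numeral)
        also have "\<dots> = X powr (- 1)" unfolding powr_powr by simp
        also have "\<dots> = 1 / X" using X by (simp add: powr_minus_divide)
        finally have "(real n + 1) powr (real k + 1/2) * real N powr (- 1/4) \<le> (M * (2 * X)) * (1 / X)"
          using 1 X M0 by (intro mult_mono) auto
        also have "\<dots> = 2 * M" using X by simp
        finally have "K1 * ((real n + 1) powr (real k + 1/2) * real N powr (- 1/4)) \<le> K1 * (2 * M)"
          using K1(1) by (intro mult_left_mono)
        then show ?thesis by (simp add: mult_ac)
      qed
      have S: "(\<Sum>n\<in>F. (cmod (coeff_sum a n))\<^sup>2) \<le> K3 * M * H"
      proof -
        have "(\<Sum>n\<in>F. (cmod (coeff_sum a n))\<^sup>2) \<le>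
          (\<Sum>n\<in>F. K1 * integral {real n..real n + 1} (\<lambda>x. (cmod (voronoi_head k a N x))\<^sup>2) + 2 * K1 * M)"
        proof (rule sum_mono)
          fix n assume n: "n \<in> F"
          then have "n \<ge> 1" by (simp add: F_def)
          then have "(cmod (coeff_sum a n))\<^sup>2 \<le> K1 * integral {real n..real n + 1} (\<lambda>x. (cmod (voronoi_head k a N x))\<^sup>2)
            + K1 * (real n + 1) powr (real k + 1/2) * real N powr (- 1/4)"
            using K1(2) N(1) by blast
          then show "(cmod (coeff_sum a n))\<^sup>2 \<le> K1 * integral {real n..real n + 1} (\<lambda>x. (cmod (voronoi_head k a N x))\<^sup>2) + 2 * K1 * M"
            using tail[OF n] by linarith
        qed
        also have "\<dots> = K1 * (\<Sum>n\<in>F. integral {real n..real n + 1} (\<lambda>x. (cmod (voronoi_head k a N x))\<^sup>2)) + real (card F) * (2 * K1 * M)"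
          by (simp add: sum.distrib sum_distrib_left)
        also have "\<dots> \<le> K1 * (K2 * M * (5 * H)) + (3 * H) * (2 * K1 * M)"
          using int card K1(1) M0 by (intro add_mono mult_left_mono mult_right_mono) auto
        also have "\<dots> = K3 * M * H" by (simp add: K3_def algebra_simps)
        finally show ?thesis .
      qed
      have "short_sum k a X H \<le> (\<Sum>n\<in>F. (cmod (coeff_sum a n))\<^sup>2 / (X / 2) ^ (k - 1))"
        unfolding short_sum_def F_def[symmetric]
      proof (rule sum_mono)
        fix n assume "n \<in> F"
        then have "X / 2 \<le> real n" using F(2) AB by force
        then show "(cmod (coeff_sum a n))\<^sup>2 / real n ^ (k - 1) \<le> (cmod (coeff_sum a n))\<^sup>2 / (X / 2) ^ (k - 1)"
          using X by (intro divide_left_mono power_mono mult_pos_pos zero_less_power) auto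
      qed
      also have "\<dots> = (\<Sum>n\<in>F. (cmod (coeff_sum a n))\<^sup>2) / (X / 2) ^ (k - 1)"
        by (simp add: sum_divide_distrib)
      also have "\<dots> \<le> K3 * M * H / (X / 2) ^ (k - 1)" using S X by (intro divide_right_mono) auto
      also have "\<dots> = K * H * X powr (1/2)"
      proof -
        have "real k - 1/2 = real (k - 1) + 1/2" using k by (simp add: of_nat_diff)
        then have "X powr (real k - 1/2) = X ^ (k - 1) * X powr (1/2)"
          using X by (simp only: powr_add powr_realpow)
        then have "M = 2 powr (real k - 1/2) * (X ^ (k - 1) * X powr (1/2))"
          unfolding M_def by (simp only: powr_mult)
        then show ?thesis using X unfolding K_def by (simp add: power_divide field_simps)
      qed
      finally show "short_sum k a X H \<le> K * H * X powr (1/2)" .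
    qed
  qed
  moreover have "K \<ge> 0" using K3 by (simp add: K_def)
  ultimately show ?thesis by blast
qed

theorem theorem2:
  fixes k :: nat and f :: "complex \<Rightarrow> complex" and a :: "nat \<Rightarrow> complex"
  assumes "k \<ge> 2"
    and "cusp_form_SL2Z k f"
    and "cusp_fourier_expansion f a"
  shows "(\<forall>\<delta>::real. \<delta> > 1/2 \<longrightarrow>
            (\<exists>K::real. \<forall>C::real. C > 0 \<longrightarrow>
               (\<forall>\<^sub>F X::real in at_top. \<forall>y::real. 2 \<le> y \<and> y \<le> C * X powr (1 - \<delta>) \<longrightarrow>
                  short_sum k a X (X / y) \<le>
                    K * (X powr (3/2) / y + X powr (1/2) * y\<^sup>2 * ln y powr (1/2))))) \<and>
         (\<lambda>X::real. 1 / (X powr (2/3) * ln X powr (1/6)) *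
              short_sum k a X (X powr (2/3) * ln X powr (1/6)))
           \<in> O[at_top](\<lambda>X. X powr (1/2))"
proof -
  have "k \<ge> 1" using assms(1) by simp
  from short_sum_bound[OF assms(2,3) this] obtain K where K: "K \<ge> 0"
    and bound: "\<forall>\<^sub>F X in at_top. \<forall>H. X powr (2/3) \<le> H \<and> H \<le> X / 2 \<longrightarrow> short_sum k a X H \<le> K * H * X powr (1/2)"
    by (elim exE conjE)
  have "\<forall>\<^sub>F X::real in at_top. X powr (2/3) \<le> X / 2" by real_asymp
  then have main: "\<forall>\<^sub>F X::real in at_top. \<forall>y::real. 2 \<le> y \<longrightarrow>
      short_sum k a X (X / y) \<le> 2 * K * (X powr (3/2) / y + X powr (1/2) * y\<^sup>2 * ln y powr (1/2))"
    using bound eventually_gt_at_top[of 0]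
  proof eventually_elim
    case (elim X)
    then have X: "X > 0" "X powr (2/3) \<le> X / 2"
      and le: "\<And>H. X powr (2/3) \<le> H \<Longrightarrow> H \<le> X / 2 \<Longrightarrow> short_sum k a X H \<le> K * H * X powr (1/2)"
      by auto
    show ?case
    proof (intro allI impI)
      fix y :: real assume y: "2 \<le> y"
      \<comment> \<open>A constant lower bound suffices here; 1/4 is a convenient square below ln
        2.\<close>
      have "1/2 \<le> ln y powr (1/2)"
      proof -
        have "ln 2 \<le> ln y" using y by simp
        then have "1/4 \<le> ln y" using ln2_ge_two_thirds by linarith
        then have "(1/4) powr (1/2) \<le> ln y powr (1/2)" by (intro powr_mono2) auto
        moreover have "(1/4::real) powr (1/2) = 1/2" by (simp add: powr_half_sqrt real_sqrt_divide)
        ultimately show ?thesis by simp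
      qed
      show "short_sum k a X (X / y) \<le> 2 * K * (X powr (3/2) / y + X powr (1/2) * y\<^sup>2 * ln y powr (1/2))"
      \<comment> \<open>At this threshold the two terms on the right exchange dominance: longer
        intervals are paid for by X^(3/2) / y, shorter ones by X^(1/2) y^2.\<close>
      proof (cases "X powr (2/3) \<le> X / y")
        case True
        have "X / y \<le> X / 2" using X y by (intro divide_left_mono) auto
        then have "short_sum k a X (X / y) \<le> K * (X / y) * X powr (1/2)" by (rule le[OF True])
        also have "\<dots> = K * (X powr 1 * X powr (1/2) / y)" using X by simp
        also have "X powr 1 * X powr (1/2) = X powr (3/2)" unfolding powr_add[symmetric] by simp
        also have "K * (X powr (3/2) / y) \<le> 2 * K * (X powr (3/2) / y)"
          using K y by (intro mult_right_mono) auto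
        also have "\<dots> \<le> 2 * K * (X powr (3/2) / y + X powr (1/2) * y\<^sup>2 * ln y powr (1/2))"
          using K by (intro mult_left_mono) auto
        finally show ?thesis .
      next
        case False
        have "X powr (1/3) \<le> y"
        proof -
          have "X powr 1 = X powr (1/3) * X powr (2/3)" unfolding powr_add[symmetric] by simp
          then have "X powr (1/3) * X powr (2/3) < y * X powr (2/3)"
            using False X y by (simp add: field_simps)
          then show ?thesis using X by simp
        qed
        then have "X powr (1/3) * X powr (1/3) \<le> y * y" using y by (intro mult_mono) auto
        then have y2: "X powr (2/3) \<le> y\<^sup>2" by (simp add: powr_add[symmetric] power2_eq_square)
        \<comment> \<open>The interval is enlarged to the shortest admissible half-length X^(2/3);
          since y is at least X^(1/3) here, the result X^(7/6) is at most X^(1/2) y^2.\<close>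
        have "short_sum k a X (X / y) \<le> short_sum k a X (X powr (2/3))"
          using False by (intro short_sum_mono) simp
        also have "\<dots> \<le> K * X powr (2/3) * X powr (1/2)" using X by (intro le) auto
        also have "\<dots> = 2 * K * (X powr (1/2) * X powr (2/3) * (1/2))" by simp
        also have "\<dots> \<le> 2 * K * (X powr (1/2) * y\<^sup>2 * ln y powr (1/2))"
          using K y2 \<open>1/2 \<le> ln y powr (1/2)\<close> by (intro mult_left_mono mult_mono) auto
        also have "\<dots> \<le> 2 * K * (X powr (3/2) / y + X powr (1/2) * y\<^sup>2 * ln y powr (1/2))"
          using K y by (intro mult_left_mono) auto
        finally show ?thesis .
      qed
    qed
  qed
  have "\<forall>\<delta>::real. \<delta> > 1/2 \<longrightarrow> (\<exists>K::real. \<forall>C::real. C > 0 \<longrightarrow>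
      (\<forall>\<^sub>F X::real in at_top. \<forall>y::real. 2 \<le> y \<and> y \<le> C * X powr (1 - \<delta>) \<longrightarrow>
         short_sum k a X (X / y) \<le> K * (X powr (3/2) / y + X powr (1/2) * y\<^sup>2 * ln y powr (1/2))))"
    by (intro allI impI exI[of _ "2 * K"] eventually_mono[OF main]) auto
  moreover have "(\<lambda>X::real. 1 / (X powr (2/3) * ln X powr (1/6)) *
      short_sum k a X (X powr (2/3) * ln X powr (1/6))) \<in> O[at_top](\<lambda>X. X powr (1/2))"
  proof (rule bigoI[where c = K])
    have "\<forall>\<^sub>F X::real in at_top. X powr (2/3) * ln X powr (1/6) \<le> X / 2" by real_asymp
    moreover have "\<forall>\<^sub>F X::real in at_top. X powr (2/3) \<le> X powr (2/3) * ln X powr (1/6)" by real_asymp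
    ultimately show "\<forall>\<^sub>F X::real in at_top. norm (1 / (X powr (2/3) * ln X powr (1/6)) *
      short_sum k a X (X powr (2/3) * ln X powr (1/6))) \<le> K * norm (X powr (1/2))"
      using bound eventually_gt_at_top[of 0]
    proof eventually_elim
      case (elim X)
      \<comment> \<open>For large X this half-length lies between X^(2/3) and X / 2, so the short
        interval bound applies directly and only has to be divided by H.\<close>
      define H where "H = X powr (2/3) * ln X powr (1/6)"
      have "0 < X powr (2/3)" using elim by simp
      then have "H > 0" using elim unfolding H_def by linarith
      have "short_sum k a X H \<le> K * H * X powr (1/2)" using elim unfolding H_def by blast
      then have "1 / H * short_sum k a X H \<le> K * X powr (1/2)"
        using \<open>H > 0\<close> by (simp add: field_simps)
      moreover have "1 / H * short_sum k a X H \<ge> 0" using \<open>H > 0\<close> short_sum_nonneg by simp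
      ultimately show ?case unfolding H_def[symmetric] by simp
    qed
  qed
  ultimately show ?thesis by blast
qed

end
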